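(* Let $X$ be an Asplund space, $\varphi:X\to\,]-\infty,+\infty]$ be proper and lower semicontinuous, and $\alpha>0$. Then $\varphi$ is $\alpha$-robustly quasiconvex if and only if for all $(x,x^* ),(y,y^* )$ with $x^*\in\widehat\partial\varphi(x)$ and $y^*\in\widehat\partial\varphi(y)$, $$\min\{\langle x^*,y-x\rangle,\ \langle y^*,x-y\rangle\}>-\alpha\|y-x\|\ \Longrightarrow\ \langle x^*-y^*,x-y\rangle\ge 0.$$
   Context: A function $f$ is quasiconvex if $f(\lambda x+(1-\lambda)y)\le\max\{f(x),f(y)\}$ for all $x,y\in X$, $\lambda\in\,]0,1[$. For $v^*\in X^*$, $\varphi_{v^*}(x):=\varphi(x)+\langle v^*,x\rangle$. $\varphi$ is $\alpha$-robustly quasiconvex if $\varphi_{v^*}$ is quasiconvex for every $v^*\in X^*$ with $\|v^*\|\le\alpha$. For $x\in\operatorname{dom}\varphi=\{x:\varphi(x)<\infty\}$, the Fréchet subdifferential is $\widehat\partial\varphi(x)=\{x^*\in X^*:\ \liminf_{y\to x}\frac{\varphi(y)-\varphi(x)-\langle x^*,y-x\rangle}{\|y-x\|}\ge 0\}$, and $\widehat\partial\varphi(x)=\emptyset$ otherwise. An Asplund space is a Banach space every separable subspace of which has separable dual. *)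

theory Defs
  imports "HOL-Analysis.Analysis"
begin

text \<open>Extended-real-valued functions \<open>X \<rightarrow> ]-\<infinity>,+\<infinity>]\<close> are modelled as \<open>'a \<Rightarrow> ereal\<close>
  never taking the value \<open>-\<infinity>\<close>. The dual space \<open>X*\<close> is \<open>'a \<Rightarrow>\<^sub>L real\<close>.\<close>

definition edom :: "('a \<Rightarrow> ereal) \<Rightarrow> 'a set" where
  "edom f = {x. f x < \<infinity>}"

definition proper_fun :: "('a \<Rightarrow> ereal) \<Rightarrow> bool" where
  "proper_fun f \<longleftrightarrow> (\<forall>x. f x \<noteq> -\<infinity>) \<and> edom f \<noteq> {}"

definition lsc_fun :: "('a::topological_space \<Rightarrow> ereal) \<Rightarrow> bool" where
  "lsc_fun f \<longleftrightarrow> (\<forall>x. f x \<le> Liminf (at x) f)"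

definition quasiconvex_fun :: "('a::real_vector \<Rightarrow> ereal) \<Rightarrow> bool" where
  "quasiconvex_fun f \<longleftrightarrow>
     (\<forall>x y. \<forall>t::real. 0 < t \<and> t < 1 \<longrightarrow>
        f (t *\<^sub>R x + (1 - t) *\<^sub>R y) \<le> max (f x) (f y))"

definition tilt :: "('a::real_normed_vector \<Rightarrow> ereal) \<Rightarrow> ('a \<Rightarrow>\<^sub>L real) \<Rightarrow> 'a \<Rightarrow> ereal" where
  "tilt f v x = f x + ereal (blinfun_apply v x)"

definition robustly_quasiconvex :: "real \<Rightarrow> ('a::real_normed_vector \<Rightarrow> ereal) \<Rightarrow> bool" where
  "robustly_quasiconvex \<alpha> f \<longleftrightarrow> (\<forall>v::'a \<Rightarrow>\<^sub>L real. norm v \<le> \<alpha> \<longrightarrow> quasiconvex_fun (tilt f v))"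

definition frechet_subdiff :: "('a::real_normed_vector \<Rightarrow> ereal) \<Rightarrow> 'a \<Rightarrow> ('a \<Rightarrow>\<^sub>L real) set" where
  "frechet_subdiff f x =
     (if x \<in> edom f then
        {v. Liminf (at x) (\<lambda>y. (f y - f x - ereal (blinfun_apply v (y - x))) / ereal (norm (y - x))) \<ge> 0}
      else {})"

definition separable_set :: "'a::metric_space set \<Rightarrow> bool" where
  "separable_set S \<longleftrightarrow> (\<exists>D. countable D \<and> D \<subseteq> S \<and> S \<subseteq> closure D)"

text \<open>The (topological) dual of a linear subspace \<open>Y\<close>: continuous linear functionals on \<open>Y\<close>,
  normalised to be \<open>0\<close> outside \<open>Y\<close>, with the dual norm.\<close>
definition subspace_dual :: "'a::real_normed_vector set \<Rightarrow> ('a \<Rightarrow> real) set" where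
  "subspace_dual Y = {f. (\<forall>x\<in>Y. \<forall>y\<in>Y. f (x + y) = f x + f y)
                       \<and> (\<forall>c. \<forall>x\<in>Y. f (c *\<^sub>R x) = c * f x)
                       \<and> (\<exists>K. \<forall>x\<in>Y. \<bar>f x\<bar> \<le> K * norm x)
                       \<and> (\<forall>x. x \<notin> Y \<longrightarrow> f x = 0)}"

definition dual_norm :: "'a::real_normed_vector set \<Rightarrow> ('a \<Rightarrow> real) \<Rightarrow> real" where
  "dual_norm Y f = (SUP x\<in>{x\<in>Y. norm x \<le> 1}. \<bar>f x\<bar>)"

definition separable_dual :: "'a::real_normed_vector set \<Rightarrow> bool" where
  "separable_dual Y \<longleftrightarrow> (\<exists>D. countable D \<and> D \<subseteq> subspace_dual Y \<and>
      (\<forall>f\<in>subspace_dual Y. \<forall>e>0. \<exists>g\<in>D. dual_norm Y (\<lambda>x. f x - g x) < e))"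

definition asplund :: "'a::banach itself \<Rightarrow> bool" where
  "asplund _ \<longleftrightarrow> (\<forall>Y::'a set. subspace Y \<and> separable_set Y \<longrightarrow> separable_dual Y)"

end

theory Submission
  imports Defs
begin

text \<open>If \<open>\<phi>\<close> is robustly quasiconvex and two subgradients violate the implication, Hahn-Banach gives a tilt
  \<open>v\<close> with \<open>\<parallel>v\<parallel> \<le> \<alpha>\<close> for which both tilted subgradients point strictly towards the other point, so the tilted
  function would increase strictly in both directions.

  Conversely, if some tilt \<open>f\<close> of \<open>\<phi>\<close> is not quasiconvex, two applications of an approximate mean value theorem
  produce a pair of subgradients of \<open>f\<close> pointing strictly towards each other. The mean value theorem (for
  \<open>f a < f b\<close> and \<open>p\<close> beyond \<open>b\<close> there is a subgradient \<open>w*\<close> at some \<open>w\<close> near \<open>[a, b]\<close> with \<open>w*(p - w) > 0\<close>) is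
  first proved on a closed separable subspace \<open>Y\<close>. As \<open>Y\<close> has a separable dual, its norm is approximated by
  Frechet smooth convex functions \<open>N\<close>, and one minimises \<open>f u + K N (u - (a + t (b - a))) - \<rho> t\<close> over
  \<open>(u, t)\<close> by a smooth variational principle: stationarity in \<open>u\<close> gives the subgradient, stationarity in \<open>t\<close>
  the sign. By Hahn-Banach the existence of a subgradient at \<open>w\<close> amounts to inequalities between finitely many
  points each, so \<open>Y\<close> can be chosen such that the subgradient relative to \<open>Y\<close> yields one in the whole space.\<close>

section \<open>The Hahn-Banach theorem\<close>

text \<open>A norm cannot serve as the penalty, since it is not differentiable at 0, and a smooth
  equivalent norm has the same defect. Giving up homogeneity and accepting an additive error
  \<kappa> gives functions differentiable everywhere, so all later constants must absorb such
  errors. This is why \<open>p\<close> lies strictly beyond \<open>b\<close>: stationarity in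
  \<open>t\<close> yields a slope \<rho> along the segment, and for p = b the resulting margin (1 -
  t) \<rho> could be arbitrarily small, whereas the surplus length \<open>s\<close> guarantees s
  \<rho>. Only an increase of \<open>t\<close> is ever tested, so a minimum at t = 0 is harmless,
  and t = 1 is excluded because \<open>f\<close> is large near \<open>b\<close>.

  The two opposing subgradients are found one after the other: the tolerance of the second search
  depends on the norm of the first subgradient.

  In the separable reduction the norm bound of the subgradient is fixed in advance. It makes the
  inequalities Lipschitz in the base point, with a constant that ignores the chosen points.\<close>

definition sublinear :: "('a::real_vector \<Rightarrow> real) \<Rightarrow> bool" where
  "sublinear p \<longleftrightarrow> (\<forall>x y. p (x + y) \<le> p x + p y) \<and> (\<forall>c x. 0 \<le> c \<longrightarrow> p (c *\<^sub>R x) = c * p x)"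

lemma sublinearD:
  assumes "sublinear p"
  shows "p (x + y) \<le> p x + p y" "0 \<le> c \<Longrightarrow> p (c *\<^sub>R x) = c * p x" "p 0 = 0" "- p (- x) \<le> p x"
proof -
  show 1: "p (x + y) \<le> p x + p y" for x y using assms by (simp add: sublinear_def)
  show 2: "0 \<le> c \<Longrightarrow> p (c *\<^sub>R x) = c * p x" for c x using assms by (simp add: sublinear_def)
  show 3: "p 0 = 0" using 2[of 0 0] by simp
  show "- p (- x) \<le> p x" using 1[of x "- x"] 3 by simp
qed

text \<open>Applying the inequality for \<open>c\<close> to \<open>inverse c\<close> gives the
  opposite one, so half of positive homogeneity suffices.\<close>

lemma sublinearI:
  assumes "\<And>x y. p (x + y) \<le> p x + p y"
    and le: "\<And>c x. 0 < c \<Longrightarrow> p (c *\<^sub>R x) \<le> c * p x" and "p 0 = (0::real)"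
  shows "sublinear p"
  unfolding sublinear_def
proof (intro conjI allI impI)
  fix c :: real and x assume "0 \<le> c"
  show "p (c *\<^sub>R x) = c * p x"
  proof (cases "c = 0")
    case False
    with \<open>0 \<le> c\<close> have c: "0 < c" by simp
    have "p x \<le> inverse c * p (c *\<^sub>R x)" using le[of "inverse c" "c *\<^sub>R x"] c by (simp add: scaleR_scaleR)
    then have "c * p x \<le> p (c *\<^sub>R x)" using c by (simp add: field_simps)
    then show ?thesis using le[OF c, of x] by simp
  qed (use assms in simp)
qed (use assms in simp)

text \<open>The pointwise infimum of the chain works; it is finite because every member satisfies -
  q (- x) \<le> - p (- x) \<le> p x.\<close>

lemma sublinear_minorant_chain:
  fixes q :: "'a::real_vector \<Rightarrow> real"
  assumes "C \<noteq> {}" and C: "\<And>p. p \<in> C \<Longrightarrow> sublinear p \<and> p \<le> q"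
    and chain: "\<And>p r. p \<in> C \<Longrightarrow> r \<in> C \<Longrightarrow> p \<le> r \<or> r \<le> p"
  shows "\<exists>m. sublinear m \<and> m \<le> q \<and> (\<forall>p\<in>C. m \<le> p)"
proof -
  define m where "m x = (INF p\<in>C. p x)" for x
  have bdd: "bdd_below ((\<lambda>p. p x) ` C)" for x
  proof (rule bdd_belowI2[where m = "- q (- x)"])
    fix p assume "p \<in> C"
    then show "- q (- x) \<le> p x"
      using C[of p] sublinearD(4)[of p x] le_funD[of p q "- x"] by auto
  qed
  have low: "m x \<le> p x" if "p \<in> C" for p x
    unfolding m_def by (rule cINF_lower[OF bdd that])
  have near: "\<exists>p\<in>C. p x < m x + e" if "0 < e" for x e
  proof -
    have "(INF p\<in>C. p x) < m x + e" using that by (simp add: m_def)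
    then show ?thesis by (subst (asm) cINF_less_iff[OF \<open>C \<noteq> {}\<close> bdd]) 
  qed
  have "sublinear m"
  proof (rule sublinearI)
    fix x y
    show "m (x + y) \<le> m x + m y"
    proof (rule field_le_epsilon)
      fix e :: real assume "0 < e"
      then obtain p r where p: "p \<in> C" "p x < m x + e/2" and r: "r \<in> C" "r y < m y + e/2"
        using near[of "e/2"] by (metis half_gt_zero)
      \<comment> \<open>The smaller of the two chain members almost attains both infima at once,
        which subadditivity requires.\<close>
      define s where "s = (if p \<le> r then p else r)"
      have s: "s \<in> C" "s \<le> p" "s \<le> r" using chain[OF p(1) r(1)] p r by (auto simp: s_def)
      have "m (x + y) \<le> s x + s y"
        using low[OF s(1), of "x + y"] C[OF s(1)] sublinearD(1)[of s x y] by linarith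
      also have "\<dots> \<le> p x + r y" using s by (simp add: le_fun_def add_mono)
      finally show "m (x + y) \<le> m x + m y + e" using p r by simp
    qed
  next
    fix c :: real and x assume c: "0 < c"
    show "m (c *\<^sub>R x) \<le> c * m x"
    proof (rule field_le_epsilon)
      fix e :: real assume "0 < e"
      then obtain p where p: "p \<in> C" "p x < m x + e/c" using near[of "e/c"] c by fastforce
      have "m (c *\<^sub>R x) \<le> c * p x"
        using low[OF p(1), of "c *\<^sub>R x"] C[OF p(1)] sublinearD(2)[of p c x] c by simp
      also have "\<dots> \<le> c * (m x + e/c)" using p c by simp
      finally show "m (c *\<^sub>R x) \<le> c * m x + e" using c by (simp add: algebra_simps)
    qed
  next
    have "(\<lambda>p. p 0) ` C = {0}" using C sublinearD(3) \<open>C \<noteq> {}\<close> by (auto simp: image_iff)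
    then show "m 0 = 0" by (simp add: m_def)
  qed
  moreover have "m \<le> q" using low C \<open>C \<noteq> {}\<close> by (meson ex_in_conv le_fun_def order_trans)
  ultimately show ?thesis using low by (auto simp: le_fun_def)
qed

text \<open>If a sublinear \<open>p\<close> has no sublinear minorant but itself, comparing it with
  \<open>x \<mapsto> inf\<^sub>t (p (x + t y) - t p y)\<close> shows that it is additive.\<close>

lemma minimal_sublinear_additive:
  fixes p :: "'a::real_vector \<Rightarrow> real"
  assumes p: "sublinear p" and min: "\<And>r. sublinear r \<Longrightarrow> r \<le> p \<Longrightarrow> r = p"
  shows "p (x + y) = p x + p y"
proof -
  define r where "r x = (INF t\<in>{0..}. p (x + t *\<^sub>R y) - t * p y)" for x
  \<comment> \<open>Sublinearity gives t p y = p (t y) \<le> p (x + t y) + p (- x).\<close>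
  have bdd: "bdd_below ((\<lambda>t. p (x + t *\<^sub>R y) - t * p y) ` {0..})" for x
  proof (rule bdd_belowI2[where m = "- p (- x)"])
    fix t :: real assume "t \<in> {0..}"
    then show "- p (- x) \<le> p (x + t *\<^sub>R y) - t * p y"
      using sublinearD(1)[OF p, of "x + t *\<^sub>R y" "- x"] sublinearD(2)[OF p, of t y] by simp
  qed
  have low: "r x \<le> p (x + t *\<^sub>R y) - t * p y" if "0 \<le> t" for x t
    unfolding r_def by (rule cINF_lower[OF bdd]) (use that in simp)
  have near: "\<exists>t\<ge>0. p (x + t *\<^sub>R y) - t * p y < r x + e" if "0 < e" for x e
  proof -
    have "(INF t\<in>{0..}. p (x + t *\<^sub>R y) - t * p y) < r x + e" using that by (simp add: r_def)
    then show ?thesis by (subst (asm) cINF_less_iff[OF _ bdd]) auto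
  qed
  have "sublinear r"
  proof (rule sublinearI)
    fix a b
    show "r (a + b) \<le> r a + r b"
    proof (rule field_le_epsilon)
      fix e :: real assume "0 < e"
      then obtain t s where t: "0 \<le> t" "p (a + t *\<^sub>R y) - t * p y < r a + e/2"
        and s: "0 \<le> s" "p (b + s *\<^sub>R y) - s * p y < r b + e/2"
        using near[of "e/2"] by (metis half_gt_zero)
      have "r (a + b) \<le> p ((a + b) + (t + s) *\<^sub>R y) - (t + s) * p y" using low t s by simp
      also have "(a + b) + (t + s) *\<^sub>R y = (a + t *\<^sub>R y) + (b + s *\<^sub>R y)"
        by (simp add: algebra_simps)
      also have "p \<dots> - (t + s) * p y \<le> p (a + t *\<^sub>R y) + p (b + s *\<^sub>R y) - (t + s) * p y"
        using sublinearD(1)[OF p] by simp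
      finally show "r (a + b) \<le> r a + r b + e" using t s by (simp add: algebra_simps)
    qed
  next
    fix c :: real and a assume c: "0 < c"
    show "r (c *\<^sub>R a) \<le> c * r a"
    proof (rule field_le_epsilon)
      fix e :: real assume "0 < e"
      then obtain t where t: "0 \<le> t" "p (a + t *\<^sub>R y) - t * p y < r a + e/c"
        using near[of "e/c" a] c by fastforce
      have "r (c *\<^sub>R a) \<le> p (c *\<^sub>R a + (c * t) *\<^sub>R y) - (c * t) * p y" using low t c by simp
      also have "c *\<^sub>R a + (c * t) *\<^sub>R y = c *\<^sub>R (a + t *\<^sub>R y)" by (simp add: algebra_simps)
      also have "p \<dots> = c * p (a + t *\<^sub>R y)" using sublinearD(2)[OF p] c by simp
      also have "\<dots> - (c * t) * p y = c * (p (a + t *\<^sub>R y) - t * p y)" by (simp add: algebra_simps)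
      also have "\<dots> \<le> c * (r a + e/c)" using t c by simp
      finally show "r (c *\<^sub>R a) \<le> c * r a + e" using c by (simp add: algebra_simps)
    qed
  next
    have "- e \<le> r 0" if "0 < e" for e :: real
      using near[OF that, of 0] sublinearD(2)[OF p] by force
    then have "0 \<le> r 0" by (metis field_le_epsilon diff_0 diff_le_eq)
    moreover have "r 0 \<le> 0" using low[of 0 0] sublinearD(3)[OF p] by simp
    ultimately show "r 0 = 0" by simp
  qed
  moreover have "r \<le> p" using low[of 0] by (simp add: le_fun_def)
  ultimately have "r = p" by (rule min)
  \<comment> \<open>Minimality makes \<open>r\<close> equal to \<open>p\<close>; the choice t = 1 in
    the infimum is then superadditivity.\<close>
  then have "p x \<le> p (x + y) - p y" using low[of 1 x] by simp
  then show ?thesis using sublinearD(1)[OF p, of x y] by simp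
qed

text \<open>Zorn's lemma for the reversed pointwise order yields a minimal sublinear minorant. Such
  a minorant is additive and positively homogeneous, hence linear.\<close>

theorem Hahn_Banach_sublinear:
  fixes q :: "'a::real_vector \<Rightarrow> real"
  assumes q: "sublinear q"
  shows "\<exists>g. linear g \<and> (\<forall>x. g x \<le> q x)"
proof -
  define A where "A = {p. sublinear p \<and> p \<le> q}"
  have "\<exists>m\<in>A. \<forall>p\<in>A. p \<le> m \<longrightarrow> p = m"
  proof (rule predicate_Zorn)
    show "partial_order_on A (relation_of (\<lambda>p r. r \<le> p) A)"
      by (rule partial_order_on_relation_ofI) auto
  next
    fix C assume C: "C \<in> Chains (relation_of (\<lambda>p r. r \<le> p) A)"
    then have CA: "C \<subseteq> A" by (rule Chains_relation_of)
    show "\<exists>u\<in>A. \<forall>a\<in>C. u \<le> a"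
    proof (cases "C = {}")
      case False
      have "\<exists>m. sublinear m \<and> m \<le> q \<and> (\<forall>p\<in>C. m \<le> p)"
        using C CA by (intro sublinear_minorant_chain False)
          (auto simp: A_def Chains_def relation_of_def)
      then show ?thesis by (auto simp: A_def)
    qed (use q in \<open>auto simp: A_def\<close>)
  qed
  then obtain m where m: "sublinear m" "m \<le> q"
    and min: "\<And>p. sublinear p \<Longrightarrow> p \<le> m \<Longrightarrow> p = m"
    unfolding A_def by (metis (mono_tags, lifting) mem_Collect_eq order_trans)
  have add: "m (x + y) = m x + m y" for x y
    by (rule minimal_sublinear_additive[OF m(1) min])
  have neg: "m (- x) = - m x" for x using add[of x "- x"] sublinearD(3)[OF m(1)] by simp
  have "linear m"
  proof (rule linearI)
    fix c :: real and x
    show "m (c *\<^sub>R x) = c *\<^sub>R m x"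
    proof (cases "0 \<le> c")
      case False
      then have "m ((- c) *\<^sub>R x) = (- c) * m x" using sublinearD(2)[OF m(1), of "- c" x] by linarith
      then show ?thesis using neg[of "c *\<^sub>R x"] by simp
    qed (use sublinearD(2)[OF m(1)] in simp)
  qed (rule add)
  then show ?thesis using m(2) by (auto simp: le_fun_def)
qed

section \<open>Solvability of systems of linear inequalities\<close>

text \<open>This lets the solvability criterion below be tested on rational weights, of which there
  are only countably many; the constraints themselves stay real.\<close>

lemma rational_weights_approx:
  fixes l :: "(real \<times> 'a::real_normed_vector \<times> real) list"
  assumes "\<forall>(\<mu>, h, r) \<in> set l. 0 \<le> \<mu> \<and> (h, r) \<in> A" and "0 < e"
  shows "\<exists>l'. (\<forall>(\<mu>, h, r) \<in> set l'. 0 \<le> \<mu> \<and> \<mu> \<in> \<rat> \<and> (h, r) \<in> A)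
     \<and> \<bar>(\<Sum>(\<mu>, h, r)\<leftarrow>l. \<mu> * r) - (\<Sum>(\<mu>, h, r)\<leftarrow>l'. \<mu> * r)\<bar> \<le> e
     \<and> norm ((\<Sum>(\<mu>, h, r)\<leftarrow>l. \<mu> *\<^sub>R h) - (\<Sum>(\<mu>, h, r)\<leftarrow>l'. \<mu> *\<^sub>R h)) \<le> e"
  using assms
proof (induction l arbitrary: e)
  case Nil
  then show ?case by (intro exI[of _ "[]"]) simp
next
  case (Cons x l)
  obtain \<mu> h r where x: "x = (\<mu>, h, r)" by (cases x)
  have "0 < e/2" using Cons.prems by simp
  with Cons.prems obtain l' where l': "\<forall>(\<mu>, h, r) \<in> set l'. 0 \<le> \<mu> \<and> \<mu> \<in> \<rat> \<and> (h, r) \<in> A"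
    "\<bar>(\<Sum>(\<mu>, h, r)\<leftarrow>l. \<mu> * r) - (\<Sum>(\<mu>, h, r)\<leftarrow>l'. \<mu> * r)\<bar> \<le> e/2"
    "norm ((\<Sum>(\<mu>, h, r)\<leftarrow>l. \<mu> *\<^sub>R h) - (\<Sum>(\<mu>, h, r)\<leftarrow>l'. \<mu> *\<^sub>R h)) \<le> e/2"
    using Cons.IH[of "e/2"] by (auto simp: case_prod_unfold)
  \<comment> \<open>A weight changed by less than \<open>d\<close> moves the scalar term and the
    vector term by at most e/2 each; the other half is left to the rest of the list.\<close>
  define d where "d = e / 2 / (1 + \<bar>r\<bar> + norm h)"
  have pos: "0 < 1 + \<bar>r\<bar> + norm h" by (simp add: add_pos_nonneg)
  have d: "0 < d" using Cons.prems pos by (simp add: d_def)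
  obtain \<nu> where \<nu>: "\<nu> \<in> \<rat>" "\<mu> < \<nu>" "\<nu> < \<mu> + d" using Rats_dense_in_real[of \<mu> "\<mu> + d"] d by auto
  have small: "d * \<bar>r\<bar> \<le> e/2" "d * norm h \<le> e/2"
    using Cons.prems pos by (auto simp: d_def field_simps)
  have 1: "\<bar>\<mu> * r - \<nu> * r\<bar> \<le> e/2"
  proof -
    have "\<bar>\<mu> * r - \<nu> * r\<bar> = \<bar>\<mu> - \<nu>\<bar> * \<bar>r\<bar>" by (simp add: abs_mult flip: left_diff_distrib)
    also have "\<dots> \<le> d * \<bar>r\<bar>" using \<nu> by (intro mult_right_mono) auto
    finally show ?thesis using small by simp
  qed
  have 2: "norm (\<mu> *\<^sub>R h - \<nu> *\<^sub>R h) \<le> e/2"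
  proof -
    have "norm (\<mu> *\<^sub>R h - \<nu> *\<^sub>R h) = \<bar>\<mu> - \<nu>\<bar> * norm h" by (simp flip: scaleR_left_diff_distrib)
    also have "\<dots> \<le> d * norm h" using \<nu> by (intro mult_right_mono) auto
    finally show ?thesis using small by simp
  qed
  show ?case
  proof (intro exI[of _ "(\<nu>, h, r) # l'"] conjI)
    show "\<forall>(\<mu>, h, r)\<in>set ((\<nu>, h, r) # l'). 0 \<le> \<mu> \<and> \<mu> \<in> \<rat> \<and> (h, r) \<in> A"
      using Cons.prems l'(1) \<nu> x by auto
    show "\<bar>(\<Sum>(\<mu>, h, r)\<leftarrow>x # l. \<mu> * r) - (\<Sum>(\<mu>, h, r)\<leftarrow>(\<nu>, h, r) # l'. \<mu> * r)\<bar> \<le> e"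
      using 1 l'(2) unfolding x by (simp only: list.map sum_list.Cons prod.case)
    have "norm ((\<mu> *\<^sub>R h - \<nu> *\<^sub>R h) + ((\<Sum>(\<mu>, h, r)\<leftarrow>l. \<mu> *\<^sub>R h) - (\<Sum>(\<mu>, h, r)\<leftarrow>l'. \<mu> *\<^sub>R h))) \<le> e"
      using norm_triangle_le[OF add_mono[OF 2 l'(3)]] by simp
    then show "norm ((\<Sum>(\<mu>, h, r)\<leftarrow>x # l. \<mu> *\<^sub>R h) - (\<Sum>(\<mu>, h, r)\<leftarrow>(\<nu>, h, r) # l'. \<mu> *\<^sub>R h)) \<le> e"
      by (simp add: x algebra_simps)
  qed
qed

text \<open>The assumption says that no nonnegative combination of constraints contradicts the norm
  bound. Under it the function \<open>q\<close> below, an infimal convolution of \<open>c\<close>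
  times the norm with the finite combinations of constraints, is finite and sublinear, and every
  linear minorant of \<open>q\<close> satisfies the constraints and the bound.\<close>

theorem linear_constraints_solvable:
  fixes A :: "('a::real_normed_vector \<times> real) set"
  assumes "0 \<le> c"
    and rat: "\<And>l. \<forall>(\<mu>, h, r) \<in> set l. 0 \<le> \<mu> \<and> \<mu> \<in> \<rat> \<and> (h, r) \<in> A \<Longrightarrow>
        0 \<le> (\<Sum>(\<mu>, h, r)\<leftarrow>l. \<mu> * r) + c * norm (\<Sum>(\<mu>, h, r)\<leftarrow>l. \<mu> *\<^sub>R h)"
  shows "\<exists>v :: 'a \<Rightarrow>\<^sub>L real. norm v \<le> c \<and> (\<forall>(h, r)\<in>A. blinfun_apply v h \<le> r)"
proof -
  define L where "L = {l. \<forall>(\<mu>, h, r) \<in> set l. (0::real) \<le> \<mu> \<and> (h, r) \<in> A}"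
  define R where "R l = (\<Sum>(\<mu>, h, r)\<leftarrow>l. \<mu> * r)" for l :: "(real \<times> 'a \<times> real) list"
  define H where "H l = (\<Sum>(\<mu>, h, r)\<leftarrow>l. \<mu> *\<^sub>R h)" for l :: "(real \<times> 'a \<times> real) list"
  \<comment> \<open>Density of the rationals extends the assumption to real weights. The scaling of
    \<open>d\<close> makes the scalar error and \<open>c\<close> times the vector error add up to
    \<open>e\<close>.\<close>
  have real: "0 \<le> R l + c * norm (H l)" if lL: "l \<in> L" for l
  proof (rule field_le_epsilon)
    fix e :: real assume "0 < e"
    define d where "d = e / (1 + c)"
    have d: "0 < d" using \<open>0 < e\<close> \<open>0 \<le> c\<close> by (simp add: d_def)
    obtain l' where l': "\<forall>(\<mu>, h, r) \<in> set l'. 0 \<le> \<mu> \<and> \<mu> \<in> \<rat> \<and> (h, r) \<in> A"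
      "\<bar>R l - R l'\<bar> \<le> d" "norm (H l - H l') \<le> d"
      using rational_weights_approx[of l A d] lL d unfolding L_def R_def H_def by blast
    have "0 \<le> R l' + c * norm (H l')" using rat[OF l'(1)] by (simp add: R_def H_def)
    also have "\<dots> \<le> (R l + d) + c * (norm (H l) + d)"
    proof (intro add_mono mult_left_mono)
      show "norm (H l') \<le> norm (H l) + d" using l'(3) norm_triangle_ineq2[of "H l'" "H l"]
        by (simp add: norm_minus_commute)
    qed (use l' \<open>0 \<le> c\<close> in auto)
    also have "\<dots> = R l + c * norm (H l) + (1 + c) * d" by (simp add: algebra_simps)
    also have "(1 + c) * d = e" using \<open>0 \<le> c\<close> by (simp add: d_def)
    finally show "0 \<le> R l + c * norm (H l) + e" .
  qed
  define q where "q z = (INF l\<in>L. R l + c * norm (z - H l))" for z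
  have bdd: "bdd_below ((\<lambda>l. R l + c * norm (z - H l)) ` L)" for z
  proof (rule bdd_belowI2[where m = "- c * norm z"])
    fix l assume "l \<in> L"
    have "c * norm (H l) \<le> c * (norm z + norm (z - H l))"
      using norm_triangle_ineq4[of z "z - H l"] \<open>0 \<le> c\<close> by (intro mult_left_mono) auto
    then show "- c * norm z \<le> R l + c * norm (z - H l)"
      using real[OF \<open>l \<in> L\<close>] by (simp add: algebra_simps)
  qed
  have low: "q z \<le> R l + c * norm (z - H l)" if "l \<in> L" for z l
    unfolding q_def by (rule cINF_lower[OF bdd that])
  have ne: "[] \<in> L" by (simp add: L_def)
  have near: "\<exists>l\<in>L. R l + c * norm (z - H l) < q z + e" if "0 < e" for z e
  proof -
    have "(INF l\<in>L. R l + c * norm (z - H l)) < q z + e" using that by (simp add: q_def)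
    then show ?thesis by (subst (asm) cINF_less_iff[OF _ bdd]) (use ne in auto)
  qed
  have "sublinear q"
  proof (rule sublinearI)
    fix x y
    show "q (x + y) \<le> q x + q y"
    proof (rule field_le_epsilon)
      fix e :: real assume "0 < e"
      then obtain l k where l: "l \<in> L" "R l + c * norm (x - H l) < q x + e/2"
        and k: "k \<in> L" "R k + c * norm (y - H k) < q y + e/2"
        using near[of "e/2"] by (metis half_gt_zero)
      have lk: "l @ k \<in> L" using l k by (auto simp: L_def)
      have "q (x + y) \<le> R (l @ k) + c * norm (x + y - H (l @ k))" by (rule low[OF lk])
      also have "R (l @ k) = R l + R k" by (simp add: R_def)
      also have "x + y - H (l @ k) = (x - H l) + (y - H k)" by (simp add: H_def)
      also have "R l + R k + c * norm ((x - H l) + (y - H k))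
          \<le> R l + R k + c * (norm (x - H l) + norm (y - H k))"
        using \<open>0 \<le> c\<close> by (intro add_left_mono mult_left_mono norm_triangle_ineq)
      finally show "q (x + y) \<le> q x + q y + e" using l k by (simp add: algebra_simps)
    qed
  next
    fix t :: real and x assume t: "0 < t"
    show "q (t *\<^sub>R x) \<le> t * q x"
    proof (rule field_le_epsilon)
      fix e :: real assume "0 < e"
      then obtain l where l: "l \<in> L" "R l + c * norm (x - H l) < q x + e/t"
        using near[of "e/t" x] t by fastforce
      define k where "k = map (\<lambda>(\<mu>, h, r). (t * \<mu>, h, r)) l"
      have kL: "k \<in> L" using l t by (auto simp: k_def L_def)
      have Rk: "R k = t * R l"
        by (simp add: k_def R_def o_def case_prod_unfold mult.assoc sum_list_const_mult)
      have Hk: "H k = t *\<^sub>R H l"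
        unfolding k_def H_def by (induction l) (auto simp: scaleR_add_right)
      have "q (t *\<^sub>R x) \<le> R k + c * norm (t *\<^sub>R x - H k)" by (rule low[OF kL])
      also have "\<dots> = t * (R l + c * norm (x - H l))"
        using t by (simp add: Rk Hk algebra_simps flip: scaleR_diff_right)
      also have "\<dots> \<le> t * (q x + e/t)" using l t by simp
      finally show "q (t *\<^sub>R x) \<le> t * q x + e" using t by (simp add: algebra_simps)
    qed
  next
    have "0 \<le> q 0 + e" if "0 < e" for e :: real
    proof -
      obtain l where "l \<in> L" "R l + c * norm (0 - H l) < q 0 + e" using near[OF \<open>0 < e\<close>] by blast
      with real[of l] show ?thesis by simp
    qed
    then have "0 \<le> q 0" by (rule field_le_epsilon)
    moreover have "q 0 \<le> 0" using low[OF ne, of 0] by (simp add: R_def H_def)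
    ultimately show "q 0 = 0" by simp
  qed
  then obtain g where g: "linear g" "\<And>x. g x \<le> q x" using Hahn_Banach_sublinear by blast
  have gle: "g x \<le> c * norm x" for x
    using g(2)[of x] low[OF ne, of x] by (simp add: R_def H_def)
  have gabs: "norm (g x) \<le> norm x * c" for x
    using gle[of x] gle[of "- x"] linear_neg[OF g(1), of x] by (simp add: abs_le_iff mult.commute)
  have "bounded_linear g"
    using g(1) gabs by (intro bounded_linear_intro[where K = c]) (auto simp: linear_add linear_scale)
  then have app: "blinfun_apply (Blinfun g) = g" by (rule bounded_linear_Blinfun_apply)
  show ?thesis
  proof (intro exI[of _ "Blinfun g"] conjI ballI)
    show "norm (Blinfun g) \<le> c" using gabs \<open>0 \<le> c\<close> by (intro norm_blinfun_bound) (auto simp: app mult.commute)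
    fix z assume "z \<in> A"
    moreover obtain h r where z: "z = (h, r)" by (cases z)
    ultimately have "[(1, h, r)] \<in> L" by (simp add: L_def)
    \<comment> \<open>The single constraint with weight 1 gives q h \<le> r, just as the empty list
      gave the norm bound.\<close>
    from low[OF this, of h] g(2)[of h] show "case z of (h, r) \<Rightarrow> blinfun_apply (Blinfun g) h \<le> r"
      by (simp add: app z R_def H_def)
  qed
qed

text \<open>The equation is written as two opposite inequalities. Every combination of them
  collapses to a real multiple of the pair (d, t), where the hypothesis on \<open>t\<close>
  applies.\<close>

corollary functional_with_value:
  fixes d :: "'a::real_normed_vector"
  assumes "\<bar>t\<bar> \<le> \<alpha> * norm d" and "0 \<le> \<alpha>"
  shows "\<exists>v :: 'a \<Rightarrow>\<^sub>L real. norm v \<le> \<alpha> \<and> blinfun_apply v d = t"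
proof -
  have "\<exists>v :: 'a \<Rightarrow>\<^sub>L real. norm v \<le> \<alpha> \<and> (\<forall>(h, r)\<in>{(d, t), (- d, - t)}. blinfun_apply v h \<le> r)"
  proof (rule linear_constraints_solvable[OF assms(2)])
    fix l :: "(real \<times> 'a \<times> real) list"
    assume "\<forall>(\<mu>, h, r)\<in>set l. 0 \<le> \<mu> \<and> \<mu> \<in> \<rat> \<and> (h, r) \<in> {(d, t), (- d, - t)}"
    then have "\<exists>s. (\<Sum>(\<mu>, h, r)\<leftarrow>l. \<mu> * r) = s * t \<and> (\<Sum>(\<mu>, h, r)\<leftarrow>l. \<mu> *\<^sub>R h) = s *\<^sub>R d"
    proof (induction l)
      case Nil
      show ?case by (rule exI[of _ 0]) simp
    next
      case (Cons x l)
      then obtain s where s: "(\<Sum>(\<mu>, h, r)\<leftarrow>l. \<mu> * r) = s * t" "(\<Sum>(\<mu>, h, r)\<leftarrow>l. \<mu> *\<^sub>R h) = s *\<^sub>R d"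
        by auto
      obtain \<mu> where "x = (\<mu>, d, t) \<or> x = (\<mu>, - d, - t)" using Cons.prems by (cases x) auto
      then show ?case
      proof
        assume "x = (\<mu>, d, t)"
        then show ?thesis by (intro exI[of _ "\<mu> + s"]) (simp add: s algebra_simps)
      next
        assume "x = (\<mu>, - d, - t)"
        then show ?thesis by (intro exI[of _ "s - \<mu>"]) (simp add: s algebra_simps)
      qed
    qed
    then obtain s where s: "(\<Sum>(\<mu>, h, r)\<leftarrow>l. \<mu> * r) = s * t" "(\<Sum>(\<mu>, h, r)\<leftarrow>l. \<mu> *\<^sub>R h) = s *\<^sub>R d"
      by blast
    have "\<bar>s * t\<bar> \<le> \<bar>s\<bar> * (\<alpha> * norm d)" using assms(1) by (simp add: abs_mult mult_left_mono)
    then show "0 \<le> (\<Sum>(\<mu>, h, r)\<leftarrow>l. \<mu> * r) + \<alpha> * norm (\<Sum>(\<mu>, h, r)\<leftarrow>l. \<mu> *\<^sub>R h)"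
      unfolding s norm_scaleR by (simp add: algebra_simps)
  qed
  then show ?thesis by (auto simp: blinfun.minus_right)
qed

section \<open>Smooth approximation of the norm\<close>

lemma subspace_dualD:
  assumes "f \<in> subspace_dual Y"
  shows "x \<in> Y \<Longrightarrow> y \<in> Y \<Longrightarrow> f (x + y) = f x + f y" "x \<in> Y \<Longrightarrow> f (c *\<^sub>R x) = c * f x"
    "\<exists>K. \<forall>x\<in>Y. \<bar>f x\<bar> \<le> K * norm x" "x \<notin> Y \<Longrightarrow> f x = 0"
  using assms by (auto simp: subspace_dual_def)

lemma subspace_dual_diff:
  assumes "f \<in> subspace_dual Y" "subspace Y" "x \<in> Y" "y \<in> Y"
  shows "f (x - y) = f x - f y"
proof -
  have "- y \<in> Y" using assms subspace_neg by blast
  then have "f (x + - y) = f x + f ((- 1) *\<^sub>R y)"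
    using subspace_dualD(1)[OF assms(1,3), of "- y"] by simp
  then show ?thesis using subspace_dualD(2)[OF assms(1,4), of "- 1"] by simp
qed

lemma subspace_dual_combination:
  assumes f: "f \<in> subspace_dual Y" and g: "g \<in> subspace_dual Y"
  shows "(\<lambda>x. a * f x + b * g x) \<in> subspace_dual Y"
proof -
  obtain K L where "\<forall>x\<in>Y. \<bar>f x\<bar> \<le> K * norm x" "\<forall>x\<in>Y. \<bar>g x\<bar> \<le> L * norm x"
    using subspace_dualD(3)[OF f] subspace_dualD(3)[OF g] by blast
  then have "\<bar>a * f x + b * g x\<bar> \<le> (\<bar>a\<bar> * K + \<bar>b\<bar> * L) * norm x" if "x \<in> Y" for x
  proof -
    have "\<bar>a * f x + b * g x\<bar> \<le> \<bar>a\<bar> * \<bar>f x\<bar> + \<bar>b\<bar> * \<bar>g x\<bar>"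
      by (metis abs_mult abs_triangle_ineq)
    also have "\<dots> \<le> \<bar>a\<bar> * (K * norm x) + \<bar>b\<bar> * (L * norm x)"
      using that \<open>\<forall>x\<in>Y. \<bar>f x\<bar> \<le> K * norm x\<close> \<open>\<forall>x\<in>Y. \<bar>g x\<bar> \<le> L * norm x\<close>
      by (intro add_mono mult_left_mono) auto
    finally show ?thesis by (simp add: algebra_simps)
  qed
  then show ?thesis using f g unfolding subspace_dual_def
    by (auto simp: distrib_left intro!: exI[of _ "\<bar>a\<bar> * K + \<bar>b\<bar> * L"])
qed

lemma subspace_dual_minus:
  "f \<in> subspace_dual Y \<Longrightarrow> g \<in> subspace_dual Y \<Longrightarrow> (\<lambda>x. f x - g x) \<in> subspace_dual Y"
  using subspace_dual_combination[of f Y g 1 "- 1"] by simp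

lemma bdd_above_dual_norm:
  assumes "f \<in> subspace_dual Y"
  shows "bdd_above ((\<lambda>x. \<bar>f x\<bar>) ` {x \<in> Y. norm x \<le> 1})"
proof -
  obtain K where K: "\<forall>x\<in>Y. \<bar>f x\<bar> \<le> K * norm x" using subspace_dualD(3)[OF assms(1)] by blast
  show ?thesis
  proof (rule bdd_aboveI2)
    fix z assume z: "z \<in> {x \<in> Y. norm x \<le> 1}"
    then have "\<bar>f z\<bar> \<le> K * norm z" using K by auto
    also have "\<dots> \<le> \<bar>K\<bar> * 1" using z by (intro mult_mono) auto
    finally show "\<bar>f z\<bar> \<le> \<bar>K\<bar>" by simp
  qed
qed

lemma dual_norm_bound:
  assumes "f \<in> subspace_dual Y" "subspace Y" "x \<in> Y"
  shows "\<bar>f x\<bar> \<le> dual_norm Y f * norm x"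
proof (cases "x = 0")
  case True
  then show ?thesis using subspace_dualD(2)[OF assms(1,3), of 0] by simp
next
  case False
  define u where "u = inverse (norm x) *\<^sub>R x"
  have u: "u \<in> Y" "norm u \<le> 1" using assms False by (auto simp: u_def subspace_scale)
  have "\<bar>f u\<bar> \<le> dual_norm Y f" unfolding dual_norm_def
    by (rule cSUP_upper[OF _ bdd_above_dual_norm[OF assms(1)]]) (use u in simp)
  moreover have "f u = inverse (norm x) * f x" using subspace_dualD(2)[OF assms(1,3)] by (simp add: u_def)
  ultimately show ?thesis using False by (simp add: abs_mult field_simps)
qed

lemma dual_norm_le:
  assumes "subspace Y" "0 \<le> K" "\<And>x. x \<in> Y \<Longrightarrow> \<bar>f x\<bar> \<le> K * norm x"
  shows "dual_norm Y f \<le> K"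
  unfolding dual_norm_def
proof (rule cSUP_least)
  show "{x \<in> Y. norm x \<le> 1} \<noteq> {}" using subspace_0[OF assms(1)] by force
  fix x assume "x \<in> {x \<in> Y. norm x \<le> 1}"
  then show "\<bar>f x\<bar> \<le> K" using assms(3)[of x] mult_left_mono[OF _ assms(2), of "norm x" 1] by auto
qed

lemma dual_norm_nonneg:
  assumes "f \<in> subspace_dual Y" "subspace Y"
  shows "0 \<le> dual_norm Y f"
proof -
  have "\<bar>f 0\<bar> \<le> dual_norm Y f" unfolding dual_norm_def
    by (rule cSUP_upper[OF _ bdd_above_dual_norm[OF assms(1)]]) (use subspace_0[OF assms(2)] in simp)
  then show ?thesis by simp
qed

text \<open>Convexity is encoded by the gradient inequality, so Frechet differentiability needs only
  the upper estimate. The slack \<kappa> leaves room for differentiability at 0, where the norm has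
  a kink; the price is that \<open>N 0\<close> may lie anywhere between 0 and \<kappa>.\<close>

definition smooth_norm_approx ::
    "real \<Rightarrow> 'a::real_normed_vector set \<Rightarrow> ('a \<Rightarrow> real) \<Rightarrow> ('a \<Rightarrow> 'a \<Rightarrow> real) \<Rightarrow> bool" where
  "smooth_norm_approx \<kappa> Y N N' \<longleftrightarrow> (\<forall>x\<in>Y. norm x \<le> N x \<and> N x \<le> norm x + \<kappa> \<and>
     N' x \<in> subspace_dual Y \<and> (\<forall>h\<in>Y. \<bar>N' x h\<bar> \<le> norm h) \<and>
     (\<forall>z\<in>Y. N x + N' x (z - x) \<le> N z) \<and>
     (\<forall>e>0. \<exists>\<delta>>0. \<forall>h\<in>Y. norm h < \<delta> \<longrightarrow> N (x + h) \<le> N x + N' x h + e * norm h))"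

text \<open>Penalising the support function of the dual unit ball \<open>B\<close> by the strictly convex \<open>Q\<close> makes
  almost-maximising functionals norm convergent, because their distances to the dense sequence \<open>d\<close>
  converge; the odd terms of \<open>q\<close> provide the pointwise limit of a maximising sequence.\<close>

locale separable_dual_subspace =
  fixes Y :: "'a::real_normed_vector set" and d :: "nat \<Rightarrow> 'a \<Rightarrow> real" and s :: "nat \<Rightarrow> 'a" and \<kappa> :: real
  assumes Y: "subspace Y" and d: "\<And>n. d n \<in> subspace_dual Y"
    and d_dense: "\<And>f e. f \<in> subspace_dual Y \<Longrightarrow> 0 < e \<Longrightarrow> \<exists>n. dual_norm Y (\<lambda>x. f x - d n x) < e"
    and s: "\<And>n. s n \<in> Y" and s_dense: "\<And>x e. x \<in> Y \<Longrightarrow> 0 < e \<Longrightarrow> \<exists>n. norm (x - s n) < e"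
    and \<kappa>: "0 < \<kappa>"
begin

definition "B = {f \<in> subspace_dual Y. \<forall>x\<in>Y. \<bar>f x\<bar> \<le> norm x}"

text \<open>The shift by \<open>norm (s (n div 2))\<close> makes the odd terms nonnegative on
  \<open>B\<close>, so that their convexity survives squaring.\<close>

definition q :: "nat \<Rightarrow> ('a \<Rightarrow> real) \<Rightarrow> real" where
  "q n f = (if even n then dual_norm Y (\<lambda>x. f x - d (n div 2) x) else f (s (n div 2)) + norm (s (n div 2)))"

definition "b n = (if even n then 1 + dual_norm Y (d (n div 2)) else 2 * norm (s (n div 2)))"

text \<open>As \<open>b n\<close> bounds \<open>q n\<close> on \<open>B\<close>, this normalisation
  puts each penalty term below a geometric one, whence 0 \<le> Q \<le> \<kappa> there.\<close>

definition "w n = \<kappa> * (1/2) ^ Suc n / (1 + (b n)\<^sup>2)"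

definition "Q f = (\<Sum>n. w n * (q n f)\<^sup>2)"

text \<open>Without \<open>Q\<close> this would be the norm on \<open>Y\<close>; the bounds on
  \<open>Q\<close> keep it at most \<kappa> below the norm.\<close>

definition "\<Psi> x = (SUP f\<in>B. f x - Q f)"

lemma BD: "f \<in> B \<Longrightarrow> f \<in> subspace_dual Y" "f \<in> B \<Longrightarrow> x \<in> Y \<Longrightarrow> \<bar>f x\<bar> \<le> norm x"
  by (auto simp: B_def)

lemma B_diff: "f \<in> B \<Longrightarrow> x \<in> Y \<Longrightarrow> y \<in> Y \<Longrightarrow> \<bar>f x - f y\<bar> \<le> norm (x - y)"
  using BD(2)[of f "x - y"] subspace_dual_diff[OF BD(1) Y] subspace_diff[OF Y] by metis

lemma w_pos: "0 < w n"
proof -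
  have "0 < 1 + (b n)\<^sup>2" by (smt (verit) zero_le_power2)
  then show ?thesis using \<kappa> by (simp add: w_def)
qed

lemma q_nonneg: "f \<in> B \<Longrightarrow> 0 \<le> q n f"
  using BD(2)[of f "s (n div 2)"] s dual_norm_nonneg[OF subspace_dual_minus[OF BD(1) d] Y]
  by (auto simp: q_def)

lemma q_le: "f \<in> B \<Longrightarrow> q n f \<le> b n"
proof (cases "even n")
  case True
  assume f: "f \<in> B"
  have "dual_norm Y (\<lambda>x. f x - d (n div 2) x) \<le> 1 + dual_norm Y (d (n div 2))"
  proof (rule dual_norm_le[OF Y])
    show "0 \<le> 1 + dual_norm Y (d (n div 2))" using dual_norm_nonneg[OF d Y, of "n div 2"] by simp
    fix x assume "x \<in> Y"
    then show "\<bar>f x - d (n div 2) x\<bar> \<le> (1 + dual_norm Y (d (n div 2))) * norm x"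
      using BD(2)[OF f, of x] dual_norm_bound[OF d Y, of x "n div 2"] by (simp add: algebra_simps)
  qed
  then show ?thesis using True by (simp add: q_def b_def)
next
  case False
  assume f: "f \<in> B"
  then show ?thesis using False BD(2)[OF f s[of "n div 2"]] by (simp add: q_def b_def)
qed

lemma term_le:
  assumes f: "f \<in> B"
  shows "w n * (q n f)\<^sup>2 \<le> \<kappa> * (1/2) ^ Suc n" "0 \<le> w n * (q n f)\<^sup>2"
proof -
  have "(q n f)\<^sup>2 \<le> (b n)\<^sup>2" using q_nonneg[OF f] q_le[OF f] by (simp add: power_mono)
  then have 1: "(q n f)\<^sup>2 \<le> 1 + (b n)\<^sup>2" by simp
  have 2: "0 < 1 + (b n)\<^sup>2" by (smt (verit) zero_le_power2)
  then have 3: "1 + (b n)\<^sup>2 \<noteq> 0" by linarith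
  have "w n * (q n f)\<^sup>2 \<le> w n * (1 + (b n)\<^sup>2)" using 1 w_pos[of n] by simp
  also have "\<dots> = \<kappa> * (1/2) ^ Suc n" unfolding w_def
    by (rule nonzero_divide_eq_eq[OF 3, THEN iffD1, OF refl, symmetric])
  finally show "w n * (q n f)\<^sup>2 \<le> \<kappa> * (1/2) ^ Suc n" .
  show "0 \<le> w n * (q n f)\<^sup>2" using w_pos[of n] by simp
qed

lemma weights_sums: "(\<lambda>n. \<kappa> * (1/2) ^ Suc n) sums \<kappa>"
  using sums_mult[OF power_half_series, of \<kappa>] by simp

lemma Q_summable: "f \<in> B \<Longrightarrow> summable (\<lambda>n. w n * (q n f)\<^sup>2)"
  using term_le by (intro summable_comparison_test'[OF sums_summable[OF weights_sums], of 0]) auto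

lemma Q_bounds:
  assumes f: "f \<in> B"
  shows "0 \<le> Q f" "Q f \<le> \<kappa>"
proof -
  show "0 \<le> Q f" unfolding Q_def by (rule suminf_nonneg[OF Q_summable[OF f] term_le(2)[OF f]])
  have "Q f \<le> (\<Sum>n. \<kappa> * (1/2) ^ Suc n)" unfolding Q_def
    by (rule suminf_le[OF term_le(1)[OF f] Q_summable[OF f] sums_summable[OF weights_sums]])
  then show "Q f \<le> \<kappa>" using sums_unique[OF weights_sums] by simp
qed

lemma midpoint_in_B:
  assumes "f \<in> B" "g \<in> B"
  shows "(\<lambda>x. (f x + g x) / 2) \<in> B"
proof -
  have "(\<lambda>x. (1/2) * f x + (1/2) * g x) \<in> subspace_dual Y"
    using assms by (intro subspace_dual_combination BD)
  moreover have "(\<lambda>x. (1/2) * f x + (1/2) * g x) = (\<lambda>x. (f x + g x) / 2)" by (auto simp: field_simps)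
  moreover have "\<bar>(f x + g x) / 2\<bar> \<le> norm x" if "x \<in> Y" for x
    using BD(2)[OF assms(1) that] BD(2)[OF assms(2) that] by (simp add: abs_le_iff)
  ultimately show ?thesis by (simp add: B_def)
qed

lemma q_midpoint:
  assumes f: "f \<in> B" and g: "g \<in> B"
  shows "q n (\<lambda>x. (f x + g x) / 2) \<le> (q n f + q n g) / 2"
proof (cases "even n")
  case True
  define k where "k = n div 2"
  have F: "(\<lambda>x. f x - d k x) \<in> subspace_dual Y" and G: "(\<lambda>x. g x - d k x) \<in> subspace_dual Y"
    by (intro subspace_dual_minus d BD(1) f g)+
  have "dual_norm Y (\<lambda>x. (f x + g x) / 2 - d k x)
      \<le> (dual_norm Y (\<lambda>x. f x - d k x) + dual_norm Y (\<lambda>x. g x - d k x)) / 2"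
  proof (rule dual_norm_le[OF Y])
    show "0 \<le> (dual_norm Y (\<lambda>x. f x - d k x) + dual_norm Y (\<lambda>x. g x - d k x)) / 2"
      using dual_norm_nonneg[OF F Y] dual_norm_nonneg[OF G Y] by simp
    fix x assume "x \<in> Y"
    then have "\<bar>f x - d k x\<bar> \<le> dual_norm Y (\<lambda>x. f x - d k x) * norm x"
      "\<bar>g x - d k x\<bar> \<le> dual_norm Y (\<lambda>x. g x - d k x) * norm x"
      using dual_norm_bound[OF F Y] dual_norm_bound[OF G Y] by auto
    then have "\<bar>((f x - d k x) + (g x - d k x)) / 2\<bar>
      \<le> (dual_norm Y (\<lambda>x. f x - d k x) * norm x + dual_norm Y (\<lambda>x. g x - d k x) * norm x) / 2"
      using abs_triangle_ineq[of "f x - d k x" "g x - d k x"] unfolding abs_divide by simp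
    moreover have "((f x - d k x) + (g x - d k x)) / 2 = (f x + g x) / 2 - d k x"
      by (simp add: field_simps)
    ultimately show "\<bar>(f x + g x) / 2 - d k x\<bar>
      \<le> (dual_norm Y (\<lambda>x. f x - d k x) + dual_norm Y (\<lambda>x. g x - d k x)) / 2 * norm x"
      by (simp only: distrib_right times_divide_eq_left)
  qed
  then show ?thesis using True by (simp add: q_def k_def)
qed (simp add: q_def)

text \<open>Midpoint convexity of \<open>q n\<close> and the parallelogram identity gain a squared
  difference in every term of the series. All gains are nonnegative, so any one of them may be kept
  and the others dropped.\<close>

lemma Q_midpoint:
  assumes f: "f \<in> B" and g: "g \<in> B"
  shows "Q (\<lambda>x. (f x + g x) / 2) \<le> (Q f + Q g) / 2 - w n * (q n f - q n g)\<^sup>2 / 4"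
proof -
  define m where "m = (\<lambda>x. (f x + g x) / 2)"
  have m: "m \<in> B" using midpoint_in_B[OF f g] by (simp add: m_def)
  define a where "a n = (w n * (q n f)\<^sup>2 + w n * (q n g)\<^sup>2) / 2 - w n * (q n m)\<^sup>2" for n
  have a_ge: "w n * (q n f - q n g)\<^sup>2 / 4 \<le> a n" for n
  proof -
    have "(q n m)\<^sup>2 \<le> ((q n f + q n g) / 2)\<^sup>2"
      using q_midpoint[OF f g] q_nonneg[OF m] by (intro power_mono) (auto simp: m_def)
    then have "w n * (q n m)\<^sup>2 \<le> w n * ((q n f + q n g) / 2)\<^sup>2" using w_pos[of n] by simp
    moreover have "w n * ((q n f + q n g) / 2)\<^sup>2
      = (w n * (q n f)\<^sup>2 + w n * (q n g)\<^sup>2) / 2 - w n * (q n f - q n g)\<^sup>2 / 4"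
      by (simp add: power2_eq_square field_simps)
    ultimately show ?thesis unfolding a_def by linarith
  qed
  have a_nonneg: "0 \<le> a n" for n
    using a_ge[of n] w_pos[of n] by (smt (verit) divide_nonneg_pos mult_nonneg_nonneg zero_le_power2)
  have "a sums ((Q f + Q g) / 2 - Q m)"
    unfolding a_def Q_def
    by (intro sums_diff sums_divide sums_add summable_sums Q_summable f g m)
  then have "a n \<le> (Q f + Q g) / 2 - Q m"
    using sum_le_suminf[of a "{n}"] a_nonneg by (auto simp: sums_iff)
  then show ?thesis using a_ge[of n] by (simp add: m_def)
qed

lemma \<Psi>_upper: "f \<in> B \<Longrightarrow> x \<in> Y \<Longrightarrow> f x - Q f \<le> \<Psi> x"
  unfolding \<Psi>_def
proof (rule cSUP_upper)
  assume "x \<in> Y"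
  then show "bdd_above ((\<lambda>f. f x - Q f) ` B)"
    using BD(2) Q_bounds(1) by (intro bdd_aboveI2[where M = "norm x"]) (smt (verit))
qed

text \<open>If two almost-maximisers differed much under some \<open>q n\<close>, their midpoint
  would exceed the supremum.\<close>

lemma almost_maximisers_close:
  assumes f: "f \<in> B" and g: "g \<in> B" and x: "x \<in> Y"
    and "\<Psi> x - e \<le> f x - Q f" "\<Psi> x - e \<le> g x - Q g"
  shows "w n * (q n f - q n g)\<^sup>2 / 4 \<le> e"
  using \<Psi>_upper[OF midpoint_in_B[OF f g] x] Q_midpoint[OF f g, of n] assms(4,5) by (simp add: field_simps)

lemma zero_in_B: "(\<lambda>x. 0) \<in> B"
  by (auto simp: B_def subspace_dual_def intro!: exI[of _ 0])

section \<open>Attainment of the penalised supremum\<close>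

lemma q_cauchy:
  assumes g: "\<And>k. g k \<in> B" and x: "x \<in> Y" and lim: "(\<lambda>k. g k x - Q (g k)) \<longlonglongrightarrow> \<Psi> x"
  shows "Cauchy (\<lambda>k. q n (g k))"
proof (rule metric_CauchyI)
  fix e :: real assume "0 < e"
  define c where "c = w n * e\<^sup>2 / 8"
  have "0 < c" using w_pos[of n] \<open>0 < e\<close> by (simp add: c_def)
  then have "\<forall>\<^sub>F k in sequentially. \<Psi> x - c < g k x - Q (g k)" using lim by (intro order_tendstoD) auto
  then obtain M where M: "\<And>k. M \<le> k \<Longrightarrow> \<Psi> x - c < g k x - Q (g k)"
    by (auto simp: eventually_sequentially)
  show "\<exists>M. \<forall>k\<ge>M. \<forall>l\<ge>M. dist (q n (g k)) (q n (g l)) < e"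
  proof (intro exI[of _ M] allI impI)
    fix k l assume "M \<le> k" "M \<le> l"
    then have "w n * (q n (g k) - q n (g l))\<^sup>2 / 4 \<le> c"
      using M by (intro almost_maximisers_close[OF g g x]) (auto simp: less_imp_le)
    also have "\<dots> < w n * e\<^sup>2 / 4" using w_pos[of n] \<open>0 < e\<close> by (simp add: c_def)
    finally have "(q n (g k) - q n (g l))\<^sup>2 < e\<^sup>2" using w_pos[of n] by simp
    then show "dist (q n (g k)) (q n (g l)) < e"
      using \<open>0 < e\<close> by (metis abs_le_square_iff abs_of_pos dist_real_def linorder_not_less)
  qed
qed

text \<open>At the odd index 2 n + 1 the shift cancels, and a difference of \<open>q\<close> values
  is a difference of values at \<open>s n\<close>. Elements of \<open>B\<close> are 1-Lipschitz on
  \<open>Y\<close>, so a dense set of points suffices.\<close>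

lemma pointwise_cauchy:
  assumes g: "\<And>k. g k \<in> B" and cau: "\<And>n. Cauchy (\<lambda>k. q n (g k))" and y: "y \<in> Y"
  shows "Cauchy (\<lambda>k. g k y)"
proof (rule metric_CauchyI)
  fix e :: real assume e: "0 < e"
  obtain n where n: "norm (y - s n) < e/3" using s_dense[OF y, of "e/3"] e by auto
  obtain M where M: "\<And>k l. M \<le> k \<Longrightarrow> M \<le> l \<Longrightarrow> dist (q (2*n+1) (g k)) (q (2*n+1) (g l)) < e/3"
    using metric_CauchyD[OF cau[of "2*n+1"], of "e/3"] e by auto
  show "\<exists>M. \<forall>k\<ge>M. \<forall>l\<ge>M. dist (g k y) (g l y) < e"
  proof (intro exI[of _ M] allI impI)
    fix k l assume "M \<le> k" "M \<le> l"
    then have "\<bar>g k (s n) - g l (s n)\<bar> < e/3" using M[of k l] by (simp add: q_def dist_real_def)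
    moreover have "\<bar>g k y - g k (s n)\<bar> < e/3" "\<bar>g l y - g l (s n)\<bar> < e/3"
      using B_diff[OF g y s, of k n] B_diff[OF g y s, of l n] n by linarith+
    ultimately show "dist (g k y) (g l y) < e" unfolding dist_real_def by linarith
  qed
qed

lemma pointwise_limit_in_B:
  assumes g: "\<And>k. g k \<in> B" and lim: "\<And>y. y \<in> Y \<Longrightarrow> (\<lambda>k. g k y) \<longlonglongrightarrow> f y"
    and out: "\<And>y. y \<notin> Y \<Longrightarrow> f y = 0"
  shows "f \<in> B"
proof -
  have "f (x + y) = f x + f y" if "x \<in> Y" "y \<in> Y" for x y
  proof -
    have "(\<lambda>k. g k (x + y)) \<longlonglongrightarrow> f x + f y"
      using tendsto_add[OF lim[OF that(1)] lim[OF that(2)]] subspace_dualD(1)[OF BD(1)[OF g] that] by simp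
    then show ?thesis using lim[OF subspace_add[OF Y that]] LIMSEQ_unique by blast
  qed
  moreover have "f (c *\<^sub>R x) = c * f x" if "x \<in> Y" for x c
  proof -
    have "(\<lambda>k. g k (c *\<^sub>R x)) \<longlonglongrightarrow> c * f x"
      using tendsto_mult_left[OF lim[OF that], of c] subspace_dualD(2)[OF BD(1)[OF g] that] by simp
    then show ?thesis using lim[OF subspace_scale[OF Y that]] LIMSEQ_unique by blast
  qed
  moreover have bd: "\<bar>f x\<bar> \<le> norm x" if "x \<in> Y" for x
    using BD(2)[OF g that] by (intro LIMSEQ_le_const2[OF tendsto_rabs[OF lim[OF that]]]) auto
  moreover have "\<exists>K. \<forall>x\<in>Y. \<bar>f x\<bar> \<le> K * norm x" using bd by (intro exI[of _ 1]) simp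
  ultimately show ?thesis using out by (auto simp: B_def subspace_dual_def)
qed

text \<open>The dual norm is a supremum of evaluations and therefore lower semicontinuous under
  pointwise convergence; the odd terms are even continuous.\<close>

lemma q_limit_le:
  assumes g: "\<And>k. g k \<in> B" and lim: "\<And>y. y \<in> Y \<Longrightarrow> (\<lambda>k. g k y) \<longlonglongrightarrow> f y"
    and f: "f \<in> B" and l: "(\<lambda>k. q n (g k)) \<longlonglongrightarrow> l"
  shows "q n f \<le> l"
proof (cases "even n")
  case True
  define k where "k = n div 2"
  have l0: "0 \<le> l" using q_nonneg[OF g] by (intro LIMSEQ_le_const[OF l]) auto
  have "dual_norm Y (\<lambda>x. f x - d k x) \<le> l"
  proof (rule dual_norm_le[OF Y l0])
    fix y assume y: "y \<in> Y"
    show "\<bar>f y - d k y\<bar> \<le> l * norm y"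
    proof (rule LIMSEQ_le)
      show "(\<lambda>j. \<bar>g j y - d k y\<bar>) \<longlonglongrightarrow> \<bar>f y - d k y\<bar>" by (intro tendsto_intros lim y)
      show "(\<lambda>j. q n (g j) * norm y) \<longlonglongrightarrow> l * norm y" by (intro tendsto_intros l)
      show "\<exists>N. \<forall>j\<ge>N. \<bar>g j y - d k y\<bar> \<le> q n (g j) * norm y"
        using dual_norm_bound[OF subspace_dual_minus[OF BD(1)[OF g] d] Y y] True
        by (auto simp: q_def k_def)
    qed
  qed
  then show ?thesis using True by (simp add: q_def k_def)
next
  case False
  then have "(\<lambda>k. q n (g k)) \<longlonglongrightarrow> q n f" using lim[OF s] by (simp add: q_def tendsto_add)
  then show ?thesis using l LIMSEQ_unique by blast
qed

text \<open>No compactness of the dual ball is invoked: the penalty itself forces a maximising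
  sequence to converge pointwise. The limit loses no value because the penalty terms are lower
  semicontinuous, which passes to the series through its partial sums.\<close>

lemma maximiser_exists:
  assumes x: "x \<in> Y"
  shows "\<exists>f\<in>B. f x - Q f = \<Psi> x"
proof -
  have "\<exists>g\<in>B. \<Psi> x - 1 / real (Suc k) < g x - Q g" for k
  proof -
    have "\<Psi> x - 1 / real (Suc k) < (SUP f\<in>B. f x - Q f)" by (simp add: \<Psi>_def)
    moreover have "bdd_above ((\<lambda>f. f x - Q f) ` B)" using \<Psi>_upper[OF _ x] by (rule bdd_aboveI2)
    ultimately show ?thesis using zero_in_B by (subst (asm) less_cSUP_iff) auto
  qed
  then obtain g where g: "\<And>k. g k \<in> B" and gx: "\<And>k. \<Psi> x - 1 / real (Suc k) < g k x - Q (g k)"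
    by metis
  have lim: "(\<lambda>k. g k x - Q (g k)) \<longlonglongrightarrow> \<Psi> x"
  proof (rule tendsto_sandwich)
    show "\<forall>\<^sub>F k in sequentially. \<Psi> x - 1 / real (Suc k) \<le> g k x - Q (g k)"
      using gx by (intro always_eventually allI less_imp_le)
    show "\<forall>\<^sub>F k in sequentially. g k x - Q (g k) \<le> \<Psi> x" using \<Psi>_upper[OF g x] by simp
    show "(\<lambda>k. \<Psi> x - 1 / real (Suc k)) \<longlonglongrightarrow> \<Psi> x"
      using tendsto_diff[OF tendsto_const LIMSEQ_Suc[OF lim_1_over_n]] by simp
  qed simp
  have cau: "Cauchy (\<lambda>k. q n (g k))" for n by (rule q_cauchy[OF g x lim])
  then have "\<forall>n. \<exists>l. (\<lambda>k. q n (g k)) \<longlonglongrightarrow> l" by (simp add: Cauchy_convergent_iff convergent_def)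
  then obtain l where l: "\<And>n. (\<lambda>k. q n (g k)) \<longlonglongrightarrow> l n" by metis
  \<comment> \<open>The value 0 outside \<open>Y\<close> is the normalisation built into
    \<open>subspace_dual\<close>.\<close>
  define f where "f y = (if y \<in> Y then lim (\<lambda>k. g k y) else 0)" for y
  have flim: "(\<lambda>k. g k y) \<longlonglongrightarrow> f y" if "y \<in> Y" for y
    using pointwise_cauchy[OF g cau that] that
    by (simp add: f_def Cauchy_convergent_iff convergent_LIMSEQ_iff)
  have f: "f \<in> B" by (rule pointwise_limit_in_B[OF g flim]) (auto simp: f_def)
  have Qlim: "(\<lambda>k. Q (g k)) \<longlonglongrightarrow> f x - \<Psi> x" using tendsto_diff[OF flim[OF x] lim] by simp
  have "Q f \<le> f x - \<Psi> x" unfolding Q_def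
  proof (rule suminf_le_const[OF Q_summable[OF f]])
    fix M
    have "(\<Sum>n<M. w n * (q n f)\<^sup>2) \<le> (\<Sum>n<M. w n * (l n)\<^sup>2)"
      using q_limit_le[OF g flim f l] q_nonneg[OF f] w_pos
      by (intro sum_mono mult_left_mono power_mono) (auto intro: less_imp_le)
    also have "\<dots> \<le> f x - \<Psi> x"
    proof (rule LIMSEQ_le)
      show "(\<lambda>k. \<Sum>n<M. w n * (q n (g k))\<^sup>2) \<longlonglongrightarrow> (\<Sum>n<M. w n * (l n)\<^sup>2)"
        by (intro tendsto_intros l)
      show "\<exists>N. \<forall>k\<ge>N. (\<Sum>n<M. w n * (q n (g k))\<^sup>2) \<le> Q (g k)"
        unfolding Q_def using term_le(2)[OF g] by (intro exI allI impI sum_le_suminf Q_summable g) auto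
    qed (rule Qlim)
    finally show "(\<Sum>n<M. w n * (q n f)\<^sup>2) \<le> f x - \<Psi> x" .
  qed
  then show ?thesis using \<Psi>_upper[OF f x] f by (intro bexI[of _ f]) auto
qed

text \<open>Some \<open>d n\<close> lies within e/3 of \<open>f\<close>. An almost-maximiser
  \<open>g\<close> has nearly the same distance to it, at most 2 e/3, so \<open>f\<close> and
  \<open>g\<close> are \<open>e\<close>-close in the dual norm. Strong maxima of this kind make
  \<Psi> Frechet differentiable.\<close>

lemma maximiser_strong:
  assumes f: "f \<in> B" and x: "x \<in> Y" and fx: "f x - Q f = \<Psi> x" and e: "0 < e"
  shows "\<exists>\<delta>>0. \<forall>g\<in>B. \<Psi> x - \<delta> \<le> g x - Q g \<longrightarrow> (\<forall>y\<in>Y. \<bar>g y - f y\<bar> \<le> e * norm y)"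
proof -
  obtain n where n: "dual_norm Y (\<lambda>y. f y - d n y) < e/3"
    using d_dense[OF BD(1)[OF f], of "e/3"] e by auto
  define \<delta> where "\<delta> = w (2*n) * (e/3)\<^sup>2 / 4"
  have \<delta>: "0 < \<delta>" using w_pos[of "2*n"] e by (simp add: \<delta>_def)
  show ?thesis
  proof (intro exI[of _ \<delta>] conjI ballI impI \<delta>)
    fix g y assume g: "g \<in> B" and gx: "\<Psi> x - \<delta> \<le> g x - Q g" and y: "y \<in> Y"
    have "w (2*n) * (q (2*n) f - q (2*n) g)\<^sup>2 / 4 \<le> \<delta>"
      using fx gx \<delta> by (intro almost_maximisers_close[OF f g x]) auto
    then have "(q (2*n) f - q (2*n) g)\<^sup>2 \<le> (e/3)\<^sup>2" using w_pos[of "2*n"] by (simp add: \<delta>_def)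
    then have "\<bar>q (2*n) f - q (2*n) g\<bar> \<le> e/3" using e by (metis abs_le_square_iff abs_of_pos divide_pos_pos zero_less_numeral)
    then have gn: "dual_norm Y (\<lambda>y. g y - d n y) \<le> 2 * e / 3" 
      using n unfolding q_def by (simp del: le_divide_eq_numeral1)
    have "\<bar>g y - d n y\<bar> \<le> 2 / 3 * (e * norm y)"
      using dual_norm_bound[OF subspace_dual_minus[OF BD(1)[OF g] d] Y y, of n] mult_right_mono[OF gn, of "norm y"]
      by simp
    moreover have "\<bar>f y - d n y\<bar> \<le> 1 / 3 * (e * norm y)"
      using dual_norm_bound[OF subspace_dual_minus[OF BD(1)[OF f] d] Y y, of n]
        mult_right_mono[OF less_imp_le[OF n], of "norm y"] by simp
    ultimately show "\<bar>g y - f y\<bar> \<le> e * norm y" by linarith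
  qed
qed

text \<open>As in Smulian's criterion, the derivative at \<open>x\<close> is the maximiser
  \<open>F x\<close>. For the upper estimate the maximiser at x + h is inserted at \<open>x\<close>,
  where it is optimal up to twice the norm of \<open>h\<close> and hence norm close to
  \<open>F x\<close>.\<close>

lemma smooth_norm_approx_exists: "\<exists>N N'. smooth_norm_approx \<kappa> Y N N'"
proof -
  obtain F where F: "\<And>x. x \<in> Y \<Longrightarrow> F x \<in> B" and Fx: "\<And>x. x \<in> Y \<Longrightarrow> F x x - Q (F x) = \<Psi> x"
    using maximiser_exists by metis
  have "smooth_norm_approx \<kappa> Y (\<lambda>x. \<Psi> x + \<kappa>) F"
    unfolding smooth_norm_approx_def
  proof (intro ballI conjI allI impI)
    fix x assume x: "x \<in> Y"
    show "norm x \<le> \<Psi> x + \<kappa>"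
    proof -
      \<comment> \<open>A norming functional restricted to \<open>Y\<close> pays a penalty of at
        most \<kappa>, which explains the shift of \<Psi> by \<kappa>.\<close>
      obtain v :: "'a \<Rightarrow>\<^sub>L real" where v: "norm v \<le> 1" "blinfun_apply v x = norm x"
        using functional_with_value[of "norm x" 1 x] by auto
      define g where "g y = (if y \<in> Y then blinfun_apply v y else 0)" for y
      have bd: "\<bar>blinfun_apply v y\<bar> \<le> norm y" for y
        using norm_blinfun[of v y] mult_right_mono[OF v(1), of "norm y"] by simp
      have "g \<in> B" unfolding B_def subspace_dual_def
        using bd subspace_add[OF Y] subspace_scale[OF Y]
        by (auto simp: g_def blinfun.add_right blinfun.scaleR_right intro!: exI[of _ 1])
      then show ?thesis using \<Psi>_upper[of g x] Q_bounds(2)[of g] x v(2) by (simp add: g_def)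
    qed
    show "\<Psi> x + \<kappa> \<le> norm x + \<kappa>" using Fx[OF x] BD(2)[OF F[OF x] x] Q_bounds(1)[OF F[OF x]] by simp
    show "F x \<in> subspace_dual Y" using F[OF x] by (rule BD)
    show "\<bar>F x h\<bar> \<le> norm h" if "h \<in> Y" for h using BD(2)[OF F[OF x] that] .
    show grad: "\<Psi> x + \<kappa> + F x (z - x) \<le> \<Psi> z + \<kappa>" if "z \<in> Y" for z
      using \<Psi>_upper[OF F[OF x] that] Fx[OF x] subspace_dual_diff[OF BD(1)[OF F[OF x]] Y that x] by simp
    fix e :: real assume e: "0 < e"
    obtain \<delta> where \<delta>: "0 < \<delta>"
      "\<And>g y. g \<in> B \<Longrightarrow> \<Psi> x - \<delta> \<le> g x - Q g \<Longrightarrow> y \<in> Y \<Longrightarrow> \<bar>g y - F x y\<bar> \<le> e * norm y"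
      using maximiser_strong[OF F[OF x] x Fx[OF x] e] by blast
    show "\<exists>\<delta>>0. \<forall>h\<in>Y. norm h < \<delta> \<longrightarrow> \<Psi> (x + h) + \<kappa> \<le> \<Psi> x + \<kappa> + F x h + e * norm h"
    proof (intro exI[of _ "\<delta>/2"] conjI ballI impI)
      fix h assume h: "h \<in> Y" "norm h < \<delta>/2"
      have xh: "x + h \<in> Y" using subspace_add[OF Y x h(1)] .
      define g where "g = F (x + h)"
      have g: "g \<in> B" and gx: "g (x + h) - Q g = \<Psi> (x + h)" using F[OF xh] Fx[OF xh] by (auto simp: g_def)
      have gadd: "g (x + h) = g x + g h" using subspace_dualD(1)[OF BD(1)[OF g] x h(1)] .
      have "\<Psi> x + F x h \<le> \<Psi> (x + h)" using grad[OF xh] by simp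
      \<comment> \<open>Both \<open>F x h\<close> and \<open>g h\<close> may cost up to
        \<open>norm h\<close>, hence the radius \<delta>/2.\<close>
      then have "\<Psi> x - \<delta> \<le> g x - Q g"
        using gx gadd BD(2)[OF g h(1)] BD(2)[OF F[OF x] h(1)] h(2) by simp
      then have "\<bar>g h - F x h\<bar> \<le> e * norm h" using \<delta>(2)[OF g _ h(1)] by simp
      then show "\<Psi> (x + h) + \<kappa> \<le> \<Psi> x + \<kappa> + F x h + e * norm h"
        using gx gadd \<Psi>_upper[OF g x] by simp
    qed (use \<delta> in simp)
  qed
  then show ?thesis by blast
qed

end

theorem smooth_norm_approx_exists:
  fixes Y :: "'a::real_normed_vector set"
  assumes Y: "subspace Y" and sep: "separable_set Y" and dual: "separable_dual Y" and "0 < \<kappa>"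
  shows "\<exists>N N'. smooth_norm_approx \<kappa> Y N N'"
proof -
  obtain S where S: "countable S" "S \<subseteq> Y" "Y \<subseteq> closure S" using sep by (auto simp: separable_set_def)
  obtain D where D: "countable D" "D \<subseteq> subspace_dual Y"
    "\<And>f e. f \<in> subspace_dual Y \<Longrightarrow> 0 < e \<Longrightarrow> \<exists>g\<in>D. dual_norm Y (\<lambda>x. f x - g x) < e"
    using dual by (auto simp: separable_dual_def)
  \<comment> \<open>An enumeration by \<open>from_nat_into\<close> stays inside its set only if that
    set is nonempty.\<close>
  have "S \<noteq> {}" using S(3) subspace_0[OF Y] by auto
  have "(\<lambda>x. 0) \<in> subspace_dual Y" by (auto simp: subspace_dual_def intro!: exI[of _ 0])
  then have "D \<noteq> {}" using D(3)[of _ 1] by force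
  interpret separable_dual_subspace Y "from_nat_into D" "from_nat_into S" \<kappa>
  proof
    show "from_nat_into D n \<in> subspace_dual Y" "from_nat_into S n \<in> Y" for n
      using from_nat_into[OF \<open>D \<noteq> {}\<close>] from_nat_into[OF \<open>S \<noteq> {}\<close>] S D by blast+
    show "\<exists>n. dual_norm Y (\<lambda>x. f x - from_nat_into D n x) < e" if "f \<in> subspace_dual Y" "0 < e" for f e
      using D(3)[OF that] from_nat_into_surj[OF \<open>countable D\<close>] by metis
    show "\<exists>n. norm (x - from_nat_into S n) < e" if "x \<in> Y" "0 < e" for x e
    proof -
      obtain y where "y \<in> S" "dist y x < e" 
        using S(3) \<open>x \<in> Y\<close> \<open>0 < e\<close> closure_approachable[of x S] by blast
      then show ?thesis using from_nat_into_surj[OF \<open>countable S\<close>] by (metis dist_commute dist_norm)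
    qed
  qed (use Y \<open>0 < \<kappa>\<close> in auto)
  show ?thesis by (rule smooth_norm_approx_exists)
qed

section \<open>A smooth variational principle\<close>

lemma smooth_norm_approxD:
  assumes "smooth_norm_approx \<kappa> Y N N'" "x \<in> Y"
  shows "norm x \<le> N x" "N x \<le> norm x + \<kappa>" "N' x \<in> subspace_dual Y" "h \<in> Y \<Longrightarrow> \<bar>N' x h\<bar> \<le> norm h"
    "z \<in> Y \<Longrightarrow> N x + N' x (z - x) \<le> N z"
    "0 < e \<Longrightarrow> \<exists>\<delta>>0. \<forall>h\<in>Y. norm h < \<delta> \<longrightarrow> N (x + h) \<le> N x + N' x h + e * norm h"
  using assms by (auto simp: smooth_norm_approx_def)

lemma smooth_norm_approx_Lipschitz:
  assumes N: "smooth_norm_approx \<kappa> Y N N'" and Y: "subspace Y" and x: "x \<in> Y" and z: "z \<in> Y"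
  shows "\<bar>N x - N z\<bar> \<le> norm (x - z)"
proof -
  have "N x - N z \<le> norm (x - z)" if "x \<in> Y" "z \<in> Y" for x z
  proof -
    have "\<bar>N' x (z - x)\<bar> \<le> norm (z - x)"
      using smooth_norm_approxD(4)[OF N that(1)] subspace_diff[OF Y that(2,1)] by blast
    then show ?thesis using smooth_norm_approxD(5)[OF N that] by (simp add: norm_minus_commute)
  qed
  from this[OF x z] this[OF z x] show ?thesis by (simp add: norm_minus_commute abs_le_iff)
qed

text \<open>The weights sum to \<epsilon>, which will bound the Lipschitz constant and the gradient.
  Each centre has its own \<open>N k\<close>, so that the approximation errors can shrink along the
  sequence.\<close>

definition perturbation :: "real \<Rightarrow> (nat \<Rightarrow> 'a::real_normed_vector \<Rightarrow> real) \<Rightarrow> (nat \<Rightarrow> 'a) \<Rightarrow> 'a \<Rightarrow> real" where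
  "perturbation \<epsilon> N u z = (\<Sum>k. \<epsilon> * (1/2) ^ Suc k * N k (z - u k))"

lemma perturbation_weights_sums: "(\<lambda>k. \<epsilon> * (1/2) ^ Suc k) sums (\<epsilon>::real)"
  using sums_mult[OF power_half_series, of \<epsilon>] by simp

lemma summable_weighted:
  fixes x :: "nat \<Rightarrow> real"
  assumes "0 \<le> \<epsilon>" "\<And>k. \<bar>x k\<bar> \<le> C"
  shows "summable (\<lambda>k. \<epsilon> * (1/2) ^ Suc k * x k)" "\<bar>\<Sum>k. \<epsilon> * (1/2) ^ Suc k * x k\<bar> \<le> \<epsilon> * C"
proof -
  have le: "\<bar>\<epsilon> * (1/2) ^ Suc k * x k\<bar> \<le> \<epsilon> * (1/2) ^ Suc k * C" for k
    using assms by (simp add: abs_mult mult_left_mono)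
  have s: "(\<lambda>k. \<epsilon> * (1/2) ^ Suc k * C) sums (\<epsilon> * C)"
    by (rule sums_mult2[OF perturbation_weights_sums])
  show sm: "summable (\<lambda>k. \<epsilon> * (1/2) ^ Suc k * x k)"
    by (rule summable_comparison_test'[OF sums_summable[OF s], of 0]) (use le in simp)
  have sa: "summable (\<lambda>k. \<bar>\<epsilon> * (1/2) ^ Suc k * x k\<bar>)"
    by (rule summable_comparison_test'[OF sums_summable[OF s], of 0]) (use le in simp)
  have "\<bar>\<Sum>k. \<epsilon> * (1/2) ^ Suc k * x k\<bar> \<le> (\<Sum>k. \<bar>\<epsilon> * (1/2) ^ Suc k * x k\<bar>)"
    by (rule summable_rabs[OF sa])
  also have "\<dots> \<le> (\<Sum>k. \<epsilon> * (1/2) ^ Suc k * C)"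
    by (rule suminf_le[OF le sa sums_summable[OF s]])
  finally show "\<bar>\<Sum>k. \<epsilon> * (1/2) ^ Suc k * x k\<bar> \<le> \<epsilon> * C" using sums_unique[OF s] by simp
qed

lemma summable_perturbation:
  assumes Y: "subspace Y" and N: "\<And>k. smooth_norm_approx (\<kappa> k) Y (N k) (N' k)" and \<kappa>: "\<And>k. \<kappa> k \<le> 1"
    and u: "\<And>k. u k \<in> Y" "\<And>k. norm (u k) \<le> R" and \<epsilon>: "0 \<le> \<epsilon>" and z: "z \<in> Y"
  shows "summable (\<lambda>k. \<epsilon> * (1/2) ^ Suc k * N k (z - u k))"
proof (rule summable_weighted(1)[OF \<epsilon>, where C = "norm z + R + 1"])
  fix k
  have "z - u k \<in> Y" by (rule subspace_diff[OF Y z u(1)])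
  from smooth_norm_approxD(1,2)[OF N this, of k] norm_triangle_ineq4[of z "u k"] u(2)[of k] \<kappa>[of k]
  show "\<bar>N k (z - u k)\<bar> \<le> norm z + R + 1" using norm_ge_zero[of "z - u k"] by linarith
qed

lemma perturbation_Lipschitz:
  assumes Y: "subspace Y" and N: "\<And>k. smooth_norm_approx (\<kappa> k) Y (N k) (N' k)" and \<kappa>: "\<And>k. \<kappa> k \<le> 1"
    and u: "\<And>k. u k \<in> Y" "\<And>k. norm (u k) \<le> R" and \<epsilon>: "0 \<le> \<epsilon>" and x: "x \<in> Y" and z: "z \<in> Y"
  shows "\<bar>perturbation \<epsilon> N u x - perturbation \<epsilon> N u z\<bar> \<le> \<epsilon> * norm (x - z)"
proof -
  have "perturbation \<epsilon> N u x - perturbation \<epsilon> N u z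
      = (\<Sum>k. \<epsilon> * (1/2) ^ Suc k * (N k (x - u k) - N k (z - u k)))"
    unfolding perturbation_def right_diff_distrib
    by (rule suminf_diff) (intro summable_perturbation[OF Y N \<kappa> u \<epsilon>] x z)+
  moreover have Lip: "\<bar>N k (x - u k) - N k (z - u k)\<bar> \<le> norm (x - z)" for k
    using smooth_norm_approx_Lipschitz[OF N Y subspace_diff[OF Y x u(1)] subspace_diff[OF Y z u(1)], of k k k]
    by simp
  ultimately show ?thesis using summable_weighted(2)[OF \<epsilon> Lip] by simp
qed

text \<open>The series is differentiated term by term: finitely many initial terms share a common
  radius, and the tail is controlled uniformly by the Lipschitz bounds because its weights are
  small.\<close>

lemma perturbation_smooth:
  assumes Y: "subspace Y" and N: "\<And>k. smooth_norm_approx (\<kappa> k) Y (N k) (N' k)" and \<kappa>: "\<And>k. \<kappa> k \<le> 1"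
    and u: "\<And>k. u k \<in> Y" "\<And>k. norm (u k) \<le> R" and \<epsilon>: "0 < \<epsilon>" and w: "w \<in> Y"
  shows "\<exists>g\<in>subspace_dual Y. (\<forall>h\<in>Y. \<bar>g h\<bar> \<le> \<epsilon> * norm h) \<and>
    (\<forall>e>0. \<exists>\<delta>>0. \<forall>h\<in>Y. norm h < \<delta> \<longrightarrow>
       perturbation \<epsilon> N u (w + h) \<le> perturbation \<epsilon> N u w + g h + e * norm h)"
proof -
  define x where "x k = w - u k" for k
  have x: "x k \<in> Y" for k unfolding x_def by (rule subspace_diff[OF Y w u(1)])
  note grad = smooth_norm_approxD[OF N x]
  define g where "g h = (\<Sum>k. \<epsilon> * (1/2) ^ Suc k * N' k (x k) h)" for h
  have gs: "summable (\<lambda>k. \<epsilon> * (1/2) ^ Suc k * N' k (x k) h)" and gb: "\<bar>g h\<bar> \<le> \<epsilon> * norm h" if "h \<in> Y" for h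
    unfolding g_def using summable_weighted[of \<epsilon> "\<lambda>k. N' k (x k) h" "norm h"] \<epsilon> grad(4)[OF that] by auto
  have "g \<in> subspace_dual Y"
    unfolding subspace_dual_def
  proof (intro CollectI conjI ballI allI impI)
    show "g (y + z) = g y + g z" if "y \<in> Y" "z \<in> Y" for y z
      unfolding g_def subspace_dualD(1)[OF grad(3) that] distrib_left
      by (rule suminf_add[symmetric, OF gs[OF that(1)] gs[OF that(2)]])
    show "g (c *\<^sub>R y) = c * g y" if "y \<in> Y" for c y
      unfolding g_def subspace_dualD(2)[OF grad(3) that]
      using suminf_mult[OF gs[OF that], of c] by (simp add: mult.left_commute mult.assoc)
    show "\<exists>K. \<forall>x\<in>Y. \<bar>g x\<bar> \<le> K * norm x" using gb by blast
    show "g y = 0" if "y \<notin> Y" for y unfolding g_def subspace_dualD(4)[OF grad(3) that] by simp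
  qed
  moreover have "\<exists>\<delta>>0. \<forall>h\<in>Y. norm h < \<delta> \<longrightarrow>
       perturbation \<epsilon> N u (w + h) \<le> perturbation \<epsilon> N u w + g h + e * norm h" if e: "0 < e" for e
  proof -
    define e1 where "e1 = e / (2 * \<epsilon>)"
    have e1: "0 < e1" using e \<epsilon> by (simp add: e1_def)
    \<comment> \<open>The tail after \<open>n\<close> terms costs at most
      \<open>2 * \<epsilon> * (1/2) ^ n * norm h\<close>, which this choice keeps below half of the
      allowance; \<open>e1\<close> reserves the other half for the initial terms.\<close>
    obtain n where n: "(1/2) ^ n < e / (4 * \<epsilon>)" using real_arch_pow_inv[of "e / (4 * \<epsilon>)" "1/2"] e \<epsilon> by auto
    obtain \<delta> where \<delta>: "\<And>k. 0 < \<delta> k"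
      "\<And>k h. h \<in> Y \<Longrightarrow> norm h < \<delta> k \<Longrightarrow> N k (x k + h) \<le> N k (x k) + N' k (x k) h + e1 * norm h"
    proof -
      have "\<forall>k. \<exists>\<delta>>0. \<forall>h\<in>Y. norm h < \<delta> \<longrightarrow> N k (x k + h) \<le> N k (x k) + N' k (x k) h + e1 * norm h"
        using grad(6)[OF e1] by blast
      then show ?thesis using that by metis
    qed
    define \<delta>0 where "\<delta>0 = Min (insert 1 (\<delta> ` {..<n}))"
    have "0 < \<delta>0" using \<delta>(1) by (simp add: \<delta>0_def)
    moreover have "perturbation \<epsilon> N u (w + h) \<le> perturbation \<epsilon> N u w + g h + e * norm h"
      if h: "h \<in> Y" "norm h < \<delta>0" for h
    proof -
      define D where "D k = N k (x k + h) - N k (x k) - N' k (x k) h" for k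
      have wh: "w + h \<in> Y" by (rule subspace_add[OF Y w h(1)])
      have D2: "\<bar>D k\<bar> \<le> 2 * norm h" for k
        using smooth_norm_approx_Lipschitz[OF N Y subspace_add[OF Y x h(1)] x, of k k k] grad(4)[OF h(1), of k k]
        by (simp add: D_def)
      have D1: "D k \<le> e1 * norm h" if "k < n" for k
      proof -
        have "\<delta>0 \<le> \<delta> k" unfolding \<delta>0_def by (rule Min_le) (use that in auto)
        then show ?thesis using \<delta>(2)[OF h(1), of k] h(2) by (simp add: D_def)
      qed
      have Ds: "summable (\<lambda>k. \<epsilon> * (1/2) ^ Suc k * D k)"
        by (rule summable_weighted(1)[OF _ D2]) (use \<epsilon> in simp)
      have "(\<lambda>k. \<epsilon> * (1/2) ^ Suc k * D k) sums (perturbation \<epsilon> N u (w + h) - perturbation \<epsilon> N u w - g h)"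
      proof -
        have xh: "x k + h = (w + h) - u k" for k by (simp add: x_def)
        have "(\<lambda>k. \<epsilon> * (1/2) ^ Suc k * N k (x k + h)) sums perturbation \<epsilon> N u (w + h)"
          unfolding perturbation_def xh
          by (rule summable_sums[OF summable_perturbation[OF Y N \<kappa> u less_imp_le[OF \<epsilon>] wh]])
        moreover have "(\<lambda>k. \<epsilon> * (1/2) ^ Suc k * N k (x k)) sums perturbation \<epsilon> N u w"
          unfolding perturbation_def x_def
          by (rule summable_sums[OF summable_perturbation[OF Y N \<kappa> u less_imp_le[OF \<epsilon>] w]])
        moreover have "(\<lambda>k. \<epsilon> * (1/2) ^ Suc k * N' k (x k) h) sums g h"
          unfolding g_def by (rule summable_sums[OF gs[OF h(1)]])
        ultimately show ?thesis unfolding D_def right_diff_distrib by (intro sums_diff)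
      qed
      then have "perturbation \<epsilon> N u (w + h) - perturbation \<epsilon> N u w - g h = (\<Sum>k. \<epsilon> * (1/2) ^ Suc k * D k)"
        by (rule sums_unique)
      also have "\<dots> = (\<Sum>k. \<epsilon> * (1/2) ^ Suc (k + n) * D (k + n)) + (\<Sum>k<n. \<epsilon> * (1/2) ^ Suc k * D k)"
        by (rule suminf_split_initial_segment[OF Ds])
      also have "(\<Sum>k. \<epsilon> * (1/2) ^ Suc (k + n) * D (k + n)) = (\<Sum>k. (\<epsilon> * (1/2) ^ n) * (1/2) ^ Suc k * D (k + n))"
        by (simp add: power_add mult_ac)
      also have "\<dots> \<le> \<epsilon> * (1/2) ^ n * (2 * norm h)"
        using summable_weighted(2)[of "\<epsilon> * (1/2) ^ n" "\<lambda>k. D (k + n)" "2 * norm h"] D2 \<epsilon> by (simp add: abs_le_iff)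
      also have "\<dots> \<le> e / 2 * norm h"
      proof -
        have "\<epsilon> * (1/2) ^ n * 2 \<le> e / 2" using n \<epsilon> by (simp add: field_simps)
        then have "\<epsilon> * (1/2) ^ n * 2 * norm h \<le> e / 2 * norm h" by (intro mult_right_mono) auto
        then show ?thesis by (simp add: mult.assoc)
      qed
      also have "(\<Sum>k<n. \<epsilon> * (1/2) ^ Suc k * D k) \<le> (\<Sum>k<n. \<epsilon> * (1/2) ^ Suc k * (e1 * norm h))"
        using D1 \<epsilon> by (intro sum_mono mult_left_mono) auto
      also have "\<dots> = (\<Sum>k<n. \<epsilon> * (1/2) ^ Suc k) * (e1 * norm h)" by (simp add: sum_distrib_right)
      also have "\<dots> \<le> \<epsilon> * (e1 * norm h)"
      proof (rule mult_right_mono)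
        show "(\<Sum>k<n. \<epsilon> * (1/2) ^ Suc k) \<le> \<epsilon>"
          using sum_le_suminf[OF sums_summable[OF perturbation_weights_sums], of "{..<n}" \<epsilon>] \<epsilon>
            sums_unique[OF perturbation_weights_sums, of \<epsilon>] by simp
      qed (use e1 in simp)
      also have "\<epsilon> * (e1 * norm h) = e / 2 * norm h" using \<epsilon> by (simp add: e1_def)
      finally show ?thesis by simp
    qed
    ultimately show ?thesis by blast
  qed
  ultimately show ?thesis using gb by blast
qed

text \<open>A Borwein-Preiss scheme: each \<open>u k\<close> almost minimises \<open>F\<close> plus
  the penalties accumulated so far, and penalising the distance to it forces the next point to be
  near. The hypothesis on sequences combines closedness of \<open>E\<close> with lower
  semicontinuity of \<open>F\<close>.\<close>

theorem smooth_variational_principle: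
  fixes Y E :: "'a::banach set" and F :: "'a \<Rightarrow> real"
  assumes Y: "subspace Y" and EY: "E \<subseteq> Y" and "E \<noteq> {}"
    and N: "\<And>k. smooth_norm_approx ((1/2) ^ k) Y (N k) (N' k)"
    and m: "\<And>z. z \<in> E \<Longrightarrow> m \<le> F z"
    and lsc: "\<And>u w c C. \<lbrakk>\<And>k. u k \<in> E; u \<longlonglongrightarrow> w; \<And>k. F (u k) \<le> c k; c \<longlonglongrightarrow> C\<rbrakk> \<Longrightarrow> w \<in> E \<and> F w \<le> C"
    and \<epsilon>: "0 < \<epsilon>"
  shows "\<exists>u w. (\<forall>k. u k \<in> E) \<and> bounded (range u) \<and> w \<in> E \<and>
    (\<forall>z\<in>E. F w + perturbation \<epsilon> N u w \<le> F z + perturbation \<epsilon> N u z)"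
proof -
  define c where "c k = \<epsilon> * (1/2) ^ Suc k" for k :: nat
  \<comment> \<open>The factor \<open>(1/2) ^ k\<close> survives division by the weight
    \<open>c k\<close> and makes the distances between consecutive points summable.\<close>
  define e where "e k = c k * (1/2) ^ k" for k
  have c: "0 < c k" and e: "0 < e k" for k using \<epsilon> by (auto simp: c_def e_def)
  have N0: "0 \<le> N k (z - y)" if "z \<in> Y" "y \<in> Y" for k z y
    using smooth_norm_approxD(1)[OF N subspace_diff[OF Y that], of k] norm_ge_zero order_trans by blast
  have approx_min: "\<exists>v\<in>E. \<forall>z\<in>E. F v + G v \<le> F z + G z + d" if G: "\<And>z. z \<in> E \<Longrightarrow> 0 \<le> G z" and d: "0 < d" for G d
  proof -
    define I where "I = (INF z\<in>E. F z + G z)"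
    have bdd: "bdd_below ((\<lambda>z. F z + G z) ` E)"
      using m G by (intro bdd_belowI2[where m = m]) force
    have "I < I + d" using d by simp
    then obtain v where v: "v \<in> E" "F v + G v < I + d"
      unfolding I_def by (subst (asm) cINF_less_iff[OF \<open>E \<noteq> {}\<close> bdd]) auto
    moreover have "I \<le> F z + G z" if "z \<in> E" for z unfolding I_def by (rule cINF_lower[OF bdd that])
    ultimately show ?thesis by force
  qed
  \<comment> \<open>The state of the recursion is the current point together with the penalty
    accumulated before it, which starts at 0.\<close>
  define P where "P k x \<longleftrightarrow> fst x \<in> E \<and> (\<forall>z\<in>E. 0 \<le> snd x z) \<and> (k = 0 \<longrightarrow> snd x = (\<lambda>_. 0)) \<and>
    (\<forall>z\<in>E. F (fst x) + snd x (fst x) \<le> F z + snd x z + e k)" for k :: nat and x :: "'a \<times> ('a \<Rightarrow> real)"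
  define step where "step k x y \<longleftrightarrow> snd y = (\<lambda>z. snd x z + c k * N k (z - fst x))"
    for k and x y :: "'a \<times> ('a \<Rightarrow> real)"
  have "\<exists>x. \<forall>k. P k (x k) \<and> step k (x k) (x (Suc k))"
  proof (rule dependent_nat_choice)
    obtain v where "v \<in> E" "\<forall>z\<in>E. F v + 0 \<le> F z + 0 + e 0" using approx_min[of "\<lambda>_. 0", OF _ e[of 0]] by auto
    then show "\<exists>x. P 0 x" by (intro exI[of _ "(v, \<lambda>_. 0)"]) (simp add: P_def)
    fix x k assume x: "P k x"
    define G where "G z = snd x z + c k * N k (z - fst x)" for z
    have G: "0 \<le> G z" if "z \<in> E" for z
      using x that N0[of z "fst x" k] EY less_imp_le[OF c[of k]]
      unfolding P_def G_def by (blast intro: add_nonneg_nonneg mult_nonneg_nonneg)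
    obtain v where "v \<in> E" "\<forall>z\<in>E. F v + G v \<le> F z + G z + e (Suc k)" 
      using approx_min[of G, OF G e[of "Suc k"]] by blast
    then show "\<exists>y. P (Suc k) y \<and> step k x y"
      using G by (intro exI[of _ "(v, G)"]) (auto simp: P_def step_def G_def)
  qed
  then obtain x where xP: "\<And>k. P k (x k)" and xs: "\<And>k. step k (x k) (x (Suc k))" by blast
  define u where "u k = fst (x k)" for k
  define G where "G k = snd (x k)" for k
  have uE: "u k \<in> E" and G_nonneg: "z \<in> E \<Longrightarrow> 0 \<le> G k z" and G0: "G 0 = (\<lambda>_. 0)"
    and umin: "z \<in> E \<Longrightarrow> F (u k) + G k (u k) \<le> F z + G k z + e k" for k z
    using xP[of k] xP[of 0] by (auto simp: P_def u_def G_def)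
  have GSuc: "G (Suc k) z = G k z + c k * N k (z - u k)" for k z
    using xs[of k] by (simp add: step_def u_def G_def)
  have uY: "u k \<in> Y" for k using uE EY by blast
  have Gsum: "G k z = (\<Sum>j<k. c j * N j (z - u j))" for k z
    by (induction k) (auto simp: GSuc G0)
  \<comment> \<open>Three errors meet: two from approximate minimality, and \<open>N k 0\<close>,
    which is at most \<open>(1/2) ^ k\<close> but need not vanish.\<close>
  have dist: "norm (u (Suc k) - u k) \<le> 2 * (1/2) ^ k + (1/2) ^ k" for k
  proof -
    have "F (u (Suc k)) + G (Suc k) (u (Suc k)) \<le> F (u k) + G (Suc k) (u k) + e (Suc k)"
      by (rule umin[OF uE])
    moreover have "F (u k) + G k (u k) \<le> F (u (Suc k)) + G k (u (Suc k)) + e k" by (rule umin[OF uE])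
    ultimately have "c k * N k (u (Suc k) - u k) \<le> c k * N k (u k - u k) + e (Suc k) + e k"
      unfolding GSuc by linarith
    also have "\<dots> \<le> c k * (1/2) ^ k + e k + e k"
    proof (intro add_mono mult_left_mono)
      show "N k (u k - u k) \<le> (1/2) ^ k" using smooth_norm_approxD(2)[OF N, of 0 k] subspace_0[OF Y] by simp
      show "e (Suc k) \<le> e k" using \<epsilon> by (simp add: e_def c_def)
    qed (use c[of k] in auto)
    also have "\<dots> = c k * (2 * (1/2) ^ k + (1/2) ^ k)" by (simp add: e_def algebra_simps)
    finally have "N k (u (Suc k) - u k) \<le> 2 * (1/2) ^ k + (1/2) ^ k"
      by (rule mult_left_le_imp_le[OF _ c])
    then show ?thesis using smooth_norm_approxD(1)[OF N[of k] subspace_diff[OF Y uY[of "Suc k"] uY[of k]]] by simp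
  qed
  have "summable (\<lambda>k. 2 * (1/2::real) ^ k + (1/2) ^ k)"
    by (intro summable_add summable_mult summable_geometric) auto
  then have "summable (\<lambda>k. u (Suc k) - u k)" by (rule summable_comparison_test'[where N = 0]) (rule dist)
  then have "(\<lambda>n. (\<Sum>k<n. u (Suc k) - u k) + u 0) \<longlonglongrightarrow> (\<Sum>k. u (Suc k) - u k) + u 0"
    by (intro tendsto_add summable_LIMSEQ tendsto_const)
  then obtain w where w: "u \<longlonglongrightarrow> w" by (auto simp: sum_lessThan_telescope)
  then have bdd: "bounded (range u)" by (rule convergent_imp_bounded)
  then obtain R where R: "\<And>k. norm (u k) \<le> R" by (auto simp: bounded_iff)
  have \<kappa>: "(1/2::real) ^ k \<le> 1" for k by (simp add: power_le_one)
  have ps: "summable (\<lambda>k. c k * N k (z - u k))" if "z \<in> Y" for z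
    unfolding c_def by (rule summable_perturbation[OF Y N \<kappa> uY R less_imp_le[OF \<epsilon>] that])
  have per: "perturbation \<epsilon> N u z = (\<Sum>k. c k * N k (z - u k))" for z by (simp add: perturbation_def c_def)
  have G_le: "G k z \<le> perturbation \<epsilon> N u z" if "z \<in> E" for k z
    unfolding per Gsum[of k]
  proof (intro sum_le_suminf ps)
    show "z \<in> Y" using that EY by blast
    then show "0 \<le> c j * N j (z - u j)" for j by (intro mult_nonneg_nonneg less_imp_le[OF c] N0 uY)
  qed simp
  have e_lim: "e \<longlonglongrightarrow> 0"
  proof -
    have "(\<lambda>k. \<epsilon> / 2 * (1/4) ^ k) \<longlonglongrightarrow> \<epsilon> / 2 * 0" by (intro tendsto_mult tendsto_const LIMSEQ_realpow_zero) auto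
    moreover have "e = (\<lambda>k. \<epsilon> / 2 * (1/4) ^ k)"
      by (auto simp: e_def c_def mult.assoc simp flip: power_mult_distrib)
    ultimately show ?thesis by simp
  qed
  have wE: "w \<in> E"
  proof -
    obtain z where z: "z \<in> E" using \<open>E \<noteq> {}\<close> by blast
    have "F (u k) \<le> F z + perturbation \<epsilon> N u z + e k" for k
      using umin[OF z, of k] G_le[OF z, of k] G_nonneg[OF uE, of k k] by linarith
    moreover have "(\<lambda>k. F z + perturbation \<epsilon> N u z + e k) \<longlonglongrightarrow> F z + perturbation \<epsilon> N u z + 0"
      by (intro tendsto_intros e_lim)
    ultimately show ?thesis by (rule lsc[OF uE w, THEN conjunct1])
  qed
  then have wY: "w \<in> Y" using EY by blast
  \<comment> \<open>A diagonal limit: \<open>G k\<close> converges at the fixed point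
    \<open>w\<close>, and the common Lipschitz constant \<epsilon> transfers this to the moving
    points \<open>u k\<close>.\<close>
  have G_lim: "(\<lambda>k. G k (u k)) \<longlonglongrightarrow> perturbation \<epsilon> N u w"
  proof (rule Lim_transform)
    show "(\<lambda>k. G k w) \<longlonglongrightarrow> perturbation \<epsilon> N u w" unfolding Gsum per by (rule summable_LIMSEQ[OF ps[OF wY]])
    have close: "\<bar>G k w - G k (u k)\<bar> \<le> \<epsilon> * norm (u k - w)" for k
    proof -
      have "\<bar>G k w - G k (u k)\<bar> \<le> (\<Sum>j<k. \<bar>c j * (N j (w - u j) - N j (u k - u j))\<bar>)"
        unfolding Gsum sum_subtractf[symmetric] right_diff_distrib[symmetric] by (rule sum_abs)
      also have "\<dots> \<le> (\<Sum>j<k. c j * norm (u k - w))"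
      proof (rule sum_mono)
        fix j
        have "\<bar>N j (w - u j) - N j (u k - u j)\<bar> \<le> norm (u k - w)"
          using smooth_norm_approx_Lipschitz[OF N[of j] Y subspace_diff[OF Y wY uY[of j]] subspace_diff[OF Y uY[of k] uY[of j]]]
          by (simp add: norm_minus_commute)
        then show "\<bar>c j * (N j (w - u j) - N j (u k - u j))\<bar> \<le> c j * norm (u k - w)"
          using c[of j] by (simp add: abs_mult)
      qed
      also have "\<dots> = (\<Sum>j<k. c j) * norm (u k - w)" by (simp add: sum_distrib_right)
      also have "\<dots> \<le> \<epsilon> * norm (u k - w)"
      proof (rule mult_right_mono)
        show "(\<Sum>j<k. c j) \<le> \<epsilon>"
          using sum_le_suminf[OF sums_summable[OF perturbation_weights_sums], of "{..<k}" \<epsilon>] \<epsilon>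
            sums_unique[OF perturbation_weights_sums, of \<epsilon>] by (simp add: c_def)
      qed simp
      finally show ?thesis .
    qed
    show "(\<lambda>k. G k (u k) - G k w) \<longlonglongrightarrow> 0"
    proof (rule Lim_null_comparison)
      show "\<forall>\<^sub>F k in sequentially. norm (G k (u k) - G k w) \<le> \<epsilon> * norm (u k - w)"
        using close by (intro always_eventually allI) (simp add: abs_minus_commute)
      show "(\<lambda>k. \<epsilon> * norm (u k - w)) \<longlonglongrightarrow> 0"
        by (rule tendsto_mult_right_zero[OF tendsto_norm_zero[OF LIM_zero[OF w]]])
    qed
  qed
  have "F w + perturbation \<epsilon> N u w \<le> F z + perturbation \<epsilon> N u z" if z: "z \<in> E" for z
  proof -
    have "F (u k) \<le> F z + perturbation \<epsilon> N u z + e k - G k (u k)" for k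
      using umin[OF z, of k] G_le[OF z, of k] by linarith
    moreover have "(\<lambda>k. F z + perturbation \<epsilon> N u z + e k - G k (u k))
        \<longlonglongrightarrow> F z + perturbation \<epsilon> N u z + 0 - perturbation \<epsilon> N u w"
      by (intro tendsto_intros e_lim G_lim)
    ultimately have "F w \<le> F z + perturbation \<epsilon> N u z + 0 - perturbation \<epsilon> N u w"
      by (rule lsc[OF uE w, THEN conjunct2])
    then show ?thesis by simp
  qed
  then show ?thesis using uE bdd wE by blast
qed

section \<open>A mean value theorem relative to a separable subspace\<close>

lemma lsc_fun_nhds:
  fixes f :: "'a::real_normed_vector \<Rightarrow> ereal"
  assumes "lsc_fun f" "c < f x"
  shows "\<exists>\<delta>>0. \<forall>y. norm (y - x) < \<delta> \<longrightarrow> c < f y"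
proof -
  have "f x \<le> Liminf (at x) f" using assms by (simp add: lsc_fun_def)
  then have "\<forall>\<^sub>F y in at x. c < f y" using assms(2) by (simp add: le_Liminf_iff)
  then obtain \<delta> where "0 < \<delta>" "\<And>y. y \<noteq> x \<Longrightarrow> dist y x < \<delta> \<Longrightarrow> c < f y"
    by (auto simp: eventually_at)
  then show ?thesis using assms(2) by (metis dist_norm)
qed

lemma lsc_fun_open_superlevel:
  fixes f :: "'a::real_normed_vector \<Rightarrow> ereal"
  assumes "lsc_fun f"
  shows "open {x. c < f x}"
  unfolding open_dist using lsc_fun_nhds[OF assms, of c] by (fastforce simp: dist_norm)

text \<open>Increasing open superlevel sets cover \<open>C\<close>, so one of them contains
  \<open>C\<close> with a uniform neighbourhood. The neighbourhood matters because the minimisation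
  in the mean value theorem leaves the segment.\<close>

lemma lsc_fun_bounded_below_near_compact:
  fixes f :: "'a::real_normed_vector \<Rightarrow> ereal"
  assumes "lsc_fun f" "\<And>x. f x \<noteq> -\<infinity>" "compact C"
  shows "\<exists>r>0. \<exists>m. \<forall>x\<in>C. \<forall>y. norm (y - x) < r \<longrightarrow> ereal m < f y"
proof -
  define U where "U n = {x. ereal (- real n) < f x}" for n
  have op: "open (U n)" for n unfolding U_def by (rule lsc_fun_open_superlevel[OF assms(1)])
  have "\<exists>n. x \<in> U n" for x
  proof -
    have "-\<infinity> < f x" using assms(2)[of x] by (simp add: ereal_infty_less(2))
    then obtain r where r: "ereal r < f x" using ereal_dense2[of "-\<infinity>" "f x"] by auto
    obtain n :: nat where "- r \<le> real n" using real_arch_simple by blast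
    then have "ereal (- real n) \<le> ereal r" by simp
    then show ?thesis using r unfolding U_def by (blast intro: le_less_trans)
  qed
  then have "C \<subseteq> (\<Union>n\<in>UNIV. U n)" by blast
  then obtain I where I: "finite I" "C \<subseteq> (\<Union>n\<in>I. U n)" by (rule compactE_image[OF assms(3) op])
  define n where "n = Max (insert 0 I)"
  have "U k \<subseteq> U n" if "k \<in> I" for k
  proof -
    have "k \<le> n" unfolding n_def using I(1) that by simp
    then have "ereal (- real n) \<le> ereal (- real k)" by simp
    then show ?thesis unfolding U_def by (blast intro: le_less_trans)
  qed
  then have "C \<subseteq> U n" using I(2) by blast
  then obtain r where r: "0 < r" "(\<Union>x\<in>C. ball x r) \<subseteq> U n"
    using compact_subset_open_imp_ball_epsilon_subset[OF assms(3) op] by metis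
  have "ereal (- real n) < f y" if "x \<in> C" "norm (y - x) < r" for x y
  proof -
    have "y \<in> ball x r" using that(2) by (simp add: dist_norm norm_minus_commute)
    then have "y \<in> U n" using r(2) that(1) by blast
    then show ?thesis by (simp add: U_def)
  qed
  then show ?thesis using r(1) by blast
qed

lemma lsc_fun_le_limit:
  fixes f :: "'a::real_normed_vector \<Rightarrow> ereal"
  assumes "lsc_fun f" "u \<longlonglongrightarrow> w" "\<And>k. f (u k) \<le> ereal (c k)" "c \<longlonglongrightarrow> C"
  shows "f w \<le> ereal C"
proof (rule ccontr)
  assume "\<not> f w \<le> ereal C"
  then obtain r where r: "ereal C < ereal r" "ereal r < f w" 
    using ereal_dense2[of "ereal C" "f w"] by (auto simp: not_le)
  obtain \<delta> where \<delta>: "0 < \<delta>" "\<And>y. norm (y - w) < \<delta> \<Longrightarrow> ereal r < f y"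
    using lsc_fun_nhds[OF assms(1) r(2)] by blast
  have "\<forall>\<^sub>F k in sequentially. norm (u k - w) < \<delta>"
    using tendstoD[OF assms(2) \<delta>(1)] by (simp add: dist_norm)
  moreover have "\<forall>\<^sub>F k in sequentially. c k < r" using order_tendstoD(2)[OF assms(4)] r(1) by simp
  ultimately have "\<forall>\<^sub>F k in sequentially. False"
  proof eventually_elim
    case (elim k)
    then have "ereal r < ereal (c k)" using \<delta>(2)[of "u k"] assms(3)[of k] by (blast intro: less_le_trans)
    then show False using elim by simp
  qed
  then show False by simp
qed

lemma compact_line_image: "compact ((\<lambda>t. a + t *\<^sub>R v) ` {0..1::real})" for a v :: "'a::real_normed_vector"
  by (intro compact_continuous_image continuous_intros) simp

text \<open>The minimum over \<open>t\<close> is exact by compactness of the interval; the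
  variational principle then acts on \<open>u\<close> alone, in a closed tube around the segment.
  Comparison with \<open>a\<close> at t = 0 places the minimiser in the interior of the tube and
  excludes t = 1.\<close>

lemma mean_value_smooth_subspace:
  fixes f :: "'a::banach \<Rightarrow> ereal"
  assumes Y: "subspace Y" "closed Y" and N: "\<And>\<kappa>. 0 < \<kappa> \<Longrightarrow> smooth_norm_approx \<kappa> Y (N \<kappa>) (N' \<kappa>)"
    and f: "lsc_fun f" "\<And>x. f x \<noteq> -\<infinity>" and aY: "a \<in> Y" and bY: "b \<in> Y" and ab: "f a < f b"
    and s: "0 < s" and p: "p = b + s *\<^sub>R (b - a)" and \<epsilon>: "0 < \<epsilon>"
  shows "\<exists>w\<in>Y. \<exists>g\<in>subspace_dual Y. \<exists>t\<in>{0..1}. norm (w - (a + t *\<^sub>R (b - a))) < \<epsilon> \<and> f w < \<infinity> \<and> 0 < g (p - w) \<and>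
    (\<forall>e>0. \<exists>\<delta>>0. \<forall>u\<in>Y. norm (u - w) < \<delta> \<longrightarrow> f w + ereal (g (u - w) - e * norm (u - w)) \<le> f u)"
proof -
  define v where "v = b - a"
  define c where "c t = a + t *\<^sub>R v" for t :: real
  have vY: "v \<in> Y" unfolding v_def by (rule subspace_diff[OF Y(1) bY aY])
  have cY: "c t \<in> Y" for t unfolding c_def by (intro subspace_add subspace_scale Y(1) aY vY)
  define Seg where "Seg = c ` {0..1}"
  have Seg: "compact Seg" unfolding Seg_def c_def by (rule compact_line_image)
  have SegNE: "Seg \<noteq> {}" by (auto simp: Seg_def)
  obtain r0 m where r0: "0 < r0" "\<And>x y. x \<in> Seg \<Longrightarrow> norm (y - x) < r0 \<Longrightarrow> ereal m < f y"
    using lsc_fun_bounded_below_near_compact[OF f Seg] by blast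
  \<comment> \<open>An infinite value becomes 0 here, so \<open>fr\<close> is meaningful only where
    \<open>f\<close> is finite; \<open>E\<close> below is restricted accordingly.\<close>
  define fr where "fr x = real_of_ereal (f x)" for x
  have fr: "f x = ereal (fr x)" if "f x < \<infinity>" for x
    using that f(2)[of x] by (cases "f x") (auto simp: fr_def)
  have fa: "f a = ereal (fr a)" using ab by (intro fr) auto
  obtain M where M: "ereal (fr a) < ereal M" "ereal M < f b" using ereal_dense2[OF ab] fa by auto
  obtain \<eta> where \<eta>: "0 < \<eta>" "\<And>y. norm (y - b) < \<eta> \<Longrightarrow> ereal M < f y"
    using lsc_fun_nhds[OF f(1) M(2)] by blast
  \<comment> \<open>Moving \<open>t\<close> from 0 to 1 gains only \<rho>, too little to pay for the
    rise of \<open>f\<close> by more than 2 \<rho> near \<open>b\<close>.\<close>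
  define \<rho> where "\<rho> = (M - fr a) / 2"
  have \<rho>: "0 < \<rho>" using M(1) by (simp add: \<rho>_def)
  define r where "r = min r0 (min \<eta> \<epsilon>) / 2"
  have r: "0 < r" "r < r0" "r < \<eta>" "r < \<epsilon>" using r0(1) \<eta>(1) \<epsilon> by (auto simp: r_def)
  \<comment> \<open>This will bound the distances of the minimiser to \<open>a\<close> and to
    \<open>p\<close>; 2 \<open>r\<close> accounts for its distance to the segment.\<close>
  define R where "R = (s + 1) * norm v + 2 * r"
  have R: "0 < R" using r s by (simp add: R_def add_nonneg_pos)
  \<comment> \<open>The error budget: smoothing (\<open>K * \<kappa>\<close>) and perturbation
    (\<open>\<epsilon>1 * R\<close>) each cost \<sigma>, and two such errors stay below both \<rho>
    and s \<rho>.\<close>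
  define \<sigma> where "\<sigma> = \<rho> * min 1 s / 4"
  have \<sigma>: "0 < \<sigma>" "\<sigma> \<le> \<rho> / 4" "\<sigma> \<le> s * \<rho> / 4" using \<rho> s by (auto simp: \<sigma>_def min_def)
  define \<epsilon>1 where "\<epsilon>1 = \<sigma> / R"
  have \<epsilon>1: "0 < \<epsilon>1" "\<epsilon>1 * R = \<sigma>" using \<sigma> R by (auto simp: \<epsilon>1_def)
  \<comment> \<open>At distance \<open>r\<close> the penalty outweighs every possible gain: fr a - m
    from \<open>f\<close>, \<rho> from the parameter, and the errors 2 \<sigma>.\<close>
  define K where "K = (\<bar>fr a - m\<bar> + 2 * \<rho> + 1) / r"
  have K: "0 < K" "K * r = \<bar>fr a - m\<bar> + 2 * \<rho> + 1" using r \<rho> by (auto simp: K_def)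
  define \<kappa> where "\<kappa> = \<sigma> / K"
  have \<kappa>: "0 < \<kappa>" "K * \<kappa> = \<sigma>" using \<sigma> K by (auto simp: \<kappa>_def)
  define L where "L = N \<kappa>"
  define L' where "L' = N' \<kappa>"
  have L: "smooth_norm_approx \<kappa> Y L L'" unfolding L_def L'_def by (rule N[OF \<kappa>(1)])
  have L0: "L 0 \<le> \<kappa>" using smooth_norm_approxD(2)[OF L subspace_0[OF Y(1)]] by simp
  have ucY: "u - c t \<in> Y" if "u \<in> Y" for u t by (rule subspace_diff[OF Y(1) that cY])
  define H where "H u t = K * L (u - c t) - \<rho> * t" for u t
  have H_Lip: "H u t \<le> H u' t + K * norm (u - u')" if "u \<in> Y" "u' \<in> Y" for u u' t
  proof -
    have "L (u - c t) \<le> L (u' - c t) + norm (u - u')"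
      using smooth_norm_approx_Lipschitz[OF L Y(1) ucY[OF that(1)] ucY[OF that(2)], of t t] by simp
    then have "K * L (u - c t) \<le> K * (L (u' - c t) + norm (u - u'))" using K(1) by simp
    then show ?thesis by (simp add: H_def algebra_simps)
  qed
  have "\<exists>t\<in>{0..1}. \<forall>t'\<in>{0..1}. H u t \<le> H u t'" if u: "u \<in> Y" for u
  proof (rule continuous_attains_inf)
    have "1-lipschitz_on Y L"
      using smooth_norm_approx_Lipschitz[OF L Y(1)] by (intro lipschitz_onI) (auto simp: dist_norm)
    then have "continuous_on Y L" by (rule lipschitz_on_continuous_on)
    then have "continuous_on {0..1} (\<lambda>t. L (u - c t))"
      by (rule continuous_on_compose2) (auto simp: c_def intro!: continuous_intros ucY[OF u, unfolded c_def])
    then show "continuous_on {0..1} (H u)" unfolding H_def by (intro continuous_intros)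
  qed auto
  then obtain \<tau> where \<tau>: "\<And>u. u \<in> Y \<Longrightarrow> \<tau> u \<in> {0..1}"
    and \<tau>_min: "\<And>u t. u \<in> Y \<Longrightarrow> t \<in> {0..1} \<Longrightarrow> H u (\<tau> u) \<le> H u t" by metis
  define G where "G u = H u (\<tau> u)" for u
  have G_le: "G u \<le> G u' + K * norm (u - u')" if "u \<in> Y" "u' \<in> Y" for u u'
    using \<tau>_min[OF that(1) \<tau>[OF that(2)]] H_Lip[OF that, of "\<tau> u'"] by (simp add: G_def)
  define E where "E = {u \<in> Y. f u < \<infinity> \<and> infdist u Seg \<le> r}"
  have EY: "E \<subseteq> Y" by (auto simp: E_def)
  have E_near: "\<exists>t\<in>{0..1}. norm (u - c t) < r'" if "u \<in> E" "r < r'" for u r'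
  proof -
    have "(INF x\<in>Seg. dist u x) < r'" using that by (simp add: E_def infdist_notempty[OF SegNE])
    then obtain x where "x \<in> Seg" "dist u x < r'"
      by (subst (asm) cINF_less_iff[OF SegNE]) auto
    then show ?thesis by (auto simp: Seg_def dist_norm)
  qed
  have aE: "a \<in> E"
  proof -
    have "a \<in> Seg" unfolding Seg_def c_def by (rule image_eqI[of _ _ 0]) auto
    then show ?thesis using aY fa r(1) by (simp add: E_def)
  qed
  have fm: "m \<le> fr u" if uE: "u \<in> E" for u
  proof -
    obtain t where t: "t \<in> {0..1}" "norm (u - c t) < r0" using E_near[OF uE r(2)] by blast
    then have "ereal m < f u" using r0(2)[of "c t" u] by (auto simp: Seg_def)
    then show ?thesis using fr[of u] uE by (simp add: E_def)
  qed
  have H_low: "K * norm (u - c t) - \<rho> \<le> H u t" if "u \<in> Y" "t \<in> {0..1}" for u t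
  proof -
    have "K * norm (u - c t) \<le> K * L (u - c t)" using smooth_norm_approxD(1)[OF L ucY[OF that(1)]] K(1) by simp
    moreover have "\<rho> * t \<le> \<rho> * 1" using that \<rho> by (intro mult_left_mono) auto
    ultimately show ?thesis by (simp add: H_def)
  qed
  define F where "F u = fr u + G u" for u
  have F_low: "m - \<rho> \<le> F u" if "u \<in> E" for u
  proof -
    have "u \<in> Y" using that EY by blast
    from H_low[OF this \<tau>[OF this]] have "- \<rho> \<le> G u" using K(1) norm_ge_zero[of "u - c (\<tau> u)"]
      unfolding G_def by (smt (verit) mult_nonneg_nonneg)
    then show ?thesis using fm[OF that] by (simp add: F_def)
  qed
  have F_lsc: "w \<in> E \<and> F w \<le> C"
    if u: "\<And>k. u k \<in> E" and w: "u \<longlonglongrightarrow> w" and le: "\<And>k. F (u k) \<le> d k" and d: "d \<longlonglongrightarrow> C" for u w d C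
  proof -
    have uY: "u k \<in> Y" for k using u EY by blast
    have wY: "w \<in> Y" using Y(2) uY w by (rule closed_sequentially)
    have G_lim: "(\<lambda>k. G (u k)) \<longlonglongrightarrow> G w"
    proof (rule LIM_zero_cancel, rule Lim_null_comparison)
      have "norm (G (u k) - G w) \<le> K * norm (u k - w)" for k
        using G_le[OF uY wY, of k] G_le[OF wY uY, of k] by (simp add: norm_minus_commute abs_le_iff)
      then show "\<forall>\<^sub>F k in sequentially. norm (G (u k) - G w) \<le> K * norm (u k - w)" by simp
      show "(\<lambda>k. K * norm (u k - w)) \<longlonglongrightarrow> 0"
        by (rule tendsto_mult_right_zero[OF tendsto_norm_zero[OF LIM_zero[OF w]]])
    qed
    have "f w \<le> ereal (C - G w)"
    proof (rule lsc_fun_le_limit[OF f(1) w])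
      show "(\<lambda>k. d k - G (u k)) \<longlonglongrightarrow> C - G w" by (rule tendsto_diff[OF d G_lim])
      fix k
      have "f (u k) = ereal (fr (u k))" using u[of k] by (intro fr) (simp add: E_def)
      then show "f (u k) \<le> ereal (d k - G (u k))" using le[of k] by (simp add: F_def)
    qed
    moreover from this have fin: "f w < \<infinity>" by (rule le_less_trans) simp
    moreover have "infdist w Seg \<le> r"
      using u by (intro LIMSEQ_le_const2[OF tendsto_infdist[OF w]]) (auto simp: E_def)
    ultimately show ?thesis using wY fr[OF fin] by (simp add: E_def F_def)
  qed
  define Nk where "Nk k = N ((1/2) ^ k)" for k :: nat
  define Nk' where "Nk' k = N' ((1/2) ^ k)" for k :: nat
  have Nk: "smooth_norm_approx ((1/2) ^ k) Y (Nk k) (Nk' k)" for k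
    unfolding Nk_def Nk'_def by (rule N) simp
  have "\<exists>u w. (\<forall>k. u k \<in> E) \<and> bounded (range u) \<and> w \<in> E \<and>
      (\<forall>z\<in>E. F w + perturbation \<epsilon>1 Nk u w \<le> F z + perturbation \<epsilon>1 Nk u z)"
  proof (rule smooth_variational_principle[OF Y(1) EY _ Nk])
    show "E \<noteq> {}" using aE by blast
    show "m - \<rho> \<le> F z" if "z \<in> E" for z by (rule F_low[OF that])
    show "w \<in> E \<and> F w \<le> C"
      if "\<And>k. u k \<in> E" "u \<longlonglongrightarrow> w" "\<And>k. F (u k) \<le> d k" "d \<longlonglongrightarrow> C" for u w d C
      by (rule F_lsc[OF that])
  qed (rule \<epsilon>1(1))
  then obtain u w where u: "\<And>k. u k \<in> E" and bu: "bounded (range u)" and wE: "w \<in> E"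
    and wmin: "\<And>z. z \<in> E \<Longrightarrow> F w + perturbation \<epsilon>1 Nk u w \<le> F z + perturbation \<epsilon>1 Nk u z"
    by blast
  have wY: "w \<in> Y" and fw: "f w < \<infinity>" using wE by (auto simp: E_def)
  have uY: "u k \<in> Y" for k using u EY by blast
  obtain B where B: "\<And>k. norm (u k) \<le> B" using bu by (auto simp: bounded_iff)
  have k1: "(1/2::real) ^ k \<le> 1" for k by (simp add: power_le_one)
  define P where "P = perturbation \<epsilon>1 Nk u"
  have P_Lip: "\<bar>P x - P z\<bar> \<le> \<epsilon>1 * norm (x - z)" if "x \<in> Y" "z \<in> Y" for x z
    unfolding P_def by (rule perturbation_Lipschitz[OF Y(1) Nk k1 uY B less_imp_le[OF \<epsilon>1(1)] that])
  obtain P' where P': "P' \<in> subspace_dual Y" "\<And>h. h \<in> Y \<Longrightarrow> \<bar>P' h\<bar> \<le> \<epsilon>1 * norm h"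
    "\<And>e. 0 < e \<Longrightarrow> \<exists>\<delta>>0. \<forall>h\<in>Y. norm h < \<delta> \<longrightarrow> P (w + h) \<le> P w + P' h + e * norm h"
    using perturbation_smooth[where u = u and N = Nk, OF Y(1) Nk k1 uY B \<epsilon>1(1) wY] unfolding P_def by blast
  define t where "t = \<tau> w"
  have t: "0 \<le> t" "t \<le> 1" using \<tau>[OF wY] by (auto simp: t_def)
  define x where "x = w - c t"
  have xY: "x \<in> Y" unfolding x_def by (rule ucY[OF wY])
  obtain t' where t': "0 \<le> t'" "t' \<le> 1" "norm (w - c t') < 2 * r" using E_near[OF wE, of "2 * r"] r(1) by auto
  have near_w: "norm (z - w) \<le> R" if "norm (z - c t') \<le> (s + 1) * norm v" for z
    using norm_triangle_ineq4[of "z - c t'" "w - c t'"] that t'(3) by (simp add: R_def)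
  have aw: "norm (a - w) \<le> R"
  proof (rule near_w)
    have "norm (a - c t') = t' * norm v" using t' by (simp add: c_def)
    also have "\<dots> \<le> (s + 1) * norm v" using t' s by (intro mult_right_mono) auto
    finally show "norm (a - c t') \<le> (s + 1) * norm v" .
  qed
  have p_c: "p - c q = (s + 1 - q) *\<^sub>R v" for q by (simp add: p c_def v_def algebra_simps)
  have pw: "norm (p - w) \<le> R"
  proof (rule near_w)
    have "norm (p - c t') = (s + 1 - t') * norm v" unfolding p_c using t' s by simp
    also have "\<dots> \<le> (s + 1) * norm v" using t' by (intro mult_right_mono) auto
    finally show "norm (p - c t') \<le> (s + 1) * norm v" .
  qed
  \<comment> \<open>The competitor is \<open>a\<close> with parameter 0; smoothing and perturbation
    contribute one \<sigma> each.\<close>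
  have w_value: "fr w + H w t \<le> fr a + 2 * \<sigma>"
  proof -
    have "G a \<le> H a 0" unfolding G_def by (rule \<tau>_min[OF aY]) simp
    also have "H a 0 = K * L 0" by (simp add: H_def c_def)
    also have "\<dots> \<le> \<sigma>" using mult_left_mono[OF L0, of K] K(1) \<kappa>(2) by simp
    finally have "F a \<le> fr a + \<sigma>" by (simp add: F_def)
    moreover have "P a - P w \<le> \<sigma>"
      using P_Lip[OF aY wY] mult_left_mono[OF aw, of \<epsilon>1] \<epsilon>1 by linarith
    ultimately show ?thesis using wmin[OF aE] by (simp add: F_def G_def P_def t_def)
  qed
  have xr: "norm x < r"
  proof -
    have "K * norm x \<le> fr a - m + \<rho> + 2 * \<sigma>"
      using H_low[OF wY, of t] t w_value fm[OF wE] by (simp add: x_def)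
    also have "\<dots> < K * r" using \<sigma>(2) \<rho> K(2) by simp
    finally show ?thesis using K(1) by simp
  qed
  \<comment> \<open>At t = 1 the point \<open>w\<close> would be so close to \<open>b\<close> that
    its value exceeds fr a + 2 \<rho>, while the parameter gains only \<rho>.\<close>
  have "t \<noteq> 1"
  proof
    assume "t = 1"
    then have "x = w - b" by (simp add: x_def c_def v_def)
    then have "ereal M < f w" using xr r(3) by (intro \<eta>(2)) simp
    then have "M < fr w" using fr[OF fw] by simp
    moreover have "- \<rho> \<le> H w t"
      using H_low[OF wY, of t] t K(1) norm_ge_zero[of "w - c t"] by (smt (verit) atLeastAtMost_iff mult_nonneg_nonneg)
    moreover have "M = fr a + 2 * \<rho>" by (simp add: \<rho>_def field_simps)
    ultimately show False using w_value \<sigma>(2) \<rho> by linarith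
  qed
  then have t1: "t < 1" using t by simp
  note L'x = smooth_norm_approxD(3-6)[OF L xY]
  \<comment> \<open>Since t < 1, the parameter can be increased; minimality in \<open>t\<close> then
    gives a one-sided derivative, which has the sign required even when t = 0.\<close>
  have slope: "K * L' x v \<le> - \<rho>"
  proof (rule field_le_epsilon)
    fix e :: real assume e: "0 < e"
    define e1 where "e1 = e / (K * (norm v + 1))"
    have nv: "0 < norm v + 1" by (simp add: add_nonneg_pos)
    have e1: "0 < e1" using e K(1) nv by (simp add: e1_def)
    obtain \<delta> where \<delta>: "0 < \<delta>" "\<And>h. h \<in> Y \<Longrightarrow> norm h < \<delta> \<Longrightarrow> L (x + h) \<le> L x + L' x h + e1 * norm h"
      using L'x(4)[OF e1] by blast
    define q where "q = min (1 - t) (\<delta> / (2 * (norm v + 1)))"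
    have q: "0 < q" "t + q \<le> 1" using t1 \<delta>(1) nv by (auto simp: q_def)
    have "q \<le> \<delta> / (2 * (norm v + 1))" by (simp add: q_def)
    then have "q * (norm v + 1) \<le> \<delta> / 2" using nv by (simp add: field_simps)
    then have qv: "norm ((- q) *\<^sub>R v) < \<delta>" using q(1) \<delta>(1) by (simp add: algebra_simps)
    have "H w t \<le> H w (t + q)" unfolding t_def by (rule \<tau>_min[OF wY]) (use t q in \<open>auto simp: t_def\<close>)
    moreover have "w - c (t + q) = x + (- q) *\<^sub>R v" by (simp add: x_def c_def algebra_simps)
    ultimately have "K * L x + \<rho> * q \<le> K * L (x + (- q) *\<^sub>R v)" by (simp add: H_def x_def algebra_simps)
    also have "\<dots> \<le> K * (L x + L' x ((- q) *\<^sub>R v) + e1 * norm ((- q) *\<^sub>R v))"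
      using K(1) \<delta>(2)[OF subspace_scale[OF Y(1) vY] qv] by simp
    also have "L' x ((- q) *\<^sub>R v) = - q * L' x v" by (rule subspace_dualD(2)[OF L'x(1) vY])
    also have "norm ((- q) *\<^sub>R v) = q * norm v" using q(1) by simp
    finally have "q * (K * L' x v) \<le> q * (- \<rho> + K * (e1 * norm v))" by (simp add: algebra_simps)
    then have "K * L' x v \<le> - \<rho> + K * (e1 * norm v)" using q(1) by simp
    also have "K * (e1 * norm v) \<le> K * (e1 * (norm v + 1))" using K(1) e1 by simp
    also have "K * (e1 * (norm v + 1)) = e" using K(1) nv by (simp add: e1_def)
    finally show "K * L' x v \<le> - \<rho> + e" by simp
  qed
  define g where "g h = (- K) * L' x h + (- 1) * P' h" for h
  have g: "g \<in> subspace_dual Y" unfolding g_def by (rule subspace_dual_combination[OF L'x(1) P'(1)])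
  \<comment> \<open>The vector splits into p - c t, a positive multiple of \<open>v\<close> on which
    the slope yields at least s \<rho>, and - x, where convexity between \<open>x\<close> and 0
    loses at most \<sigma>. The perturbation loses at most another \<sigma>.\<close>
  have "0 < g (p - w)"
  proof -
    have pY: "p \<in> Y" unfolding p by (intro subspace_add subspace_scale subspace_diff Y(1) aY bY)
    have "L' x (p - w) = L' x ((p - c t) - x)" by (simp add: x_def)
    also have "\<dots> = L' x (p - c t) - L' x x" by (rule subspace_dual_diff[OF L'x(1) Y(1) ucY[OF pY] xY])
    also have "L' x (p - c t) = (s + 1 - t) * L' x v" unfolding p_c by (rule subspace_dualD(2)[OF L'x(1) vY])
    finally have Lpw: "L' x (p - w) = (s + 1 - t) * L' x v - L' x x" .
    have 1: "- K * L' x (p - w) = (s + 1 - t) * (- (K * L' x v)) + K * L' x x"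
      unfolding Lpw by (simp add: algebra_simps)
    have "s * \<rho> \<le> (s + 1 - t) * \<rho>" using t \<rho> by (intro mult_right_mono) auto
    also have "\<dots> \<le> (s + 1 - t) * (- (K * L' x v))" using slope t s by (intro mult_left_mono) auto
    finally have 2: "s * \<rho> \<le> (s + 1 - t) * (- (K * L' x v))" .
    have "L x + L' x (0 - x) \<le> L 0" by (rule L'x(3)[OF subspace_0[OF Y(1)]])
    moreover have "L' x (0 - x) = - L' x x" using subspace_dualD(2)[OF L'x(1) xY, of "- 1"] by simp
    ultimately have "- \<kappa> \<le> L' x x" using L0 smooth_norm_approxD(1)[OF L xY] norm_ge_zero[of x] by linarith
    then have 3: "- \<sigma> \<le> K * L' x x" using mult_left_mono[of "- \<kappa>" "L' x x" K] K(1) \<kappa>(2) by simp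
    have 4: "\<bar>P' (p - w)\<bar> \<le> \<sigma>"
      using P'(2)[OF subspace_diff[OF Y(1) pY wY]] mult_left_mono[OF pw, of \<epsilon>1] \<epsilon>1 by linarith
    have "0 < s * \<rho>" using s \<rho> by simp
    then show ?thesis using 1 2 3 4 \<sigma>(3) unfolding g_def by linarith
  qed
  moreover have "\<exists>\<delta>>0. \<forall>u\<in>Y. norm (u - w) < \<delta> \<longrightarrow> f w + ereal (g (u - w) - e * norm (u - w)) \<le> f u" if e: "0 < e" for e
  proof -
    have e2: "0 < e / (2 * K)" "0 < e / 2" using e K(1) by auto
    obtain \<delta>1 where \<delta>1: "0 < \<delta>1"
      "\<And>h. h \<in> Y \<Longrightarrow> norm h < \<delta>1 \<Longrightarrow> L (x + h) \<le> L x + L' x h + e / (2 * K) * norm h"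
      using L'x(4)[OF e2(1)] by blast
    obtain \<delta>2 where \<delta>2: "0 < \<delta>2"
      "\<And>h. h \<in> Y \<Longrightarrow> norm h < \<delta>2 \<Longrightarrow> P (w + h) \<le> P w + P' h + e / 2 * norm h"
      using P'(3)[OF e2(2)] by blast
    \<comment> \<open>The bound \<open>r - norm x\<close> keeps the competitor inside the tube,
      where the minimality of \<open>w\<close> is known.\<close>
    define \<delta> where "\<delta> = min (min \<delta>1 \<delta>2) (r - norm x)"
    have "f w + ereal (g (z - w) - e * norm (z - w)) \<le> f z" if z: "z \<in> Y" "norm (z - w) < \<delta>" for z
    proof (cases "f z < \<infinity>")
      case True
      define h where "h = z - w"
      have h: "h \<in> Y" "norm h < \<delta>1" "norm h < \<delta>2" "norm h + norm x < r"
        using z subspace_diff[OF Y(1) z(1) wY] by (auto simp: h_def \<delta>_def)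
      have "infdist z Seg \<le> dist z (c t)" by (rule infdist_le) (use t in \<open>auto simp: Seg_def\<close>)
      also have "\<dots> \<le> norm h + norm x" using norm_triangle_ineq[of h x] by (simp add: dist_norm h_def x_def)
      finally have "z \<in> E" using z(1) True h(4) by (simp add: E_def)
      from wmin[OF this] have "fr w + H w t + P w \<le> fr z + G z + P z" by (simp add: F_def G_def P_def t_def)
      moreover have "G z \<le> H z t" unfolding G_def by (rule \<tau>_min[OF z(1)]) (use t in auto)
      ultimately have 1: "fr w + H w t + P w \<le> fr z + H z t + P z" by simp
      have zx: "z - c t = x + h" "z = w + h" by (auto simp: x_def h_def)
      have "K * L (x + h) \<le> K * (L x + L' x h + e / (2 * K) * norm h)" using \<delta>1(2)[OF h(1,2)] K(1) by simp
      then have "H z t \<le> H w t + K * L' x h + e / 2 * norm h"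
        using K(1) unfolding H_def zx(1) x_def[symmetric] by (simp add: algebra_simps)
      moreover have "P z \<le> P w + P' h + e / 2 * norm h" using \<delta>2(2)[OF h(1,3)] by (simp add: zx(2))
      ultimately have "fr w + (g h - e * norm h) \<le> fr z" using 1 unfolding g_def by simp
      then show ?thesis using fr[OF fw] fr[OF True] by (simp add: h_def)
    qed simp
    moreover have "0 < \<delta>" using \<delta>1(1) \<delta>2(1) xr by (simp add: \<delta>_def)
    ultimately show ?thesis by blast
  qed
  moreover have "norm (w - (a + t *\<^sub>R (b - a))) < \<epsilon>" using xr r(4) by (simp add: x_def c_def v_def)
  ultimately show ?thesis using wY g t fw by (intro bexI[of _ w] bexI[of _ g] bexI[of _ t]) auto
qed

theorem mean_value_separable_dual:
  fixes f :: "'a::banach \<Rightarrow> ereal"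
  assumes Y: "subspace Y" "closed Y" "separable_set Y" "separable_dual Y"
    and f: "lsc_fun f" "\<And>x. f x \<noteq> -\<infinity>" and ab: "a \<in> Y" "b \<in> Y" "f a < f b"
    and s: "0 < s" and p: "p = b + s *\<^sub>R (b - a)" and \<epsilon>: "0 < \<epsilon>"
  shows "\<exists>w\<in>Y. \<exists>g\<in>subspace_dual Y. \<exists>t\<in>{0..1}. norm (w - (a + t *\<^sub>R (b - a))) < \<epsilon> \<and> f w < \<infinity> \<and> 0 < g (p - w) \<and>
    (\<forall>e>0. \<exists>\<delta>>0. \<forall>u\<in>Y. norm (u - w) < \<delta> \<longrightarrow> f w + ereal (g (u - w) - e * norm (u - w)) \<le> f u)"
proof -
  have "\<forall>\<kappa>. \<exists>M. 0 < \<kappa> \<longrightarrow> smooth_norm_approx \<kappa> Y (fst M) (snd M)"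
    using smooth_norm_approx_exists[OF Y(1,3,4)] by (metis fst_conv snd_conv)
  then obtain M where M: "\<And>\<kappa>. 0 < \<kappa> \<Longrightarrow> smooth_norm_approx \<kappa> Y (fst (M \<kappa>)) (snd (M \<kappa>))" by metis
  show ?thesis by (rule mean_value_smooth_subspace[OF Y(1,2) M f ab s p \<epsilon>])
qed

section \<open>Separable reduction\<close>

lemma le_frechet_quotient_iff:
  fixes n r d fx :: real
  assumes "0 < n" "F \<noteq> -\<infinity>"
  shows "ereal r \<le> (F - ereal fx - ereal d) / ereal n \<longleftrightarrow> ereal fx + ereal (d + r * n) \<le> F"
proof (cases F)
  case (real a)
  then show ?thesis using assms by (simp add: field_simps)
qed (use assms in auto)

lemma frechet_subdiff_iff:
  fixes f :: "'a::real_normed_vector \<Rightarrow> ereal"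
  assumes f: "\<And>x. f x \<noteq> -\<infinity>"
  shows "v \<in> frechet_subdiff f x \<longleftrightarrow> f x < \<infinity> \<and>
    (\<forall>e>0. \<exists>\<delta>>0. \<forall>y. norm (y - x) < \<delta> \<longrightarrow> f x + ereal (blinfun_apply v (y - x) - e * norm (y - x)) \<le> f y)"
proof (cases "f x < \<infinity>")
  case True
  then obtain fx where fx: "f x = ereal fx" using f[of x] by (cases "f x") auto
  define Q where "Q y = (f y - f x - ereal (blinfun_apply v (y - x))) / ereal (norm (y - x))" for y
  have Q: "ereal (- e) \<le> Q y \<longleftrightarrow> f x + ereal (blinfun_apply v (y - x) - e * norm (y - x)) \<le> f y" if "y \<noteq> x" for e y
    unfolding Q_def fx using le_frechet_quotient_iff[of "norm (y - x)" "f y" "- e" fx] that f[of y] by simp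
  have "v \<in> frechet_subdiff f x \<longleftrightarrow> (\<forall>c<0. \<forall>\<^sub>F y in at x. c < Q y)"
    using True by (simp add: frechet_subdiff_def edom_def le_Liminf_iff Q_def)
  also have "\<dots> \<longleftrightarrow> (\<forall>e>0. \<forall>\<^sub>F y in at x. ereal (- e) \<le> Q y)"
  proof (intro iffI allI impI)
    fix e :: real assume *: "\<forall>c<0. \<forall>\<^sub>F y in at x. c < Q y" "0 < e"
    then have "\<forall>\<^sub>F y in at x. ereal (- e) < Q y" by simp
    then show "\<forall>\<^sub>F y in at x. ereal (- e) \<le> Q y" by (rule eventually_mono) (rule less_imp_le)
  next
    fix c :: ereal assume *: "\<forall>e>0. \<forall>\<^sub>F y in at x. ereal (- e) \<le> Q y" "c < 0"
    then obtain z where z: "c < ereal z" "ereal z < 0" using ereal_dense2 by blast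
    then have "0 < - z" by simp
    with *(1) have "\<forall>\<^sub>F y in at x. ereal (- (- z)) \<le> Q y" by blast
    then show "\<forall>\<^sub>F y in at x. c < Q y" by (rule eventually_mono) (use z in \<open>auto intro: less_le_trans\<close>)
  qed
  also have "\<dots> \<longleftrightarrow> (\<forall>e>0. \<exists>\<delta>>0. \<forall>y. norm (y - x) < \<delta> \<longrightarrow>
      f x + ereal (blinfun_apply v (y - x) - e * norm (y - x)) \<le> f y)"
  proof -
    have "(\<forall>\<^sub>F y in at x. ereal (- e) \<le> Q y) \<longleftrightarrow> (\<exists>\<delta>>0. \<forall>y. norm (y - x) < \<delta> \<longrightarrow>
      f x + ereal (blinfun_apply v (y - x) - e * norm (y - x)) \<le> f y)" for e
    proof -
      have "(y \<noteq> x \<and> dist y x < \<delta> \<longrightarrow> ereal (- e) \<le> Q y) \<longleftrightarrow> (norm (y - x) < \<delta> \<longrightarrow>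
        f x + ereal (blinfun_apply v (y - x) - e * norm (y - x)) \<le> f y)" for y \<delta>
        using Q[of y e] by (cases "y = x") (auto simp: dist_norm fx)
      then show ?thesis by (simp add: eventually_at)
    qed
    then show ?thesis by simp
  qed
  finally show ?thesis using True by simp
qed (simp add: frechet_subdiff_def edom_def)

text \<open>A closing-off argument: sums, rational multiples and witnesses are added countably
  often. Where no witness exists, \<open>SOME\<close> still contributes a countable set, which does
  no harm.\<close>

lemma countable_closure_under_choices:
  fixes P :: "'i::countable \<Rightarrow> 'a::real_vector \<Rightarrow> 'z \<Rightarrow> bool" and pts :: "'z \<Rightarrow> 'a set"
  assumes "countable S0" "\<And>z. countable (pts z)"
  shows "\<exists>S. countable S \<and> S0 \<subseteq> S \<and> (\<forall>x\<in>S. \<forall>y\<in>S. x + y \<in> S) \<and> (\<forall>r::rat. \<forall>x\<in>S. real_of_rat r *\<^sub>R x \<in> S) \<and>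
    (\<forall>i. \<forall>x\<in>S. (\<exists>z. P i x z) \<longrightarrow> (\<exists>z. pts z \<subseteq> S \<and> P i x z))"
proof -
  define step where "step T = T \<union> (\<lambda>(x, y). x + y) ` (T \<times> T) \<union> (\<lambda>(r, x). real_of_rat r *\<^sub>R x) ` (UNIV \<times> T) \<union>
    (\<Union>i. \<Union>x\<in>T. pts (SOME z. P i x z))" for T
  define S where "S = (\<Union>n. (step ^^ n) S0)"
  have cstep: "countable (step T)" if "countable T" for T
    unfolding step_def using that assms(2) by (intro countable_Un countable_image countable_SIGMA countable_UN) auto
  have "countable ((step ^^ n) S0)" for n by (induction n) (use assms(1) cstep in auto)
  then have "countable S" unfolding S_def by blast
  have inc: "(step ^^ n) S0 \<subseteq> (step ^^ m) S0" if "n \<le> m" for n m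
    using that by (rule lift_Suc_mono_le[rotated]) (auto simp: step_def)
  have in_S: "x \<in> S" if "x \<in> step ((step ^^ n) S0)" for x n
    unfolding S_def using that by (intro UN_I[of "Suc n"]) auto
  have S0: "S0 \<subseteq> S" unfolding S_def by (intro UN_upper[of 0, THEN subset_trans[rotated]]) auto
  have add: "x + y \<in> S" if xy: "x \<in> S" "y \<in> S" for x y
  proof -
    obtain n m where "x \<in> (step ^^ n) S0" "y \<in> (step ^^ m) S0" using xy by (auto simp: S_def)
    then have "x \<in> (step ^^ max n m) S0" "y \<in> (step ^^ max n m) S0" using inc by (meson max.cobounded1 max.cobounded2 subsetD)+
    then show ?thesis by (intro in_S[of _ "max n m"]) (auto simp: step_def)
  qed
  have scale: "real_of_rat r *\<^sub>R x \<in> S" if x: "x \<in> S" for r x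
  proof -
    obtain n where "x \<in> (step ^^ n) S0" using x by (auto simp: S_def)
    then show ?thesis by (intro in_S[of _ n]) (auto simp: step_def)
  qed
  have choice: "\<exists>z. pts z \<subseteq> S \<and> P i x z" if x: "x \<in> S" and ex: "\<exists>z. P i x z" for i x
  proof -
    obtain n where n: "x \<in> (step ^^ n) S0" using x by (auto simp: S_def)
    have "pts (SOME z. P i x z) \<subseteq> step ((step ^^ n) S0)" using n unfolding step_def by blast
    then have "pts (SOME z. P i x z) \<subseteq> S" using in_S by blast
    then show ?thesis using someI_ex[OF ex] by blast
  qed
  show ?thesis
    by (intro exI[of _ S] conjI ballI allI impI S0 add scale choice \<open>countable S\<close>)
qed

lemma subspace_closure_rational:
  fixes S :: "'a::real_normed_vector set"
  assumes "S \<noteq> {}" "\<forall>x\<in>S. \<forall>y\<in>S. x + y \<in> S" "\<forall>r::rat. \<forall>x\<in>S. real_of_rat r *\<^sub>R x \<in> S"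
  shows "subspace (closure S)"
proof (rule subspaceI)
  obtain x where "x \<in> S" using assms(1) by blast
  then have "real_of_rat 0 *\<^sub>R x \<in> S" using assms(3) by blast
  then show "0 \<in> closure S" using closure_subset by auto
next
  fix x y assume "x \<in> closure S" "y \<in> closure S"
  then obtain u v where "\<And>n. u n \<in> S" "u \<longlonglongrightarrow> x" "\<And>n. v n \<in> S" "v \<longlonglongrightarrow> y"
    by (auto simp: closure_sequential)
  then show "x + y \<in> closure S" unfolding closure_sequential
    using assms(2) by (intro exI[of _ "\<lambda>n. u n + v n"]) (auto intro: tendsto_add)
next
  fix c :: real and x assume "x \<in> closure S"
  then obtain u where u: "\<And>n. u n \<in> S" "u \<longlonglongrightarrow> x" by (auto simp: closure_sequential)
  have "\<exists>q\<in>\<rat>. dist q c < e" if "0 < e" for e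
    using Rats_dense_in_real[of c "c + e"] that by (force simp: dist_real_def)
  then have "c \<in> closure \<rat>" by (simp add: closure_approachable)
  then obtain r where r: "\<And>n. r n \<in> \<rat>" "r \<longlonglongrightarrow> c" by (auto simp: closure_sequential)
  then have "r n *\<^sub>R u n \<in> S" for n using assms(3) u(1) by (metis Rats_cases)
  then show "c *\<^sub>R x \<in> closure S" unfolding closure_sequential
    using tendsto_scaleR[OF r(2) u(2)] by (intro exI[of _ "\<lambda>n. r n *\<^sub>R u n"]) auto
qed

text \<open>By Hahn-Banach, a subgradient \<open>x*\<close> of \<open>f\<close> at \<open>v\<close> with \<open>\<parallel>x*\<parallel> \<le> c\<close> and \<open>x*(p - v) \<ge> \<beta>\<close> exists iff
  \<open>penalty f p c \<tau> zs v \<ge> (\<Sum>\<mu>) f v + \<tau> \<beta>\<close> for all \<open>\<tau>\<close> and all finite families \<open>zs\<close> of quadruples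
  \<open>(\<mu>, \<epsilon>, \<delta>, u)\<close> with \<open>\<parallel>u - v\<parallel> < \<delta>\<close>, where \<open>\<delta>\<close> is the radius belonging to the error \<open>\<epsilon>\<close>. Since \<open>v\<close> enters
  the penalty in a Lipschitz way, this family of inequalities is determined by a countable set.\<close>

definition penalty :: "('a::real_normed_vector \<Rightarrow> ereal) \<Rightarrow> 'a \<Rightarrow> real \<Rightarrow> real \<Rightarrow> (real \<times> real \<times> real \<times> 'a) list \<Rightarrow> 'a \<Rightarrow> real" where
  "penalty f p c \<tau> zs v = (\<Sum>(\<mu>, \<epsilon>, \<delta>, u)\<leftarrow>zs. \<mu> * (real_of_ereal (f u) + \<epsilon> * norm (u - v)))
     + c * norm ((\<Sum>(\<mu>, \<epsilon>, \<delta>, u)\<leftarrow>zs. \<mu> *\<^sub>R (u - v)) - \<tau> *\<^sub>R (p - v))"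

text \<open>These data determine, together with \<open>c\<close> and \<tau>, the Lipschitz constant
  of the penalty in the base point; radii and points do not enter, so exchanging the points keeps
  the constant.\<close>

definition weights :: "(real \<times> real \<times> real \<times> 'a) list \<Rightarrow> (real \<times> real) list" where
  "weights zs = map (\<lambda>(\<mu>, \<epsilon>, \<delta>, u). (\<mu>, \<epsilon>)) zs"

lemma penalty_Lipschitz:
  assumes zs: "\<forall>(\<mu>, \<epsilon>) \<in> set (weights zs). 0 \<le> \<mu> \<and> 0 \<le> \<epsilon>" and c: "0 \<le> c"
  shows "penalty f p c \<tau> zs v \<le> penalty f p c \<tau> zs w +
    ((\<Sum>(\<mu>, \<epsilon>)\<leftarrow>weights zs. \<mu> * \<epsilon>) + c * ((\<Sum>(\<mu>, \<epsilon>)\<leftarrow>weights zs. \<mu>) + \<bar>\<tau>\<bar>)) * norm (v - w)"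
proof -
  have 1: "(\<Sum>(\<mu>, \<epsilon>, \<delta>, u)\<leftarrow>zs. \<mu> * (real_of_ereal (f u) + \<epsilon> * norm (u - v)))
     \<le> (\<Sum>(\<mu>, \<epsilon>, \<delta>, u)\<leftarrow>zs. \<mu> * (real_of_ereal (f u) + \<epsilon> * norm (u - w))) + (\<Sum>(\<mu>, \<epsilon>)\<leftarrow>weights zs. \<mu> * \<epsilon>) * norm (v - w)"
    using zs unfolding weights_def
  proof (induction zs)
    case (Cons z zs)
    obtain \<mu> \<epsilon> \<delta> u where z: "z = (\<mu>, \<epsilon>, \<delta>, u)" by (cases z)
    have "norm (u - v) \<le> norm (u - w) + norm (v - w)" using norm_triangle_ineq4[of "u - w" "v - w"] by simp
    then have "\<mu> * \<epsilon> * norm (u - v) \<le> \<mu> * \<epsilon> * (norm (u - w) + norm (v - w))"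
      using Cons.prems by (intro mult_left_mono) (auto simp: z)
    with Cons show ?case by (simp add: z algebra_simps)
  qed simp
  have 2: "(\<Sum>(\<mu>, \<epsilon>, \<delta>, u)\<leftarrow>zs. \<mu> *\<^sub>R (u - v))
     = (\<Sum>(\<mu>, \<epsilon>, \<delta>, u)\<leftarrow>zs. \<mu> *\<^sub>R (u - w)) - (\<Sum>(\<mu>, \<epsilon>)\<leftarrow>weights zs. \<mu>) *\<^sub>R (v - w)"
    unfolding weights_def by (induction zs) (auto simp: algebra_simps)
  define m where "m = (\<Sum>(\<mu>, \<epsilon>)\<leftarrow>weights zs. \<mu>)"
  define X where "X = (\<Sum>(\<mu>, \<epsilon>, \<delta>, u)\<leftarrow>zs. \<mu> *\<^sub>R (u - w)) - \<tau> *\<^sub>R (p - w)"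
  have m: "0 \<le> m" unfolding m_def using zs by (intro sum_list_nonneg) auto
  have "(\<Sum>(\<mu>, \<epsilon>, \<delta>, u)\<leftarrow>zs. \<mu> *\<^sub>R (u - v)) - \<tau> *\<^sub>R (p - v) = X + (\<tau> - m) *\<^sub>R (v - w)"
    unfolding 2 X_def m_def by (simp add: algebra_simps)
  also have "norm \<dots> \<le> norm X + \<bar>\<tau> - m\<bar> * norm (v - w)" by (rule norm_triangle_le) simp
  also have "\<dots> \<le> norm X + (m + \<bar>\<tau>\<bar>) * norm (v - w)" using m by (intro add_left_mono mult_right_mono) auto
  finally have "c * norm ((\<Sum>(\<mu>, \<epsilon>, \<delta>, u)\<leftarrow>zs. \<mu> *\<^sub>R (u - v)) - \<tau> *\<^sub>R (p - v))
      \<le> c * (norm X + (m + \<bar>\<tau>\<bar>) * norm (v - w))" using c by (rule mult_left_mono)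
  with 1 show ?thesis unfolding penalty_def X_def m_def by (simp add: algebra_simps)
qed

text \<open>The index consists of rationals and a natural norm bound, so it ranges over a countable
  type; the strict inequalities leave room for moving the base point.\<close>

definition realises ::
    "('a::real_normed_vector \<Rightarrow> ereal) \<Rightarrow> 'a \<Rightarrow> (rat \<times> rat \<times> rat) list \<times> rat \<times> nat \<times> rat \<Rightarrow> 'a
     \<Rightarrow> (real \<times> real \<times> real \<times> 'a) list \<Rightarrow> bool" where
  "realises f p i v zs \<longleftrightarrow> (case i of (l, \<tau>, c, q) \<Rightarrow>
     map (\<lambda>(\<mu>, \<epsilon>, \<delta>, u). (\<mu>, \<epsilon>, \<delta>)) zs = map (\<lambda>(\<mu>, \<epsilon>, \<delta>). (real_of_rat \<mu>, real_of_rat \<epsilon>, real_of_rat \<delta>)) l \<and>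
     (\<forall>(\<mu>, \<epsilon>, \<delta>, u) \<in> set zs. f u < \<infinity> \<and> norm (u - v) < \<delta>) \<and>
     penalty f p (real c) (real_of_rat \<tau>) zs v < real_of_rat q)"

abbreviation "points zs \<equiv> (\<lambda>(\<mu>, \<epsilon>, \<delta>, u). u) ` set zs"

text \<open>A violation at \<open>w\<close> is moved to a nearby \<open>v\<close> in
  \<open>S\<close>, where a rational index describes it and points of \<open>S\<close> realise it,
  and is then moved back to \<open>w\<close>. Shrinking the radii by \<gamma> beforehand lets both
  moves stay within them.\<close>

lemma penalty_violation_in_countable:
  fixes f :: "'a::real_normed_vector \<Rightarrow> ereal" and c :: nat
  assumes S: "\<forall>i. \<forall>v\<in>S. (\<exists>zs. realises f p i v zs) \<longrightarrow> (\<exists>zs. points zs \<subseteq> S \<and> realises f p i v zs)"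
    and w: "w \<in> closure S" and \<tau>: "\<tau> \<in> \<rat>"
    and zs: "\<forall>(\<mu>, \<epsilon>, \<delta>, u) \<in> set zs. 0 \<le> \<mu> \<and> 0 \<le> \<epsilon> \<and> \<mu> \<in> \<rat> \<and> \<epsilon> \<in> \<rat> \<and> \<delta> \<in> \<rat> \<and> f u < \<infinity> \<and> norm (u - w) < \<delta>"
    and less: "penalty f p (real c) \<tau> zs w < A"
  shows "\<exists>zs'. points zs' \<subseteq> S \<and> weights zs' = weights zs \<and> penalty f p (real c) \<tau> zs' w < A \<and>
    (\<forall>(\<mu>, \<epsilon>, \<delta>', u) \<in> set zs'. f u < \<infinity> \<and> (\<exists>\<delta> u'. (\<mu>, \<epsilon>, \<delta>, u') \<in> set zs \<and> norm (u - w) < \<delta>))"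
proof -
  define B where "B = (\<Sum>(\<mu>, \<epsilon>)\<leftarrow>weights zs. \<mu> * \<epsilon>) + real c * ((\<Sum>(\<mu>, \<epsilon>)\<leftarrow>weights zs. \<mu>) + \<bar>\<tau>\<bar>)"
  have co: "\<forall>(\<mu>, \<epsilon>) \<in> set (weights zs). 0 \<le> \<mu> \<and> 0 \<le> \<epsilon>" using zs by (fastforce simp: weights_def)
  \<comment> \<open>One third of the gap each serves for moving to \<open>v\<close>, for fitting in
    a rational bound, and for moving back.\<close>
  define k where "k = (A - penalty f p (real c) \<tau> zs w) / 3"
  have k: "0 < k" using less by (simp add: k_def)
  have "\<exists>\<gamma>\<in>\<rat>. 0 < \<gamma> \<and> (\<forall>(\<mu>, \<epsilon>, \<delta>, u) \<in> set zs. norm (u - w) + 2 * \<gamma> \<le> \<delta>)"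
    using zs
  proof (induction zs)
    case Nil
    show ?case by (rule bexI[of _ 1]) auto
  next
    case (Cons z zs)
    have "\<exists>\<gamma>\<in>\<rat>. 0 < \<gamma> \<and> (\<forall>(\<mu>, \<epsilon>, \<delta>, u) \<in> set zs. norm (u - w) + 2 * \<gamma> \<le> \<delta>)"
      by (rule Cons.IH) (use Cons.prems in simp)
    then obtain \<gamma> where \<gamma>: "0 < \<gamma>" "\<And>\<mu> \<epsilon> \<delta> u. (\<mu>, \<epsilon>, \<delta>, u) \<in> set zs \<Longrightarrow> norm (u - w) + 2 * \<gamma> \<le> \<delta>"
      by blast
    obtain \<mu> \<epsilon> \<delta> u where z: "z = (\<mu>, \<epsilon>, \<delta>, u)" by (cases z)
    have "0 < min \<gamma> ((\<delta> - norm (u - w)) / 2)" using \<gamma>(1) Cons.prems z by simp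
    then obtain \<gamma>' where "\<gamma>' \<in> \<rat>" "0 < \<gamma>'" "\<gamma>' < min \<gamma> ((\<delta> - norm (u - w)) / 2)" using Rats_dense_in_real by blast
    then show ?case using \<gamma>(2) z by (intro bexI[of _ \<gamma>']) (force simp: field_simps)+
  qed
  then obtain \<gamma> where \<gamma>: "\<gamma> \<in> \<rat>" "0 < \<gamma>"
    and \<gamma>': "\<forall>(\<mu>, \<epsilon>, \<delta>, u) \<in> set zs. norm (u - w) + 2 * \<gamma> \<le> \<delta>" by (elim bexE conjE)
  have "0 < min \<gamma> (k / (\<bar>B\<bar> + 1))" using \<gamma> k by simp
  then obtain v where v: "v \<in> S" "dist v w < min \<gamma> (k / (\<bar>B\<bar> + 1))" using w closure_approachable by blast
  have vw: "norm (v - w) < \<gamma>" "B * norm (v - w) < k"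
  proof -
    show "norm (v - w) < \<gamma>" using v by (simp add: dist_norm)
    have "B * norm (v - w) \<le> (\<bar>B\<bar> + 1) * norm (v - w)" by (intro mult_right_mono) auto
    also have "\<dots> < k" using v(2) by (simp add: dist_norm field_simps)
    finally show "B * norm (v - w) < k" .
  qed
  obtain q where q: "q \<in> \<rat>" "penalty f p (real c) \<tau> zs w + k < q" "q < penalty f p (real c) \<tau> zs w + 2 * k"
    using Rats_dense_in_real[of "penalty f p (real c) \<tau> zs w + k" "penalty f p (real c) \<tau> zs w + 2 * k"] k by auto
  obtain q' \<tau>' where q': "q = real_of_rat q'" and \<tau>': "\<tau> = real_of_rat \<tau>'" using q(1) \<tau> by (auto elim!: Rats_cases)
  define ys where "ys = map (\<lambda>(\<mu>, \<epsilon>, \<delta>, u). (\<mu>, \<epsilon>, \<delta> - \<gamma>, u)) zs"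
  have "\<exists>l. map (\<lambda>(\<mu>, \<epsilon>, \<delta>, u). (\<mu>, \<epsilon>, \<delta>)) ys = map (\<lambda>(\<mu>, \<epsilon>, \<delta>). (real_of_rat \<mu>, real_of_rat \<epsilon>, real_of_rat \<delta>)) l"
    using zs unfolding ys_def
  proof (induction zs)
    case (Cons z zs)
    then obtain l where l: "map (\<lambda>(\<mu>, \<epsilon>, \<delta>, u). (\<mu>, \<epsilon>, \<delta>)) (map (\<lambda>(\<mu>, \<epsilon>, \<delta>, u). (\<mu>, \<epsilon>, \<delta> - \<gamma>, u)) zs)
        = map (\<lambda>(\<mu>, \<epsilon>, \<delta>). (real_of_rat \<mu>, real_of_rat \<epsilon>, real_of_rat \<delta>)) l" by auto
    obtain \<mu> \<epsilon> \<delta> u where z: "z = (\<mu>, \<epsilon>, \<delta>, u)" by (cases z)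
    have "\<mu> \<in> \<rat>" "\<epsilon> \<in> \<rat>" "\<delta> - \<gamma> \<in> \<rat>" using Cons.prems z \<gamma>(1) by auto
    then obtain a b d where "\<mu> = real_of_rat a" "\<epsilon> = real_of_rat b" "\<delta> - \<gamma> = real_of_rat d"
      by (auto elim!: Rats_cases)
    then show ?case using l z by (intro exI[of _ "(a, b, d) # l"]) simp
  qed simp
  then obtain l where l: "map (\<lambda>(\<mu>, \<epsilon>, \<delta>, u). (\<mu>, \<epsilon>, \<delta>)) ys
      = map (\<lambda>(\<mu>, \<epsilon>, \<delta>). (real_of_rat \<mu>, real_of_rat \<epsilon>, real_of_rat \<delta>)) l" by blast
  have "penalty f p (real c) \<tau> ys v = penalty f p (real c) \<tau> zs v"
    by (simp add: penalty_def ys_def o_def case_prod_unfold)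
  also have "\<dots> \<le> penalty f p (real c) \<tau> zs w + B * norm (v - w)"
    unfolding B_def by (rule penalty_Lipschitz[OF co]) simp
  also have "\<dots> < q" using vw(2) q(2) by simp
  finally have pv: "penalty f p (real c) \<tau> ys v < q" .
  have "f u < \<infinity> \<and> norm (u - v) < \<delta>" if mem: "(\<mu>, \<epsilon>, \<delta>, u) \<in> set ys" for \<mu> \<epsilon> \<delta> u
  proof -
    have mem': "(\<mu>, \<epsilon>, \<delta> + \<gamma>, u) \<in> set zs" using mem by (auto simp: ys_def)
    have "norm (u - v) \<le> norm (u - w) + norm (v - w)" using norm_triangle_ineq4[of "u - w" "v - w"] by simp
    then show ?thesis using bspec[OF \<gamma>' mem'] bspec[OF zs mem'] vw(1) by simp
  qed
  then have "realises f p (l, \<tau>', c, q') v ys" using l pv unfolding realises_def q' \<tau>' by auto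
  then obtain zs' where zs': "points zs' \<subseteq> S" "realises f p (l, \<tau>', c, q') v zs'" using S v(1) by blast
  have keys: "map (\<lambda>(\<mu>, \<epsilon>, \<delta>, u). (\<mu>, \<epsilon>, \<delta>)) zs' = map (\<lambda>(\<mu>, \<epsilon>, \<delta>, u). (\<mu>, \<epsilon>, \<delta>)) ys"
    using zs'(2) l by (simp add: realises_def)
  have "map (\<lambda>(\<mu>, \<epsilon>, \<delta>). (\<mu>, \<epsilon>)) (map (\<lambda>(\<mu>, \<epsilon>, \<delta>, u). (\<mu>, \<epsilon>, \<delta>)) zs')
      = map (\<lambda>(\<mu>, \<epsilon>, \<delta>). (\<mu>, \<epsilon>)) (map (\<lambda>(\<mu>, \<epsilon>, \<delta>, u). (\<mu>, \<epsilon>, \<delta>)) ys)" unfolding keys ..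
  then have co': "weights zs' = weights zs" by (simp add: weights_def ys_def o_def case_prod_unfold)
  have "penalty f p (real c) \<tau> zs' w \<le> penalty f p (real c) \<tau> zs' v + B * norm (v - w)"
    using penalty_Lipschitz[of zs' "real c" f p \<tau> w v] co unfolding co' B_def by (simp add: norm_minus_commute)
  also have "\<dots> < A" using zs'(2) vw(2) q(3) by (simp add: realises_def q' \<tau>' k_def field_simps)
  finally have pw: "penalty f p (real c) \<tau> zs' w < A" .
  have "f u < \<infinity> \<and> (\<exists>\<delta> u'. (\<mu>, \<epsilon>, \<delta>, u') \<in> set zs \<and> norm (u - w) < \<delta>)" if mem: "(\<mu>, \<epsilon>, \<delta>', u) \<in> set zs'" for \<mu> \<epsilon> \<delta>' u
  proof -
    have fu: "f u < \<infinity>" "norm (u - v) < \<delta>'" using zs'(2) mem by (auto simp: realises_def)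
    have "(\<mu>, \<epsilon>, \<delta>') \<in> set (map (\<lambda>(\<mu>, \<epsilon>, \<delta>, u). (\<mu>, \<epsilon>, \<delta>)) zs')" using mem by force
    then obtain u' where u': "(\<mu>, \<epsilon>, \<delta>' + \<gamma>, u') \<in> set zs" unfolding keys by (auto simp: ys_def)
    have "norm (u - w) \<le> norm (u - v) + norm (v - w)" using norm_triangle_ineq[of "u - v" "v - w"] by simp
    then show ?thesis using fu vw(1) u' by (intro conjI exI[of _ "\<delta>' + \<gamma>"] exI[of _ u']) auto
  qed
  then show ?thesis using zs'(1) co' pw by (intro exI[of _ zs']) auto
qed

text \<open>The wanted functional solves a system of linear inequalities with a norm bound. If the
  system had an obstruction in the whole space, it would have one with points in \<open>S\<close>;
  but on the closure of \<open>S\<close> the functional \<open>g\<close> satisfies the same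
  inequalities and the same bound.\<close>

lemma subgradient_lift:
  fixes f :: "'a::real_normed_vector \<Rightarrow> ereal"
  assumes f: "\<And>x. f x \<noteq> -\<infinity>"
    and S: "\<forall>i. \<forall>v\<in>S. (\<exists>zs. realises f p i v zs) \<longrightarrow> (\<exists>zs. points zs \<subseteq> S \<and> realises f p i v zs)"
    and Y: "subspace (closure S)" and w: "w \<in> closure S" and p: "p \<in> closure S"
    and g: "g \<in> subspace_dual (closure S)" and fw: "f w < \<infinity>" and pos: "0 < g (p - w)"
    and sub: "\<And>e. 0 < e \<Longrightarrow> \<exists>\<delta>>0. \<forall>u\<in>closure S. norm (u - w) < \<delta> \<longrightarrow>
        f w + ereal (g (u - w) - e * norm (u - w)) \<le> f u"
  shows "\<exists>xs\<in>frechet_subdiff f w. 0 < blinfun_apply xs (p - w)"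
proof -
  define fr where "fr x = real_of_ereal (f x)" for x
  have fr: "f x = ereal (fr x)" if "f x < \<infinity>" for x
    using that f[of x] by (cases "f x") (auto simp: fr_def)
  \<comment> \<open>Countably many errors tending to 0 suffice for a Frechet subgradient, and being
    rational they can enter the indices.\<close>
  define \<epsilon> where "\<epsilon> n = 1 / real (Suc n)" for n
  have \<epsilon>: "0 < \<epsilon> n" "\<epsilon> n \<in> \<rat>" for n by (auto simp: \<epsilon>_def)
  have "\<exists>\<delta>\<in>\<rat>. 0 < \<delta> \<and> (\<forall>u\<in>closure S. norm (u - w) < \<delta> \<longrightarrow> f w + ereal (g (u - w) - \<epsilon> n * norm (u - w)) \<le> f u)" for n
  proof -
    obtain \<delta> where \<delta>: "0 < \<delta>"
      "\<forall>u\<in>closure S. norm (u - w) < \<delta> \<longrightarrow> f w + ereal (g (u - w) - \<epsilon> n * norm (u - w)) \<le> f u"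
      using sub[OF \<epsilon>(1)[of n]] by blast
    obtain q where "q \<in> \<rat>" "0 < q" "q < \<delta>" using Rats_dense_in_real[OF \<delta>(1)] by blast
    then show ?thesis using \<delta>(2) by (intro bexI[of _ q]) auto
  qed
  then obtain \<delta> where \<delta>: "\<And>n. \<delta> n \<in> \<rat>" "\<And>n. 0 < \<delta> n"
    and \<delta>_sub: "\<And>n u. u \<in> closure S \<Longrightarrow> norm (u - w) < \<delta> n \<Longrightarrow> f w + ereal (g (u - w) - \<epsilon> n * norm (u - w)) \<le> f u"
    by metis
  obtain K where K: "\<And>x. x \<in> closure S \<Longrightarrow> \<bar>g x\<bar> \<le> K * norm x" using subspace_dualD(3)[OF g] by blast
  obtain c :: nat where c: "K \<le> real c" using real_arch_simple by blast
  have gc: "\<bar>g x\<bar> \<le> real c * norm x" if "x \<in> closure S" for x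
    using K[OF that] mult_right_mono[OF c, of "norm x"] by simp
  define \<beta> where "\<beta> = g (p - w)"
  define A where "A = {(u - w, fr u - fr w + \<epsilon> n * norm (u - w)) | u n. f u < \<infinity> \<and> norm (u - w) < \<delta> n}"
  have "\<exists>xs :: 'a \<Rightarrow>\<^sub>L real. norm xs \<le> real c \<and> (\<forall>(h, r)\<in>insert (- (p - w), - \<beta>) A. blinfun_apply xs h \<le> r)"
  proof (rule linear_constraints_solvable)
    fix L :: "(real \<times> 'a \<times> real) list"
    assume "\<forall>(\<mu>, h, r)\<in>set L. 0 \<le> \<mu> \<and> \<mu> \<in> \<rat> \<and> (h, r) \<in> insert (- (p - w), - \<beta>) A"
    \<comment> \<open>All copies of the constraint at the target are collected into one rational
      weight \<tau>; the remaining constraints become quadruples.\<close>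
    then have "\<exists>zs \<tau>. \<tau> \<in> \<rat> \<and>
      (\<forall>(\<mu>, e, d, u) \<in> set zs. 0 \<le> \<mu> \<and> \<mu> \<in> \<rat> \<and> f u < \<infinity> \<and> norm (u - w) < d \<and> (\<exists>n. e = \<epsilon> n \<and> d = \<delta> n)) \<and>
      (\<Sum>(\<mu>, h, r)\<leftarrow>L. \<mu> * r) = (\<Sum>(\<mu>, e, d, u)\<leftarrow>zs. \<mu> * (fr u + e * norm (u - w))) - (\<Sum>(\<mu>, e)\<leftarrow>weights zs. \<mu>) * fr w - \<tau> * \<beta> \<and>
      (\<Sum>(\<mu>, h, r)\<leftarrow>L. \<mu> *\<^sub>R h) = (\<Sum>(\<mu>, e, d, u)\<leftarrow>zs. \<mu> *\<^sub>R (u - w)) - \<tau> *\<^sub>R (p - w)"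
    proof (induction L)
      case Nil
      show ?case by (intro exI[of _ "[]"] exI[of _ 0]) (simp add: weights_def)
    next
      case (Cons x L)
      obtain \<mu> h r where x: "x = (\<mu>, h, r)" by (cases x)
      from Cons obtain zs \<tau> where IH: "\<tau> \<in> \<rat>"
        "\<forall>(\<mu>, e, d, u) \<in> set zs. 0 \<le> \<mu> \<and> \<mu> \<in> \<rat> \<and> f u < \<infinity> \<and> norm (u - w) < d \<and> (\<exists>n. e = \<epsilon> n \<and> d = \<delta> n)"
        "(\<Sum>(\<mu>, h, r)\<leftarrow>L. \<mu> * r) = (\<Sum>(\<mu>, e, d, u)\<leftarrow>zs. \<mu> * (fr u + e * norm (u - w))) - (\<Sum>(\<mu>, e)\<leftarrow>weights zs. \<mu>) * fr w - \<tau> * \<beta>"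
        "(\<Sum>(\<mu>, h, r)\<leftarrow>L. \<mu> *\<^sub>R h) = (\<Sum>(\<mu>, e, d, u)\<leftarrow>zs. \<mu> *\<^sub>R (u - w)) - \<tau> *\<^sub>R (p - w)"
        by auto
      have \<mu>: "0 \<le> \<mu>" "\<mu> \<in> \<rat>" and "(h, r) \<in> insert (- (p - w), - \<beta>) A" using Cons.prems x by auto
      then consider "h = - (p - w)" "r = - \<beta>"
        | u n where "h = u - w" "r = fr u - fr w + \<epsilon> n * norm (u - w)" "f u < \<infinity>" "norm (u - w) < \<delta> n"
        by (auto simp: A_def)
      then show ?case
      proof cases
        case 1
        show ?thesis
          by (intro exI[of _ zs] exI[of _ "\<tau> + \<mu>"] conjI IH(2))
            (auto simp: x 1 IH(1,3,4) \<mu> algebra_simps)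
      next
        case 2
        show ?thesis
          by (intro exI[of _ "(\<mu>, \<epsilon> n, \<delta> n, u) # zs"] exI[of _ \<tau>] conjI IH(1))
            (use IH(2) 2(3,4) \<mu> in \<open>auto simp: x 2(1,2) IH(3,4) weights_def algebra_simps\<close>)
      qed
    qed
    then obtain zs \<tau> where \<tau>: "\<tau> \<in> \<rat>"
      and zs: "\<forall>(\<mu>, e, d, u) \<in> set zs. 0 \<le> \<mu> \<and> \<mu> \<in> \<rat> \<and> f u < \<infinity> \<and> norm (u - w) < d \<and> (\<exists>n. e = \<epsilon> n \<and> d = \<delta> n)"
      and sums: "(\<Sum>(\<mu>, h, r)\<leftarrow>L. \<mu> * r) = (\<Sum>(\<mu>, e, d, u)\<leftarrow>zs. \<mu> * (fr u + e * norm (u - w))) - (\<Sum>(\<mu>, e)\<leftarrow>weights zs. \<mu>) * fr w - \<tau> * \<beta>"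
        "(\<Sum>(\<mu>, h, r)\<leftarrow>L. \<mu> *\<^sub>R h) = (\<Sum>(\<mu>, e, d, u)\<leftarrow>zs. \<mu> *\<^sub>R (u - w)) - \<tau> *\<^sub>R (p - w)"
      by (elim exE conjE)
    define M where "M = (\<Sum>(\<mu>, e)\<leftarrow>weights zs. \<mu>) * fr w + \<tau> * \<beta>"
    have "M \<le> penalty f p (real c) \<tau> zs w"
    proof (rule ccontr)
      assume "\<not> M \<le> penalty f p (real c) \<tau> zs w"
      then have less: "penalty f p (real c) \<tau> zs w < M" by simp
      have zs_ok: "\<forall>(\<mu>, e, d, u) \<in> set zs. 0 \<le> \<mu> \<and> 0 \<le> e \<and> \<mu> \<in> \<rat> \<and> e \<in> \<rat> \<and> d \<in> \<rat> \<and> f u < \<infinity> \<and> norm (u - w) < d"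
        using zs \<epsilon> \<delta> by (fastforce simp: less_imp_le)
      obtain zs' where zs': "points zs' \<subseteq> S" "weights zs' = weights zs" "penalty f p (real c) \<tau> zs' w < M"
        "\<forall>(\<mu>, e, d', u) \<in> set zs'. f u < \<infinity> \<and> (\<exists>d u'. (\<mu>, e, d, u') \<in> set zs \<and> norm (u - w) < d)"
        using penalty_violation_in_countable[OF S w \<tau> zs_ok less] by (elim exE conjE)
      have sub': "0 \<le> \<mu> \<and> u \<in> closure S \<and> g (u - w) \<le> fr u - fr w + e * norm (u - w)"
        if mem: "(\<mu>, e, d', u) \<in> set zs'" for \<mu> e d' u
      proof -
        obtain d u' where d: "f u < \<infinity>" "(\<mu>, e, d, u') \<in> set zs" "norm (u - w) < d"
          using bspec[OF zs'(4) mem] by auto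
        then obtain n where n: "0 \<le> \<mu>" "e = \<epsilon> n" "d = \<delta> n" using bspec[OF zs d(2)] by auto
        have u: "u \<in> closure S" using zs'(1) mem closure_subset[of S] by force
        have "f w + ereal (g (u - w) - e * norm (u - w)) \<le> f u" using \<delta>_sub[OF u] d(3) n by simp
        then show ?thesis using n u fr[OF fw] fr[OF d(1)] by simp
      qed
      \<comment> \<open>The inequalities satisfied by \<open>g\<close> at the single points of
        \<open>S\<close> are added up with their weights.\<close>
      have "(\<Sum>(\<mu>, e, d, u)\<leftarrow>zs'. \<mu> *\<^sub>R (u - w)) \<in> closure S \<and> g (\<Sum>(\<mu>, e, d, u)\<leftarrow>zs'. \<mu> *\<^sub>R (u - w))
          \<le> (\<Sum>(\<mu>, e, d, u)\<leftarrow>zs'. \<mu> * (fr u + e * norm (u - w))) - (\<Sum>(\<mu>, e)\<leftarrow>weights zs'. \<mu>) * fr w"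
        using sub'
      proof (induction zs')
        case Nil
        show ?case using subspace_dualD(2)[OF g w, of 0] subspace_0[OF Y] by (simp add: weights_def)
      next
        case (Cons z zs)
        obtain \<mu> e d u where z: "z = (\<mu>, e, d, u)" by (cases z)
        define H where "H = (\<Sum>(\<mu>, e, d, u)\<leftarrow>zs. \<mu> *\<^sub>R (u - w))"
        have IH: "H \<in> closure S" "g H \<le> (\<Sum>(\<mu>, e, d, u)\<leftarrow>zs. \<mu> * (fr u + e * norm (u - w))) - (\<Sum>(\<mu>, e)\<leftarrow>weights zs. \<mu>) * fr w"
          using Cons.IH Cons.prems unfolding H_def by (meson list.set_intros(2))+
        have z': "0 \<le> \<mu>" "u \<in> closure S" "g (u - w) \<le> fr u - fr w + e * norm (u - w)"
          using Cons.prems[of \<mu> e d u] z by auto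
        have uw: "u - w \<in> closure S" by (rule subspace_diff[OF Y z'(2) w])
        have "g (\<mu> *\<^sub>R (u - w) + H) = \<mu> * g (u - w) + g H"
          using subspace_dualD(1)[OF g subspace_scale[OF Y uw] IH(1)] subspace_dualD(2)[OF g uw] by simp
        also have "\<dots> \<le> \<mu> * (fr u - fr w + e * norm (u - w)) + g H" using mult_left_mono[OF z'(3,1)] by simp
        finally show ?case
          using IH(2) subspace_add[OF Y subspace_scale[OF Y uw] IH(1)]
          by (simp add: z H_def weights_def algebra_simps)
      qed
      then obtain H where H: "H = (\<Sum>(\<mu>, e, d, u)\<leftarrow>zs'. \<mu> *\<^sub>R (u - w))" "H \<in> closure S"
        "g H \<le> (\<Sum>(\<mu>, e, d, u)\<leftarrow>zs'. \<mu> * (fr u + e * norm (u - w))) - (\<Sum>(\<mu>, e)\<leftarrow>weights zs. \<mu>) * fr w"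
        by (simp add: zs'(2))
      have pw: "p - w \<in> closure S" by (rule subspace_diff[OF Y p w])
      have "g (H - \<tau> *\<^sub>R (p - w)) = g H - \<tau> * \<beta>"
        using subspace_dual_diff[OF g Y H(2) subspace_scale[OF Y pw]] subspace_dualD(2)[OF g pw] by (simp add: \<beta>_def)
      moreover have "- (real c * norm (H - \<tau> *\<^sub>R (p - w))) \<le> g (H - \<tau> *\<^sub>R (p - w))"
        using gc[OF subspace_diff[OF Y H(2) subspace_scale[OF Y pw]], of \<tau>] by linarith
      ultimately have "M \<le> penalty f p (real c) \<tau> zs' w"
        using H(3) unfolding penalty_def M_def H(1) fr_def[symmetric] by linarith
      then show False using zs'(3) by simp
    qed
    then show "0 \<le> (\<Sum>(\<mu>, h, r)\<leftarrow>L. \<mu> * r) + real c * norm (\<Sum>(\<mu>, h, r)\<leftarrow>L. \<mu> *\<^sub>R h)"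
      unfolding sums penalty_def M_def fr_def[symmetric] by linarith
  qed simp
  then obtain xs :: "'a \<Rightarrow>\<^sub>L real" where xs: "\<And>h r. (h, r) \<in> insert (- (p - w), - \<beta>) A \<Longrightarrow> blinfun_apply xs h \<le> r"
    by blast
  have "blinfun_apply xs (- (p - w)) \<le> - \<beta>" by (rule xs) simp
  then have "0 < blinfun_apply xs (p - w)" using pos unfolding \<beta>_def blinfun.minus_right by linarith
  moreover have "\<exists>d>0. \<forall>y. norm (y - w) < d \<longrightarrow> f w + ereal (blinfun_apply xs (y - w) - e * norm (y - w)) \<le> f y"
    if e: "0 < e" for e
  proof -
    obtain n where n: "\<epsilon> n < e" using reals_Archimedean[OF e] by (auto simp: \<epsilon>_def inverse_eq_divide)
    have "f w + ereal (blinfun_apply xs (y - w) - e * norm (y - w)) \<le> f y" if y: "norm (y - w) < \<delta> n" for y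
    proof (cases "f y < \<infinity>")
      case True
      have "blinfun_apply xs (y - w) \<le> fr y - fr w + \<epsilon> n * norm (y - w)"
        by (rule xs) (use True y in \<open>auto simp: A_def\<close>)
      moreover have "\<epsilon> n * norm (y - w) \<le> e * norm (y - w)" using n by (intro mult_right_mono) auto
      ultimately show ?thesis using fr[OF fw] fr[OF True] by simp
    qed simp
    then show ?thesis using \<delta>(2) by blast
  qed
  ultimately show ?thesis using fw frechet_subdiff_iff[where f = f and v = xs and x = w, OF f] by blast
qed

text \<open>The set \<open>S\<close> is generated from \<open>a\<close> and \<open>b\<close> with
  the target \<open>p\<close> as a parameter of the penalty; \<open>p\<close> lies in its closure as
  a linear combination of the two. The Asplund property is applied to this closure.\<close>

theorem mean_value_asplund:
  fixes f :: "'a::banach \<Rightarrow> ereal"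
  assumes X: "asplund TYPE('a)" and f: "lsc_fun f" "\<And>x. f x \<noteq> -\<infinity>" and ab: "f a < f b"
    and s: "0 < s" and p: "p = b + s *\<^sub>R (b - a)" and \<epsilon>: "0 < \<epsilon>"
  shows "\<exists>w t. \<exists>xs\<in>frechet_subdiff f w. 0 \<le> t \<and> t \<le> 1 \<and> norm (w - (a + t *\<^sub>R (b - a))) < \<epsilon> \<and>
    0 < blinfun_apply xs (p - w)"
proof -
  have "\<exists>S. countable S \<and> {a, b} \<subseteq> S \<and> (\<forall>x\<in>S. \<forall>y\<in>S. x + y \<in> S) \<and> (\<forall>r::rat. \<forall>x\<in>S. real_of_rat r *\<^sub>R x \<in> S) \<and>
    (\<forall>i. \<forall>v\<in>S. (\<exists>zs. realises f p i v zs) \<longrightarrow> (\<exists>zs. points zs \<subseteq> S \<and> realises f p i v zs))"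
    by (rule countable_closure_under_choices) (auto simp: countable_finite)
  then obtain S where S: "countable S" "{a, b} \<subseteq> S" "\<forall>x\<in>S. \<forall>y\<in>S. x + y \<in> S"
    "\<forall>r::rat. \<forall>x\<in>S. real_of_rat r *\<^sub>R x \<in> S"
    and choice: "\<forall>i. \<forall>v\<in>S. (\<exists>zs. realises f p i v zs) \<longrightarrow> (\<exists>zs. points zs \<subseteq> S \<and> realises f p i v zs)"
    by (elim exE conjE)
  have Y: "subspace (closure S)" using S by (intro subspace_closure_rational) auto
  have sep: "separable_set (closure S)" unfolding separable_set_def using S(1) closure_subset by blast
  have dual: "separable_dual (closure S)" using X Y sep by (simp add: asplund_def)
  have aY: "a \<in> closure S" and bY: "b \<in> closure S" using S(2) closure_subset by auto
  have pY: "p \<in> closure S" unfolding p by (intro subspace_add subspace_scale subspace_diff Y aY bY)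
  obtain w g t where w: "w \<in> closure S" and g: "g \<in> subspace_dual (closure S)" and t: "t \<in> {0..1}"
    and near: "norm (w - (a + t *\<^sub>R (b - a))) < \<epsilon>" and fw: "f w < \<infinity>" and pos: "0 < g (p - w)"
    and sub: "\<And>e. 0 < e \<Longrightarrow> \<exists>\<delta>>0. \<forall>u\<in>closure S. norm (u - w) < \<delta> \<longrightarrow>
      f w + ereal (g (u - w) - e * norm (u - w)) \<le> f u"
    using mean_value_separable_dual[OF Y closed_closure sep dual f aY bY ab s p \<epsilon>] by blast
  have "\<exists>xs\<in>frechet_subdiff f w. 0 < blinfun_apply xs (p - w)"
    by (rule subgradient_lift[OF f(2) choice Y w pY g fw pos sub])
  then show ?thesis using near t by (metis atLeastAtMost_iff)
qed

section \<open>Robust quasiconvexity\<close>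

lemma lsc_fun_tilt:
  fixes f :: "'a::real_normed_vector \<Rightarrow> ereal"
  assumes f: "lsc_fun f" "\<And>x. f x \<noteq> -\<infinity>"
  shows "lsc_fun (tilt f v)"
  unfolding lsc_fun_def
proof
  fix x
  show "tilt f v x \<le> Liminf (at x) (tilt f v)"
    unfolding le_Liminf_iff
  proof (intro allI impI)
    fix c assume "c < tilt f v x"
    then obtain z where z: "c < ereal z" "ereal z < tilt f v x" using ereal_dense2 by blast
    obtain z' where z': "ereal z < ereal z'" "ereal z' < tilt f v x" using ereal_dense2[OF z(2)] by blast
    have "ereal (z' - blinfun_apply v x) < f x" using z'(2) by (cases "f x") (auto simp: tilt_def)
    moreover have "f x \<le> Liminf (at x) f" using f(1) by (simp add: lsc_fun_def)
    ultimately have "\<forall>\<^sub>F y in at x. ereal (z' - blinfun_apply v x) < f y" by (simp add: le_Liminf_iff)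
    moreover have "\<forall>\<^sub>F y in at x. blinfun_apply v x - (z' - z) < blinfun_apply v y"
    proof (rule order_tendstoD(1))
      show "(blinfun_apply v \<longlongrightarrow> blinfun_apply v x) (at x)" by (intro tendsto_intros)
    qed (use z' in simp)
    ultimately show "\<forall>\<^sub>F y in at x. c < tilt f v y"
    proof eventually_elim
      case (elim y)
      have "ereal z < tilt f v y" using elim by (cases "f y") (auto simp: tilt_def)
      with z(1) show ?case by simp
    qed
  qed
qed

lemma frechet_subdiff_tilt:
  fixes f :: "'a::real_normed_vector \<Rightarrow> ereal"
  assumes f: "\<And>x. f x \<noteq> -\<infinity>"
  shows "xs \<in> frechet_subdiff (tilt f v) x \<longleftrightarrow> xs - v \<in> frechet_subdiff f x"
proof -
  have t: "tilt f v x \<noteq> -\<infinity>" for x using f[of x] by (cases "f x") (auto simp: tilt_def)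
  have fin: "tilt f v x < \<infinity> \<longleftrightarrow> f x < \<infinity>" by (cases "f x") (auto simp: tilt_def)
  have "tilt f v x + ereal (blinfun_apply xs (y - x) - e * norm (y - x)) \<le> tilt f v y \<longleftrightarrow>
      f x + ereal (blinfun_apply (xs - v) (y - x) - e * norm (y - x)) \<le> f y" for y e
    by (cases "f x"; cases "f y") (auto simp: tilt_def blinfun.diff_left blinfun.diff_right algebra_simps)
  then show ?thesis unfolding frechet_subdiff_iff[of "tilt f v", OF t] frechet_subdiff_iff[of f, OF f] fin by simp
qed

text \<open>Otherwise quasiconvexity bounds \<open>f\<close> by its value at \<open>x\<close> on the
  segment to \<open>y\<close>, whereas the subgradient, with an error of half its slope, makes
  \<open>f\<close> grow along the segment near \<open>x\<close>.\<close>

lemma quasiconvex_subgradient_increasing: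
  fixes f :: "'a::real_normed_vector \<Rightarrow> ereal"
  assumes f: "\<And>x. f x \<noteq> -\<infinity>" and qc: "quasiconvex_fun f" and xs: "xs \<in> frechet_subdiff f x"
    and pos: "0 < blinfun_apply xs (y - x)"
  shows "f x < f y"
proof (rule ccontr)
  assume "\<not> f x < f y"
  then have yx: "f y \<le> f x" by simp
  define a where "a = blinfun_apply xs (y - x)"
  have ny: "0 < norm (y - x)" using pos by auto
  define e where "e = a / (2 * norm (y - x))"
  have e: "0 < e" using pos ny by (simp add: e_def a_def)
  have fx: "f x < \<infinity>" using xs frechet_subdiff_iff[where f = f, OF f] by blast
  obtain \<delta> where \<delta>: "0 < \<delta>"
    "\<And>z. norm (z - x) < \<delta> \<Longrightarrow> f x + ereal (blinfun_apply xs (z - x) - e * norm (z - x)) \<le> f z"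
    using xs e frechet_subdiff_iff[where f = f and v = xs and x = x, OF f] by blast
  define t where "t = min (1/2) (\<delta> / (2 * norm (y - x)))"
  have t: "0 < t" "t < 1" "t * norm (y - x) < \<delta>"
  proof -
    show "0 < t" "t < 1" using \<delta>(1) ny by (auto simp: t_def)
    have "t \<le> \<delta> / (2 * norm (y - x))" by (simp add: t_def)
    then have "t * norm (y - x) \<le> \<delta> / 2" using ny by (simp add: field_simps)
    then show "t * norm (y - x) < \<delta>" using \<delta>(1) by simp
  qed
  define z where "z = t *\<^sub>R y + (1 - t) *\<^sub>R x"
  have zx: "z - x = t *\<^sub>R (y - x)" by (simp add: z_def algebra_simps)
  have "f z \<le> max (f y) (f x)" using qc t unfolding quasiconvex_fun_def z_def by blast
  then have "f z \<le> f x" using yx by simp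
  moreover have "f x + ereal (blinfun_apply xs (z - x) - e * norm (z - x)) \<le> f z"
    using t by (intro \<delta>(2)) (simp add: zx)
  moreover have "blinfun_apply xs (z - x) - e * norm (z - x) = t * a / 2"
  proof -
    have "blinfun_apply xs (z - x) = t * a" by (simp add: zx blinfun.scaleR_right a_def)
    moreover have "e * norm (z - x) = t * a / 2" using t(1) ny by (simp add: zx e_def)
    ultimately show ?thesis by simp
  qed
  moreover have "0 < t * a / 2" using t pos by (simp add: a_def)
  ultimately show False using fx f[of x] by (cases "f x"; cases "f z") auto
qed

lemma robustly_quasiconvex_imp_monotone:
  fixes f :: "'a::real_normed_vector \<Rightarrow> ereal"
  assumes f: "\<And>x. f x \<noteq> -\<infinity>" and rq: "robustly_quasiconvex \<alpha> f" and \<alpha>: "0 < \<alpha>"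
    and xs: "xs \<in> frechet_subdiff f x" and ys: "ys \<in> frechet_subdiff f y"
    and min: "- \<alpha> * norm (y - x) < min (blinfun_apply xs (y - x)) (blinfun_apply ys (x - y))"
  shows "0 \<le> blinfun_apply (xs - ys) (x - y)"
proof (rule ccontr)
  assume neg: "\<not> 0 \<le> blinfun_apply (xs - ys) (x - y)"
  define a where "a = blinfun_apply xs (y - x)"
  define b where "b = blinfun_apply ys (x - y)"
  define n where "n = norm (y - x)"
  have swap: "blinfun_apply u (x - y) = - blinfun_apply u (y - x)" for u :: "'a \<Rightarrow>\<^sub>L real"
    by (simp add: blinfun.diff_right)
  have "- a < b" using neg by (simp add: a_def b_def blinfun.diff_left swap)
  moreover have "- (\<alpha> * n) < a" "- (\<alpha> * n) < b" using min by (auto simp: a_def b_def n_def)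
  moreover have "0 \<le> \<alpha> * n" using \<alpha> by (simp add: n_def)
  \<comment> \<open>The value \<open>t\<close> of the tilt at y - x has to satisfy a + t > 0, b - t
    > 0 and |t| \<le> \<alpha> n. The hypothesis and the negated conclusion make this range nonempty
    unless \<alpha> n = 0.\<close>
  ultimately have "max (- a) (- (\<alpha> * n)) < min b (\<alpha> * n) \<or> \<alpha> * n = 0" by auto
  moreover have "\<alpha> * n \<noteq> 0"
  proof
    assume "\<alpha> * n = 0"
    then have "y = x" using \<alpha> by (simp add: n_def)
    then show False using neg by simp
  qed
  ultimately obtain t where "max (- a) (- (\<alpha> * n)) < t" "t < min b (\<alpha> * n)" using dense by blast
  then have t: "- a < t" "t < b" "\<bar>t\<bar> \<le> \<alpha> * n" by auto
  then obtain v :: "'a \<Rightarrow>\<^sub>L real" where v: "norm v \<le> \<alpha>" "blinfun_apply v (y - x) = t"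
    using functional_with_value[of t \<alpha> "y - x"] \<alpha> by (auto simp: n_def)
  have qc: "quasiconvex_fun (tilt f v)" using rq v(1) by (simp add: robustly_quasiconvex_def)
  have tl: "tilt f v z \<noteq> -\<infinity>" for z using f[of z] by (cases "f z") (auto simp: tilt_def)
  have "tilt f v x < tilt f v y"
  proof (rule quasiconvex_subgradient_increasing[OF tl qc])
    show "xs + v \<in> frechet_subdiff (tilt f v) x" using xs by (simp add: frechet_subdiff_tilt[of f, OF f])
    show "0 < blinfun_apply (xs + v) (y - x)" using t v(2) by (simp add: blinfun.add_left a_def)
  qed
  moreover have "tilt f v y < tilt f v x"
  proof (rule quasiconvex_subgradient_increasing[OF tl qc])
    show "ys + v \<in> frechet_subdiff (tilt f v) y" using ys by (simp add: frechet_subdiff_tilt[of f, OF f])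
    show "0 < blinfun_apply (ys + v) (x - y)" using t v(2) by (simp add: blinfun.add_left b_def[symmetric] swap[of v])
  qed
  ultimately show False by simp
qed

text \<open>The first subgradient, at \<open>u\<close> near the part of the segment before the peak
  \<open>z\<close>, is aimed at \<open>y\<close>. The segment from \<open>u\<close> to
  \<open>y\<close> still passes near the peak, at \<open>z'\<close>; the second application runs
  from \<open>y\<close> to \<open>z'\<close> and is aimed at \<open>u\<close>. The new point
  \<open>w\<close> lies near that piece, where the first subgradient is still positive.\<close>

lemma not_quasiconvex_opposing_subgradients:
  fixes f :: "'a::banach \<Rightarrow> ereal"
  assumes X: "asplund TYPE('a)" and f: "lsc_fun f" "\<And>x. f x \<noteq> -\<infinity>" and nqc: "\<not> quasiconvex_fun f"
  shows "\<exists>u w. \<exists>us\<in>frechet_subdiff f u. \<exists>ws\<in>frechet_subdiff f w.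
    0 < blinfun_apply us (w - u) \<and> 0 < blinfun_apply ws (u - w)"
proof -
  obtain x y t where t: "0 < t" "t < (1::real)" and gt: "max (f x) (f y) < f (t *\<^sub>R x + (1 - t) *\<^sub>R y)"
    using nqc by (auto simp: quasiconvex_fun_def not_le)
  define \<zeta> where "\<zeta> = 1 - t"
  define line where "line q = x + q *\<^sub>R (y - x)" for q :: real
  define z where "z = line \<zeta>"
  have \<zeta>: "0 < \<zeta>" "\<zeta> < 1" using t by (auto simp: \<zeta>_def)
  have "z = t *\<^sub>R x + (1 - t) *\<^sub>R y" by (simp add: z_def line_def \<zeta>_def algebra_simps)
  then have fz: "max (f x) (f y) < f z" using gt by simp
  obtain \<eta> where \<eta>: "0 < \<eta>" "\<And>u. norm (u - z) < \<eta> \<Longrightarrow> max (f x) (f y) < f u"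
    using lsc_fun_nhds[OF f(1) fz] by blast
  define n where "n = norm (y - x) + 1"
  have n: "0 < n" by (simp add: n_def add_nonneg_pos)
  \<comment> \<open>Stopping strictly before the peak keeps the peak strictly ahead of
    \<open>u\<close>, that is \<theta> < \<zeta> and \<sigma> > 0.\<close>
  define \<xi> where "\<xi> = \<zeta> - min (\<zeta> / 2) (\<eta> / (2 * n))"
  have "0 < min (\<zeta> / 2) (\<eta> / (2 * n))" "min (\<zeta> / 2) (\<eta> / (2 * n)) \<le> \<zeta> / 2" using \<zeta> \<eta>(1) n by auto
  then have \<xi>: "0 < \<xi>" "\<xi> < \<zeta>" using \<zeta> unfolding \<xi>_def by linarith+
  have near_z: "norm (line \<xi> - z) < \<eta>"
  proof -
    have "line \<xi> - z = (\<xi> - \<zeta>) *\<^sub>R (y - x)" by (simp add: z_def line_def algebra_simps)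
    then have "norm (line \<xi> - z) = (\<zeta> - \<xi>) * norm (y - x)" using \<xi> by simp
    also have "\<dots> \<le> (\<zeta> - \<xi>) * n" using \<xi> by (simp add: n_def)
    also have "\<dots> \<le> \<eta> / (2 * n) * n" using n by (intro mult_right_mono) (auto simp: \<xi>_def)
    also have "\<dots> < \<eta>" using n \<eta>(1) by simp
    finally show ?thesis .
  qed
  have "f x < f (line \<xi>)" using \<eta>(2)[OF near_z] by simp
  moreover have "y = line \<xi> + ((1 - \<xi>) / \<xi>) *\<^sub>R (line \<xi> - x)"
  proof -
    have "((1 - \<xi>) / \<xi>) *\<^sub>R (line \<xi> - x) = (1 - \<xi>) *\<^sub>R (y - x)" using \<xi> by (simp add: line_def)
    then show ?thesis by (simp add: line_def algebra_simps)
  qed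
  moreover have "0 < (1 - \<xi>) / \<xi>" using \<xi> \<zeta> by simp
  ultimately obtain u \<tau> us where us: "us \<in> frechet_subdiff f u" and \<tau>: "0 \<le> \<tau>" "\<tau> \<le> 1"
    and nu: "norm (u - (x + \<tau> *\<^sub>R (line \<xi> - x))) < \<eta>" and pos: "0 < blinfun_apply us (y - u)"
    using mean_value_asplund[OF X f _ _ _ \<eta>(1)] by blast
  define \<theta> where "\<theta> = \<tau> * \<xi>"
  have \<theta>: "0 \<le> \<theta>" "\<theta> < \<zeta>"
  proof -
    show "0 \<le> \<theta>" using \<tau> \<xi> by (simp add: \<theta>_def)
    have "\<tau> * \<xi> \<le> 1 * \<xi>" using \<tau> \<xi> by (intro mult_right_mono) auto
    then show "\<theta> < \<zeta>" using \<xi>(2) unfolding \<theta>_def by linarith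
  qed
  have nu': "norm (u - line \<theta>) < \<eta>" using nu by (simp add: line_def \<theta>_def)
  \<comment> \<open>With this ratio \<open>z'\<close> would equal \<open>z\<close> if
    \<open>u\<close> lay on the line; otherwise its deviation is that of \<open>u\<close> shrunk by
    1 - \<sigma>.\<close>
  define \<sigma> where "\<sigma> = (\<zeta> - \<theta>) / (1 - \<theta>)"
  have \<sigma>: "0 < \<sigma>" "\<sigma> < 1" using \<theta> \<zeta> by (auto simp: \<sigma>_def field_simps)
  define z' where "z' = u + \<sigma> *\<^sub>R (y - u)"
  have z'z: "z' - z = (1 - \<sigma>) *\<^sub>R (u - line \<theta>)"
  proof -
    have "\<sigma> * (1 - \<theta>) = \<zeta> - \<theta>" using \<theta> \<zeta> by (simp add: \<sigma>_def)
    then have \<zeta>_eq: "\<zeta> = \<theta> + \<sigma> * (1 - \<theta>)" by simp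
    show ?thesis unfolding z'_def z_def line_def \<zeta>_eq by (simp add: algebra_simps)
  qed
  have "norm (z' - z) \<le> norm (u - line \<theta>)" unfolding z'z using \<sigma> by (simp add: mult_left_le_one_le)
  then have "f y < f z'" using \<eta>(2)[of z'] nu' by simp
  moreover have "u = z' + (\<sigma> / (1 - \<sigma>)) *\<^sub>R (z' - y)"
  proof -
    have "z' - y = (1 - \<sigma>) *\<^sub>R (u - y)" by (simp add: z'_def algebra_simps)
    then have "(\<sigma> / (1 - \<sigma>)) *\<^sub>R (z' - y) = \<sigma> *\<^sub>R (u - y)" using \<sigma> by simp
    then show ?thesis by (simp add: z'_def algebra_simps)
  qed
  moreover have "0 < \<sigma> / (1 - \<sigma>)" using \<sigma> by simp
  moreover define \<beta> where "\<beta> = blinfun_apply us (y - u)"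
  \<comment> \<open>Between \<open>y\<close> and \<open>z'\<close> the first subgradient takes
    values at least \<sigma> \<beta> relative to \<open>u\<close>; this tolerance changes them by
    less than that.\<close>
  moreover define e where "e = \<sigma> * \<beta> / (norm us + 1)"
  moreover have n1: "0 < norm us + 1" by (simp add: add_nonneg_pos)
  moreover have e: "0 < e" using \<sigma> pos n1 by (simp add: e_def \<beta>_def)
  ultimately obtain w q ws where ws: "ws \<in> frechet_subdiff f w" and q: "0 \<le> q" "q \<le> 1"
    and nw: "norm (w - (y + q *\<^sub>R (z' - y))) < e" and pos': "0 < blinfun_apply ws (u - w)"
    using mean_value_asplund[OF X f _ _ _ e] by blast
  define k where "k = y + q *\<^sub>R (z' - y)"
  have "0 < blinfun_apply us (w - u)"
  proof -
    have "k - u = (1 - q * (1 - \<sigma>)) *\<^sub>R (y - u)" by (simp add: k_def z'_def algebra_simps)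
    then have "blinfun_apply us (k - u) = (1 - q * (1 - \<sigma>)) * \<beta>" by (simp add: blinfun.scaleR_right \<beta>_def)
    moreover have "\<sigma> \<le> 1 - q * (1 - \<sigma>)"
      using mult_right_mono[of q 1 "1 - \<sigma>"] q(2) \<sigma>(2) by (simp add: algebra_simps)
    ultimately have 1: "\<sigma> * \<beta> \<le> blinfun_apply us (k - u)" using pos by (simp add: \<beta>_def mult_right_mono)
    have "\<bar>blinfun_apply us (w - k)\<bar> \<le> norm us * norm (w - k)" using norm_blinfun[of us "w - k"] by simp
    also have "\<dots> \<le> norm us * e" using nw by (intro mult_left_mono) (auto simp: k_def)
    also have "\<dots> < (norm us + 1) * e" using e by simp
    also have "\<dots> = \<sigma> * \<beta>" using n1 by (simp add: e_def)
    finally have "\<bar>blinfun_apply us (w - k)\<bar> < \<sigma> * \<beta>" .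
    moreover have "blinfun_apply us (w - u) = blinfun_apply us (w - k) + blinfun_apply us (k - u)"
      by (simp flip: blinfun.add_right)
    ultimately show ?thesis using 1 by linarith
  qed
  then show ?thesis using us ws pos' by blast
qed

theorem theorem3p2:
  fixes \<phi> :: "'a::banach \<Rightarrow> ereal" and \<alpha> :: real
  assumes "asplund TYPE('a)"
    and "proper_fun \<phi>"
    and "lsc_fun \<phi>"
    and "\<alpha> > 0"
  shows "robustly_quasiconvex \<alpha> \<phi> \<longleftrightarrow>
    (\<forall>x y xs ys. xs \<in> frechet_subdiff \<phi> x \<longrightarrow> ys \<in> frechet_subdiff \<phi> y \<longrightarrow>
       min (blinfun_apply xs (y - x)) (blinfun_apply ys (x - y)) > - \<alpha> * norm (y - x) \<longrightarrow>
       blinfun_apply (xs - ys) (x - y) \<ge> 0)"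
proof
  have \<phi>: "\<phi> x \<noteq> -\<infinity>" for x using assms(2) by (simp add: proper_fun_def)
  {
    assume "robustly_quasiconvex \<alpha> \<phi>"
    then show "\<forall>x y xs ys. xs \<in> frechet_subdiff \<phi> x \<longrightarrow> ys \<in> frechet_subdiff \<phi> y \<longrightarrow>
       min (blinfun_apply xs (y - x)) (blinfun_apply ys (x - y)) > - \<alpha> * norm (y - x) \<longrightarrow>
       blinfun_apply (xs - ys) (x - y) \<ge> 0"
      using robustly_quasiconvex_imp_monotone[where f = \<phi>, OF \<phi> _ assms(4)] by blast
  next
    assume mono: "\<forall>x y xs ys. xs \<in> frechet_subdiff \<phi> x \<longrightarrow> ys \<in> frechet_subdiff \<phi> y \<longrightarrow>
       min (blinfun_apply xs (y - x)) (blinfun_apply ys (x - y)) > - \<alpha> * norm (y - x) \<longrightarrow>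
       blinfun_apply (xs - ys) (x - y) \<ge> 0"
    show "robustly_quasiconvex \<alpha> \<phi>"
      unfolding robustly_quasiconvex_def
    proof (intro allI impI, rule ccontr)
      fix v :: "'a \<Rightarrow>\<^sub>L real" assume v: "norm v \<le> \<alpha>" and nqc: "\<not> quasiconvex_fun (tilt \<phi> v)"
      have tl: "tilt \<phi> v z \<noteq> -\<infinity>" for z using \<phi>[of z] by (cases "\<phi> z") (auto simp: tilt_def)
      obtain u w us ws where us: "us \<in> frechet_subdiff (tilt \<phi> v) u" and ws: "ws \<in> frechet_subdiff (tilt \<phi> v) w"
        and pos: "0 < blinfun_apply us (w - u)" "0 < blinfun_apply ws (u - w)"
        using not_quasiconvex_opposing_subgradients[OF assms(1) lsc_fun_tilt[OF assms(3) \<phi>] tl nqc] by blast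
      have bd: "\<bar>blinfun_apply v h\<bar> \<le> \<alpha> * norm h" for h
        using norm_blinfun[of v h] mult_right_mono[OF v, of "norm h"] by simp
      have swap: "blinfun_apply f (u - w) = - blinfun_apply f (w - u)" for f :: "'a \<Rightarrow>\<^sub>L real"
        by (simp add: blinfun.diff_right)
      have "us - v \<in> frechet_subdiff \<phi> u" "ws - v \<in> frechet_subdiff \<phi> w"
        using us ws by (simp_all add: frechet_subdiff_tilt[of \<phi>, OF \<phi>])
      \<comment> \<open>Removing the tilt costs at most \<alpha> times the distance, exactly the
        slack in the premise.\<close>
      moreover have "- \<alpha> * norm (w - u) < min (blinfun_apply (us - v) (w - u)) (blinfun_apply (ws - v) (u - w))"
        using pos bd[of "w - u"] bd[of "u - w"] unfolding blinfun.diff_left min_less_iff_conj norm_minus_commute[of w u]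
        by linarith
      \<comment> \<open>The tilt cancels in the difference of the two subgradients, so the
        conclusion contradicts the signs of \<open>us\<close> and \<open>ws\<close>.\<close>
      ultimately have "0 \<le> blinfun_apply ((us - v) - (ws - v)) (u - w)" using mono by blast
      then show False using pos by (simp add: blinfun.diff_left swap)
    qed
  }
qed

end
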